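(* Let $\xi, \zeta$ be real quadratic numbers lying in distinct quadratic fields, and let $R_\xi$ and $R_\zeta$ denote the regulators of the number fields $\mathbf{Q}(\xi)$ and $\mathbf{Q}(\zeta)$, respectively. Then there exists an absolute, positive, effectively computable real number $c_1$ such that $$ \mu_{\rm eff}(\xi, \zeta) \le 2 - (c_1 R_\xi R_\zeta)^{-1}. $$ In particular, if $a, b$ are positive integers such that none of $a$, $b$, $ab$ is a perfect square, then there exists an absolute, positive, effectively computable real number $c_2$ such that $$ \mu_{\rm eff}(\sqrt a, \sqrt b) \le 2 - \bigl(c_2 \sqrt{ab}\, (\log a)(\log b)\bigr)^{-1}. $$
   Context: Let $\xi, \zeta$ be real numbers such that $1, \xi, \zeta$ are linearly independent over $\mathbf{Q}$ (this holds when $\xi,\zeta$ are real quadratic numbers in distinct quadratic fields). A real number $\mu$ is called an effective (simultaneous) irrationality measure for the pair $(\xi,\zeta)$ if there exists a positive, effectively computable real number $c(\xi,\zeta)$ such that for every integer triple $(p,q,r)$ with $q \ge 1$, $$ \max\Bigl\{ \Bigl|\xi - \frac{p}{q}\Bigr|, \Bigl|\zeta - \frac{r}{q}\Bigr| \Bigr\} > \frac{c(\xi,\zeta)}{q^{\mu}}. $$ The effective irrationality exponent $\mu_{\rm eff}(\xi,\zeta)$ is the infimum of all effective irrationality measures for the pair $(\xi,\zeta)$. *)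

theory Defs
  imports
    "HOL-Algebra.Generated_Fields"
    "HOL-Algebra.Algebraic_Closure_Type"
    "HOL-Computational_Algebra.Computational_Algebra"
    "HOL-Analysis.Analysis"
    "HOL-Library.Nat_Bijection"
begin

section \<open>Computability\<close>

text \<open>
  Total recursive functions, as unary functions over the pairing \<open>prod_encode\<close>. Minimisation is
  restricted to functions for which the search always succeeds.
\<close>

inductive recursive :: "(nat \<Rightarrow> nat) \<Rightarrow> bool" where
  zero: "recursive (\<lambda>_. 0)"
| suc: "recursive Suc"
| fst: "recursive (\<lambda>x. fst (prod_decode x))"
| snd: "recursive (\<lambda>x. snd (prod_decode x))"
| pair: "recursive f \<Longrightarrow> recursive g \<Longrightarrow> recursive (\<lambda>x. prod_encode (f x, g x))"
| comp: "recursive f \<Longrightarrow> recursive g \<Longrightarrow> recursive (\<lambda>x. f (g x))"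
| prim_rec: "recursive f \<Longrightarrow> recursive g \<Longrightarrow>
    recursive (\<lambda>x. case prod_decode x of (a, n) \<Rightarrow>
      rec_nat (f a) (\<lambda>k r. g (prod_encode (a, prod_encode (k, r)))) n)"
| minimize: "recursive f \<Longrightarrow> (\<And>x. \<exists>n. f (prod_encode (x, n)) = 0) \<Longrightarrow>
    recursive (\<lambda>x. LEAST n. f (prod_encode (x, n)) = 0)"

text \<open>
  A family of reals indexed by natural numbers is computable if one algorithm, given an index
  \<open>x\<close> and a precision \<open>k\<close>, returns a rational within \<open>1 / (k + 1)\<close> of its member at \<open>x\<close>.
\<close>

definition computable_family :: "(nat \<Rightarrow> real) \<Rightarrow> bool" where
  "computable_family h \<longleftrightarrow>
     (\<exists>f. recursive f \<and>
       (\<forall>x k. \<bar>h x - real_of_int (int_decode (f (prod_encode (x, k)))) / (real k + 1)\<bar>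
               \<le> 1 / (real k + 1)))"

definition computable_real :: "real \<Rightarrow> bool" where
  "computable_real c \<longleftrightarrow> computable_family (\<lambda>_. c)"


section \<open>Real quadratic numbers and regulators\<close>

definition quadratic_number :: "real \<Rightarrow> bool" where
  "quadratic_number \<xi> \<longleftrightarrow>
     (\<exists>p :: rat poly. Factorial_Ring.irreducible p \<and> Polynomial.degree p = 2 \<and>
        poly (map_poly of_rat p) \<xi> = 0)"

definition adjoin_Q :: "real \<Rightarrow> real set" where
  "adjoin_Q \<xi> = generate_field (ring_of_type_algebra :: real ring) {\<xi>}"

definition integer_units :: "real set \<Rightarrow> real set" where
  "integer_units K = {u \<in> K. u \<noteq> 0 \<and> algebraic_int u \<and> algebraic_int (inverse u)}"

definition fundamental_unit :: "real set \<Rightarrow> real \<Rightarrow> bool" where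
  "fundamental_unit K u \<longleftrightarrow> u \<in> integer_units K \<and>
     (\<forall>v \<in> integer_units K. \<exists>k :: int. v = u powi k \<or> v = - (u powi k))"

text \<open>
  The regulator of a real quadratic field \<open>K\<close>: the unit group has rank one and torsion \<open>{1, -1}\<close>,
  so the regulator determinant is the single entry \<open>\<bar>ln \<bar>u\<bar>\<bar>\<close> for a fundamental unit \<open>u\<close>. This
  is independent of the choice among \<open>u\<close>, \<open>-u\<close>, \<open>1/u\<close>, \<open>-1/u\<close>.
\<close>

definition regulator :: "real set \<Rightarrow> real" where
  "regulator K = (THE R. \<exists>u. fundamental_unit K u \<and> R = \<bar>ln \<bar>u\<bar>\<bar>)"

definition lin_indep_1_Q :: "real \<Rightarrow> real \<Rightarrow> bool" where
  "lin_indep_1_Q \<xi> \<zeta> \<longleftrightarrow>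
     (\<forall>x y z. x \<in> \<rat> \<longrightarrow> y \<in> \<rat> \<longrightarrow> z \<in> \<rat> \<longrightarrow> x + y * \<xi> + z * \<zeta> = 0 \<longrightarrow> x = 0 \<and> y = 0 \<and> z = 0)"

text \<open>
  The triple presenting a quadratic number to an algorithm: the coefficients of its primitive
  integral minimal polynomial \<open>a X\<^sup>2 + b X + c\<close>. The sign of \<open>a\<close> selects the root, so a quadratic
  number has exactly one code.
\<close>

definition quadratic_code :: "int \<times> int \<times> int \<Rightarrow> real \<Rightarrow> bool" where
  "quadratic_code = (\<lambda>(a, b, c) \<xi>. a \<noteq> 0 \<and> gcd a (gcd b c) = 1 \<and> b\<^sup>2 - 4 * a * c \<ge> 0 \<and>
     \<xi> = (- real_of_int b + sqrt (real_of_int (b\<^sup>2 - 4 * a * c))) / (2 * real_of_int a))"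


section \<open>Effective irrationality measures\<close>

definition approximation_bound :: "real \<Rightarrow> real \<Rightarrow> real \<Rightarrow> real \<Rightarrow> bool" where
  "approximation_bound \<xi> \<zeta> \<mu> c \<longleftrightarrow>
     (\<forall>p q r :: int. q \<ge> 1 \<longrightarrow>
        max \<bar>\<xi> - real_of_int p / real_of_int q\<bar> \<bar>\<zeta> - real_of_int r / real_of_int q\<bar>
          > c / (real_of_int q powr \<mu>))"

text \<open>
  For a single pair \<open>(\<xi>, \<zeta>)\<close>, the existence of a positive computable constant is no stronger than
  the existence of a positive constant, since the latter can be replaced by a smaller rational.
  What ``effectively computable'' means is that there is an algorithm computing \<open>c(\<xi>, \<zeta>)\<close> from
  \<open>\<xi>\<close>, \<open>\<zeta>\<close> and the exponent. A system of effective constants is such an algorithm: \<open>C u v \<mu>\<close>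
  is computable from the codes \<open>u\<close>, \<open>v\<close> of \<open>\<xi>\<close>, \<open>\<zeta>\<close> and a rational exponent \<open>\<mu>\<close>. A value that is
  not positive means that no constant is provided; every positive value is required to be an
  admissible constant for the exponent \<open>\<mu>\<close>, for all pairs.
\<close>

type_synonym constants = "int \<times> int \<times> int \<Rightarrow> int \<times> int \<times> int \<Rightarrow> rat \<Rightarrow> real"

definition decode_triple :: "nat \<Rightarrow> int \<times> int \<times> int" where
  "decode_triple n = (case prod_decode n of (a, m) \<Rightarrow> case prod_decode m of (b, c) \<Rightarrow>
     (int_decode a, int_decode b, int_decode c))"

definition decode_rat :: "nat \<Rightarrow> rat" where
  "decode_rat n = (case prod_decode n of (a, b) \<Rightarrow> of_int (int_decode a) / of_nat (Suc b))"

definition computable_constants :: "constants \<Rightarrow> bool" where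
  "computable_constants C \<longleftrightarrow>
     computable_family (\<lambda>n. case prod_decode n of (u, m) \<Rightarrow> case prod_decode m of (v, w) \<Rightarrow>
       C (decode_triple u) (decode_triple v) (decode_rat w))"

definition effective_constants :: "constants \<Rightarrow> bool" where
  "effective_constants C \<longleftrightarrow> computable_constants C \<and>
     (\<forall>\<xi> \<zeta> u v \<mu>. quadratic_number \<xi> \<longrightarrow> quadratic_number \<zeta> \<longrightarrow> lin_indep_1_Q \<xi> \<zeta> \<longrightarrow>
        quadratic_code u \<xi> \<longrightarrow> quadratic_code v \<zeta> \<longrightarrow> C u v \<mu> > 0 \<longrightarrow>
        approximation_bound \<xi> \<zeta> (of_rat \<mu>) (C u v \<mu>))"

text \<open>
  A real exponent \<open>\<mu>\<close> is an effective measure if \<open>C\<close> provides a constant for some rational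
  exponent \<open>\<nu> \<le> \<mu>\<close>; only rational exponents can be given to an algorithm, and a constant valid
  for \<open>\<nu>\<close> is valid for \<open>\<mu>\<close>.
\<close>

definition effective_irrationality_measure :: "constants \<Rightarrow> real \<Rightarrow> real \<Rightarrow> real \<Rightarrow> bool" where
  "effective_irrationality_measure C \<xi> \<zeta> \<mu> \<longleftrightarrow>
     (\<exists>u v \<nu>. quadratic_code u \<xi> \<and> quadratic_code v \<zeta> \<and> of_rat \<nu> \<le> \<mu> \<and>
        C u v \<nu> > 0 \<and> approximation_bound \<xi> \<zeta> \<mu> (C u v \<nu>))"

text \<open>Extended reals, so that the infimum is \<open>\<infinity>\<close> if there is no effective measure.\<close>

definition mu_eff :: "constants \<Rightarrow> real \<Rightarrow> real \<Rightarrow> ereal" where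
  "mu_eff C \<xi> \<zeta> = (INF \<mu> \<in> {\<mu>. effective_irrationality_measure C \<xi> \<zeta> \<mu>}. ereal \<mu>)"

end

theory Submission
  imports Defs
begin

text \<open>
  Let \<open>\<epsilon>\<close>, \<open>\<eta>\<close> be units of norm \<open>1\<close> in the two fields and let \<open>q\<xi> - p\<close>, \<open>q\<zeta> - r\<close> both be at most
  \<open>q powr (\<tau> - 1)\<close> in absolute value. Up to the denominator \<open>w\<close> of \<open>\<xi>\<close> in \<open>\<int>[\<epsilon>]\<close>, \<open>q\<xi> - p\<close> is
  the conjugate of an algebraic integer \<open>\<alpha>\<close> with \<open>\<alpha> - \<alpha>'\<close> a fixed multiple of \<open>q\<close>, and similarly
  \<open>q\<zeta> - r\<close> for \<open>\<beta>\<close>. So fixed multiples of \<open>\<alpha>\<close> and \<open>\<beta>\<close> are extremely close, whereas their conjugates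
  lie far below them. Choose \<open>d\<close>, \<open>d'\<close> with \<open>\<theta> = \<epsilon> ^ d / \<eta> ^ d'\<close> very close to \<open>1\<close>, and \<open>M\<close> with
  \<open>\<epsilon> ^ (M d)\<close> about \<open>q\<close>. Dividing by \<open>\<epsilon> ^ (M d)\<close> and \<open>\<eta> ^ (M d')\<close> yields integers \<open>U\<close>, \<open>V\<close> of the
  biquadratic field of small height with \<open>V / U\<close> extremely close to \<open>\<theta> ^ M\<close>. This contradicts a
  lower bound for linear forms in two logarithms, which for \<open>\<theta>\<close> close to \<open>1\<close> comes from an
  elementary interpolation argument. The pigeonhole principle gives an exponential polynomial
  \<open>\<Sum> p\<^sub>a\<^sub>c (x choose a) \<theta> ^ (c x)\<close> that is small at all integers \<open>x\<close> of moderate size. Its value at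
  \<open>x = i + k M\<close>, with \<open>\<theta> ^ M\<close> replaced by \<open>V / U\<close>, is nonzero for some \<open>i\<close>, \<open>k\<close>, since eliminating the
  powers of \<open>\<theta>\<close> by shifts of \<open>i\<close> leaves a single polynomial with too many zeros. Clearing the powers of \<open>U\<close> gives
  an algebraic integer of norm less than \<open>1\<close>, a contradiction.

  The constant is effective because it is found by searching for a certificate, which consists of one unit
  for each field and a number that is large in terms of these units. The exponent obtained depends only on the
  logarithms of the units; for fundamental units these are the regulators, and for \<open>\<surd>a\<close> a solution of
  Pell's equation with logarithm \<open>O(\<surd>a log a)\<close> is used. This comes from approximations \<open>x/y\<close> to \<open>\<surd>a\<close> with
  \<open>y \<le> 2 ^ j\<close>, \<open>j \<le> J\<close>: two different ones with the same norm \<open>m\<close> and the same residue \<open>x/y\<close>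
  mod \<open>m\<close> have a unit as quotient, and there are only \<open>O(\<surd>a log a)\<close> classes, since the residue is a square
  root of \<open>a\<close> mod \<open>m\<close>.
\<close>

section \<open>Zero estimate and auxiliary function\<close>

text \<open>The difficulty is the size of the saving. The norm alone gives exponent 2; an
  improvement by \<tau> means that losses up to exp (\<tau> L), L = ln q, must be tolerated. Let H =
  d ln \<epsilon>, which is d' ln \<eta> up to 1/g. The conjugates of U and V have size exp (O(L /
  (g H))), so \<tau> may be of order 1 / (g H). Dirichlet's theorem provides H of order g ln
  \<epsilon> ln \<eta>, and this is where the product of the regulators comes from. The powers of U
  and V have exponents of order H, so that they cost only exp (O(L / g)), independently of the
  units.

  The number g is absolute because the shape of the interpolation is fixed: exponents c < 12 and
  polynomials of degree below A, a fixed tiny multiple of L. Expanding the powers of \<theta> to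
  order A leaves an error of about g^(- A), which has to beat exp L. The zero estimate loses a
  factor 2^12 and so keeps A small compared with L; \<theta> must then be extremely close to 1,
  hence the enormous threshold for g.\<close>

lemma elimination_by_shift:
  fixes p :: "nat \<Rightarrow> real poly" and \<theta> \<gamma> :: real
  assumes \<theta>: "\<theta> > 0" "\<theta> \<noteq> 1" and \<gamma>: "\<gamma> \<noteq> 0"
  assumes "finite S" "card S = Suc m" "\<And>c. c \<in> S \<Longrightarrow> p c \<noteq> 0" "\<And>c. c \<in> S \<Longrightarrow> Polynomial.degree (p c) \<le> D"
  assumes "\<And>i k. i < I + m \<Longrightarrow> k < K \<Longrightarrow>
      (\<Sum>c\<in>S. poly (p c) (real (i + k * M)) * (\<theta> ^ (c * i) * \<gamma> ^ (c * k))) = 0"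
  shows "\<exists>Q. Q \<noteq> 0 \<and> Polynomial.degree Q \<le> 2 ^ m * D \<and>
      (\<forall>i<I. \<forall>k<K. poly Q (real (i + k * M)) = 0)"
  using assms(4-)
proof (induction m arbitrary: S p D)
  case 0
  then obtain c where S: "S = {c}" by (metis One_nat_def card_1_singletonE)
  have "poly (p c) (real (i + k * M)) = 0" if "i < I" "k < K" for i k
    using "0.prems"(5)[of i k] that S \<theta> \<gamma> by simp
  then show ?case using 0 S by (intro exI[of _ "p c"]) auto
next
  case (Suc m)
  then obtain t where t: "t \<in> S" by fastforce
  define s where "s = (\<lambda>q :: real poly. pcompose q [:1, 1:])"
  have s: "Polynomial.degree (s q) = Polynomial.degree q" "lead_coeff (s q) = lead_coeff q"
    "poly (s q) x = poly q (x + 1)" for q x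
    using lead_coeff_comp[of "[:1, 1:]" q] by (simp_all add: s_def degree_pcompose poly_pcompose add.commute)
  \<comment> \<open>Coefficients of the form at i + 1 times \<open>p t\<close> at x, minus the form
    at i times \<theta>^t and \<open>p t\<close> at x + 1: the term c = t cancels. Only i is
    shifted, so \<gamma> is untouched; one value of i is lost and degrees double.\<close>
  define p' where "p' = (\<lambda>c. smult (\<theta> ^ c) (p t * s (p c)) - smult (\<theta> ^ t) (s (p t) * p c))"
  have deg: "Polynomial.degree (p' c) \<le> 2 * D" if "c \<in> S" for c
  proof -
    have "Polynomial.degree (p t * s (p c)) \<le> 2 * D" "Polynomial.degree (s (p t) * p c) \<le> 2 * D"
      using Suc.prems(4)[OF t] Suc.prems(4)[OF that] s(1)
      by (smt (verit) add_mono degree_mult_le mult_2 order.trans)+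
    then show ?thesis unfolding p'_def
      by (intro degree_diff_le) (auto intro: order.trans[OF degree_smult_le])
  qed
  \<comment> \<open>Shifting the argument keeps leading coefficients, so the top coefficient of
    \<open>p' c\<close> is \<theta>^c - \<theta>^t times a product of two nonzero ones.\<close>
  have nz: "p' c \<noteq> 0" if c: "c \<in> S" "c \<noteq> t" for c
  proof
    define e where "e = Polynomial.degree (p t) + Polynomial.degree (p c)"
    assume "p' c = 0"
    then have "poly.coeff (p' c) e = 0" by simp
    moreover have "poly.coeff (p t * s (p c)) e = lead_coeff (p t) * lead_coeff (p c)"
      using coeff_mult_degree_sum[of "p t" "s (p c)"] s by (simp add: e_def)
    moreover have "poly.coeff (s (p t) * p c) e = lead_coeff (p t) * lead_coeff (p c)"
      using coeff_mult_degree_sum[of "s (p t)" "p c"] s by (simp add: e_def)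
    ultimately have "(\<theta> ^ c - \<theta> ^ t) * (lead_coeff (p t) * lead_coeff (p c)) = 0"
      unfolding p'_def by (simp add: algebra_simps)
    then have "\<theta> ^ c = \<theta> ^ t" using Suc.prems(3) c t by auto
    then show False using \<theta> c
      by (metis less_irrefl linorder_neqE_nat linorder_neqE_linordered_idom power_strict_increasing_iff power_strict_decreasing)
  qed
  have pt: "p' t = 0" by (simp add: p'_def mult.commute)
  have "\<exists>Q. Q \<noteq> 0 \<and> Polynomial.degree Q \<le> 2 ^ m * (2 * D) \<and>
      (\<forall>i<I. \<forall>k<K. poly Q (real (i + k * M)) = 0)"
  proof (rule Suc.IH[of "S - {t}" p'])
    show "finite (S - {t})" using Suc.prems by simp
    show "card (S - {t}) = Suc m" using Suc.prems t by simp
    show "p' c \<noteq> 0" if "c \<in> S - {t}" for c using nz that by auto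
    show "Polynomial.degree (p' c) \<le> 2 * D" if "c \<in> S - {t}" for c using deg that by auto
    fix i k assume ik: "i < I + m" "k < K"
    define x where "x = real (i + k * M)"
    have x1: "x + 1 = real (Suc i + k * M)" by (simp add: x_def)
    have e1: "(\<Sum>c\<in>S. poly (p c) (x + 1) * (\<theta> ^ (c * Suc i) * \<gamma> ^ (c * k))) = 0"
      unfolding x1 by (rule Suc.prems(5)) (use ik in auto)
    have e2: "(\<Sum>c\<in>S. poly (p c) x * (\<theta> ^ (c * i) * \<gamma> ^ (c * k))) = 0"
      unfolding x_def by (rule Suc.prems(5)) (use ik in auto)
    have "(\<Sum>c\<in>S - {t}. poly (p' c) x * (\<theta> ^ (c * i) * \<gamma> ^ (c * k))) =
       (\<Sum>c\<in>S. poly (p' c) x * (\<theta> ^ (c * i) * \<gamma> ^ (c * k)))"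
      using Suc.prems(1) t pt by (simp add: sum.remove)
    also have "\<dots> = (\<Sum>c\<in>S. poly (p t) x * (poly (p c) (x + 1) * (\<theta> ^ (c * Suc i) * \<gamma> ^ (c * k)))
          - \<theta> ^ t * poly (p t) (x + 1) * (poly (p c) x * (\<theta> ^ (c * i) * \<gamma> ^ (c * k))))"
      by (intro sum.cong refl) (simp add: p'_def s algebra_simps power_add)
    also have "\<dots> = poly (p t) x * (\<Sum>c\<in>S. poly (p c) (x + 1) * (\<theta> ^ (c * Suc i) * \<gamma> ^ (c * k)))
        - \<theta> ^ t * poly (p t) (x + 1) * (\<Sum>c\<in>S. poly (p c) x * (\<theta> ^ (c * i) * \<gamma> ^ (c * k)))"
      by (simp add: sum_subtractf sum_distrib_left)
    also have "\<dots> = 0"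
      unfolding e1 e2 by simp
    finally show "(\<Sum>c\<in>S - {t}. poly (p' c) (real (i + k * M)) * (\<theta> ^ (c * i) * \<gamma> ^ (c * k))) = 0"
      by (simp add: x_def)
  qed
  then show ?case by (simp add: mult.assoc mult.commute mult.left_commute)
qed

text \<open>Otherwise elimination would leave a nonzero polynomial of degree at most 2^T D with the
  I K roots i + k M. The extra range T for i pays for the shifts.\<close>

lemma zero_estimate:
  fixes p :: "nat \<Rightarrow> real poly" and \<theta> \<gamma> :: real
  assumes \<theta>: "\<theta> > 0" "\<theta> \<noteq> 1" and \<gamma>: "\<gamma> \<noteq> 0"
  assumes nz: "c0 < T" "p c0 \<noteq> 0" and deg: "\<And>c. c < T \<Longrightarrow> Polynomial.degree (p c) \<le> D"
  assumes IM: "I \<le> M" and IK: "2 ^ T * D < I * K"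
  obtains i k where "i < I + T" "k < K"
      "(\<Sum>c<T. poly (p c) (real (i + k * M)) * (\<theta> ^ (c * i) * \<gamma> ^ (c * k))) \<noteq> 0"
proof (rule ccontr)
  note found = that
  assume "\<not> thesis"
  then have van: "(\<Sum>c<T. poly (p c) (real (i + k * M)) * (\<theta> ^ (c * i) * \<gamma> ^ (c * k))) = 0"
    if "i < I + T" "k < K" for i k using found that by blast
  \<comment> \<open>Elimination divides the work among nonzero coefficient polynomials only, so the
    zero ones are dropped first.\<close>
  define S where "S = {c. c < T \<and> p c \<noteq> 0}"
  have S: "finite S" "c0 \<in> S" by (auto simp: S_def nz)
  define m where "m = card S - 1"
  have m: "card S = Suc m" using S by (metis Suc_pred' card_gt_0_iff empty_iff m_def)
  have "card S \<le> T" using card_mono[of "{..<T}" S] by (auto simp: S_def)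
  then have mT: "m \<le> T" using m by simp
  obtain Q where Q: "Q \<noteq> 0" "Polynomial.degree Q \<le> 2 ^ m * D" "\<And>i k. i < I \<Longrightarrow> k < K \<Longrightarrow> poly Q (real (i + k * M)) = 0"
  proof (atomize_elim, rule elimination_by_shift[OF \<theta> \<gamma> S(1) m, where p = p, THEN ex_forward])
    fix i k assume "i < I + m" "k < K"
    then have "(\<Sum>c<T. poly (p c) (real (i + k * M)) * (\<theta> ^ (c * i) * \<gamma> ^ (c * k))) = 0"
      using van mT by auto
    then show "(\<Sum>c\<in>S. poly (p c) (real (i + k * M)) * (\<theta> ^ (c * i) * \<gamma> ^ (c * k))) = 0"
      by (subst sum.mono_neutral_left[of "{..<T}"]) (auto simp: S_def)
  qed (auto simp: S_def deg)
  define f where "f = (\<lambda>(i, k). real (i + k * M))"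
  \<comment> \<open>Since \<open>I \<le> M\<close>, i and k are remainder and quotient of i + k M by
    M, so the roots are distinct.\<close>
  have inj: "inj_on f ({..<I} \<times> {..<K})"
  proof (rule inj_onI, clarify)
    fix i k i' k' assume *: "f (i, k) = f (i', k')" "i < I" "i' < I"
    then have "i + k * M = i' + k' * M" unfolding f_def by (metis case_prod_conv of_nat_eq_iff)
    moreover have "i < M" "i' < M" using * IM by auto
    ultimately show "i = i' \<and> k = k'"
      by (metis add_diff_cancel_left' bits_mod_div_trivial div_mult_self1 mod_less mod_mult_self1 mult.commute
          mult_cancel2 not_less_zero div_less add.left_neutral gr_implies_not0)
  qed
  have "I * K = card (f ` ({..<I} \<times> {..<K}))" by (simp add: card_image[OF inj])
  also have "\<dots> \<le> card {x. poly Q x = 0}"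
    using poly_roots_finite[OF Q(1)] by (intro card_mono) (auto simp: f_def intro!: Q(3)[simplified])
  also have "\<dots> \<le> Polynomial.degree Q" using card_poly_roots_bound[OF Q(1)] .
  also have "\<dots> \<le> 2 ^ T * D" using Q(2) mT by (meson le_trans mult_le_mono1 one_le_numeral power_increasing)
  finally show False using IK by simp
qed

text \<open>Pigeonhole in the manner of Thue and Siegel: vectors with entries in 0..Nb are sorted by
  the boxes of side \<delta> containing their n values, and two vectors in one box are subtracted. W
  bounds the number of boxes that one form can meet.\<close>

lemma small_linear_forms:
  fixes a :: "nat \<Rightarrow> 'j \<Rightarrow> real" and Nb W :: nat
  assumes J: "finite J" and C: "\<And>r j. r < n \<Longrightarrow> j \<in> J \<Longrightarrow> \<bar>a r j\<bar> \<le> C"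
    and \<delta>: "\<delta> > 0" and W: "2 * (real (card J) * C * real Nb) / \<delta> + 2 \<le> real W" and pigeon: "W ^ n < (Nb + 1) ^ card J"
  obtains p :: "'j \<Rightarrow> int" where "\<exists>j\<in>J. p j \<noteq> 0" "\<And>j. j \<in> J \<Longrightarrow> \<bar>p j\<bar> \<le> int Nb"
    "\<And>r. r < n \<Longrightarrow> \<bar>\<Sum>j\<in>J. real_of_int (p j) * a r j\<bar> \<le> \<delta>"
proof -
  define B where "B = real (card J) * C * real Nb"
  define V where "V = PiE J (\<lambda>_. {0..Nb})"
  define s where "s = (\<lambda>v :: 'j \<Rightarrow> nat. \<lambda>r. \<Sum>j\<in>J. real (v j) * a r j)"
  define h where "h = (\<lambda>v. restrict (\<lambda>r. \<lfloor>s v r / \<delta>\<rfloor>) {..<n})"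
  define Z where "Z = PiE {..<n} (\<lambda>_. {\<lfloor>- B / \<delta>\<rfloor>..\<lfloor>B / \<delta>\<rfloor>})"
  have sB: "\<bar>s v r\<bar> \<le> B" if "v \<in> V" "r < n" for v r
  proof -
    have "\<bar>s v r\<bar> \<le> (\<Sum>j\<in>J. \<bar>real (v j) * a r j\<bar>)" unfolding s_def by (rule sum_abs)
    also have "\<dots> \<le> (\<Sum>j\<in>J. real Nb * C)"
      using that C[OF that(2)] by (intro sum_mono) (auto simp: abs_mult V_def PiE_def Pi_def intro!: mult_mono)
    finally show ?thesis by (simp add: B_def mult.commute mult.left_commute)
  qed
  have maps: "h ` V \<subseteq> Z"
  proof (intro image_subsetI)
    fix v assume v: "v \<in> V"
    have "\<lfloor>- B / \<delta>\<rfloor> \<le> \<lfloor>s v r / \<delta>\<rfloor> \<and> \<lfloor>s v r / \<delta>\<rfloor> \<le> \<lfloor>B / \<delta>\<rfloor>" if "r < n" for r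
      using sB[OF v that] \<delta> by (intro conjI floor_mono divide_right_mono) (auto simp: abs_le_iff)
    then show "h v \<in> Z" by (auto simp: h_def Z_def)
  qed
  have cV: "card V = (Nb + 1) ^ card J" using J by (simp add: V_def card_PiE)
  have "card Z < card V"
  proof (cases "n = 0")
    case True then show ?thesis using cV pigeon by (simp add: Z_def card_PiE)
  next
    case False
    have "real_of_int (\<lfloor>B / \<delta>\<rfloor> - \<lfloor>- B / \<delta>\<rfloor> + 1) \<le> B / \<delta> - (- B / \<delta>) + 2"
      using floor_correct[of "B / \<delta>"] floor_correct[of "- B / \<delta>"] unfolding of_int_add of_int_diff of_int_1 by linarith
    also have "\<dots> = 2 * B / \<delta> + 2" by (simp add: field_simps)
    also have "\<dots> \<le> real W" using W by (simp add: B_def)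
    finally have "nat (\<lfloor>B / \<delta>\<rfloor> - \<lfloor>- B / \<delta>\<rfloor> + 1) \<le> W" by linarith
    then have "card {\<lfloor>- B / \<delta>\<rfloor>..\<lfloor>B / \<delta>\<rfloor>} \<le> W" by (simp add: algebra_simps)
    then have "card Z \<le> W ^ n" by (simp add: Z_def card_PiE power_mono)
    then show ?thesis using cV pigeon by simp
  qed
  moreover have "finite Z" by (auto simp: Z_def intro: finite_PiE)
  ultimately have "\<not> inj_on h V" using maps card_inj_on_le not_less by blast
  then obtain v w where vw: "v \<in> V" "w \<in> V" "h v = h w" "v \<noteq> w" by (auto simp: inj_on_def)
  define p where "p = (\<lambda>j. int (v j) - int (w j))"
  show thesis
  proof
    obtain j where "v j \<noteq> w j" using vw by blast
    moreover from this have "j \<in> J" using vw unfolding V_def by (metis PiE_arb)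
    ultimately show "\<exists>j\<in>J. p j \<noteq> 0" by (auto simp: p_def)
    show "\<bar>p j\<bar> \<le> int Nb" if "j \<in> J" for j
    proof -
      have "v j \<le> Nb" "w j \<le> Nb" using vw that by (auto simp: V_def)
      then show ?thesis by (simp add: p_def)
    qed
    fix r assume r: "r < n"
    have "\<lfloor>s v r / \<delta>\<rfloor> = \<lfloor>s w r / \<delta>\<rfloor>" using fun_cong[OF vw(3), of r] r by (simp add: h_def)
    then have "\<bar>s v r / \<delta> - s w r / \<delta>\<bar> < 1" using floor_correct[of "s v r / \<delta>"] floor_correct[of "s w r / \<delta>"] by linarith
    moreover have "\<bar>s v r / \<delta> - s w r / \<delta>\<bar> = \<bar>s v r - s w r\<bar> / \<delta>"
      using abs_divide[of "s v r - s w r" \<delta>] \<delta> unfolding diff_divide_distrib by simp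
    ultimately have "\<bar>s v r - s w r\<bar> < \<delta>" using \<delta> by simp
    moreover have "(\<Sum>j\<in>J. real_of_int (p j) * a r j) = s v r - s w r"
      by (simp add: s_def p_def sum_subtractf algebra_simps)
    ultimately show "\<bar>\<Sum>j\<in>J. real_of_int (p j) * a r j\<bar> \<le> \<delta>" by simp
  qed
qed

text \<open>Newton interpolation at \<open>0, \<dots>, n - 1\<close>, as an induction on the degree through differences.\<close>

lemma polynomial_growth_from_nodes:
  fixes P :: "real poly"
  assumes "P = 0 \<or> Polynomial.degree P < n" "\<And>j. j < n \<Longrightarrow> \<bar>poly P (real j)\<bar> \<le> \<delta>" "\<delta> \<ge> 0"
  shows "\<bar>poly P (real x)\<bar> \<le> \<delta> * 2 ^ n * 2 ^ x"
  using assms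
proof (induction n arbitrary: P \<delta> x)
  case 0
  then show ?case by auto
next
  case (Suc n)
  define Q where "Q = pcompose P [:1, 1:] - P"
  have Qx: "poly Q y = poly P (y + 1) - poly P y" for y by (simp add: Q_def poly_pcompose add.commute)
  have "Q = 0 \<or> Polynomial.degree Q < n"
  proof (cases "Polynomial.degree P = 0")
    case True
    then obtain c where "P = [:c:]" by (metis degree_eq_zeroE)
    then show ?thesis by (simp add: Q_def)
  next
    case False
    have "Polynomial.degree (pcompose P [:1, 1:]) = Polynomial.degree P" by (simp add: degree_pcompose)
    moreover have "lead_coeff (pcompose P [:1, 1:]) = lead_coeff P" using lead_coeff_comp[of "[:1, 1:]" P] by simp
    ultimately have "Polynomial.degree Q \<le> Polynomial.degree P" "poly.coeff Q (Polynomial.degree P) = 0"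
      unfolding Q_def by (auto intro: degree_diff_le)
    then have "Polynomial.degree Q < Polynomial.degree P"
      using False by (metis degree_0 leading_coeff_0_iff le_neq_implies_less)
    then show ?thesis using Suc.prems(1) False by auto
  qed
  moreover have "\<bar>poly Q (real j)\<bar> \<le> 2 * \<delta>" if "j < n" for j
    using Suc.prems(2)[of j] Suc.prems(2)[of "Suc j"] that Qx[of "real j"] by (simp add: add.commute)
  ultimately have IH: "\<bar>poly Q (real y)\<bar> \<le> 2 * \<delta> * 2 ^ n * 2 ^ y" for y
    using Suc.IH[of Q "2 * \<delta>" y] Suc.prems(3) by simp
  have P0: "\<bar>poly P 0\<bar> \<le> \<delta>" using Suc.prems(2)[of 0] by simp
  have "\<bar>poly P (real x)\<bar> \<le> \<delta> + \<delta> * 2 ^ Suc n * (2 ^ x - 1)" for x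
  proof (induction x)
    case (Suc x)
    have "\<bar>poly P (real (Suc x))\<bar> \<le> \<bar>poly P (real x)\<bar> + \<bar>poly Q (real x)\<bar>"
      using Qx[of "real x"] by (simp add: add.commute)
    also have "\<dots> \<le> \<delta> + \<delta> * 2 ^ Suc n * (2 ^ x - 1) + 2 * \<delta> * 2 ^ n * 2 ^ x" using Suc IH[of x] by linarith
    finally show ?case by (simp add: algebra_simps)
  qed (use P0 in simp)
  from this[of x] have "\<bar>poly P (real x)\<bar> \<le> \<delta> * 2 ^ Suc n * 2 ^ x + (\<delta> - \<delta> * 2 ^ Suc n)"
    by (simp add: algebra_simps)
  moreover have "\<delta> * 1 \<le> \<delta> * 2 ^ Suc n" using Suc.prems(3) by (intro mult_left_mono) (auto intro: one_le_power simp del: power_Suc)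
  ultimately show ?case by linarith
qed

text \<open>Binomials take integer values at integers, which keeps the values of the auxiliary
  function in a ring of algebraic integers, and there they are at most 2^x for every degree a,
  unlike powers of x.\<close>

definition binomial_poly :: "nat \<Rightarrow> real poly" where
  "binomial_poly a = smult (1 / fact a) (\<Prod>j<a. [:- real j, 1:])"

lemma poly_binomial_poly [simp]: "poly (binomial_poly a) (real x) = real (x choose a)"
  by (simp add: binomial_poly_def poly_prod binomial_gbinomial gbinomial_prod_rev atLeast0LessThan)

lemma degree_binomial_poly: "Polynomial.degree (binomial_poly a) = a"
  by (simp add: binomial_poly_def degree_prod_eq_sum_degree)

lemma sum_binomial_poly_nonzero:
  assumes "finite J" "a \<in> J" "p a \<noteq> (0 :: real)"
  shows "(\<Sum>a\<in>J. smult (p a) (binomial_poly a)) \<noteq> 0"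
proof
  assume *: "(\<Sum>a\<in>J. smult (p a) (binomial_poly a)) = 0"
  \<comment> \<open>The system is triangular: at the least index with a nonzero coefficient all
    later binomials vanish.\<close>
  define m where "m = (LEAST a. a \<in> J \<and> p a \<noteq> 0)"
  have m: "m \<in> J" "p m \<noteq> 0" "\<And>b. b \<in> J \<Longrightarrow> p b \<noteq> 0 \<Longrightarrow> m \<le> b"
    using LeastI[of "\<lambda>a. a \<in> J \<and> p a \<noteq> 0" a] Least_le[of "\<lambda>a. a \<in> J \<and> p a \<noteq> 0"] assms unfolding m_def by auto
  have "0 = poly (\<Sum>a\<in>J. smult (p a) (binomial_poly a)) (real m)" using * by simp
  also have "\<dots> = (\<Sum>a\<in>J. p a * real (m choose a))" by (simp add: poly_sum)
  also have "\<dots> = (\<Sum>a\<in>J. if a = m then p m else 0)"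
    using m(3) by (intro sum.cong refl) (metis binomial_eq_0 binomial_n_n le_neq_implies_less mult_zero_left mult_zero_right of_nat_0 of_nat_1 mult.right_neutral)
  also have "\<dots> = p m" using m(1) assms(1) by simp
  finally show False using m(2) by simp
qed

lemma binomial_le_pow2: "real (x choose l) \<le> 2 ^ x"
  using binomial_le_pow2[of x l] by (metis of_nat_le_iff of_nat_numeral of_nat_power)

lemma truncated_binomial:
  fixes u \<upsilon> :: real
  assumes "\<bar>u\<bar> \<le> \<upsilon>" "\<upsilon> \<le> 1"
  shows "\<bar>(1 + u) ^ x - (\<Sum>l<A. real (x choose l) * u ^ l)\<bar> \<le> 2 ^ x * \<upsilon> ^ A"
    and "\<bar>\<Sum>l<A. real (x choose l) * u ^ l\<bar> \<le> 2 ^ x"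
proof -
  have u0: "0 \<le> \<upsilon>" using assms by linarith
  have sub: "(\<Sum>l\<in>S. real (x choose l)) \<le> 2 ^ x" if "finite S" for S
  proof -
    have "(\<Sum>l\<in>S. real (x choose l)) \<le> (\<Sum>l\<in>S \<union> {..x}. real (x choose l))" using that by (intro sum_mono2) auto
    also have "\<dots> = (\<Sum>l\<le>x. real (x choose l))"
      using that by (intro sum.mono_neutral_right) (auto simp: not_le)
    also have "\<dots> = 2 ^ x" using choose_row_sum[of x] by (metis of_nat_numeral of_nat_power of_nat_sum)
    finally show ?thesis .
  qed
  define N where "N = A + Suc x"
  have "(1 + u) ^ x = (\<Sum>l\<le>x. real (x choose l) * u ^ l)" using binomial_ring[of u 1 x] by (simp add: add.commute)
  also have "\<dots> = (\<Sum>l<N. real (x choose l) * u ^ l)" by (intro sum.mono_neutral_left) (auto simp: N_def not_le)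
  finally have eq: "(1 + u) ^ x - (\<Sum>l<A. real (x choose l) * u ^ l) = (\<Sum>l\<in>{..<N} - {..<A}. real (x choose l) * u ^ l)"
    by (subst sum_diff) (auto simp: N_def)
  have "\<bar>\<Sum>l\<in>{..<N} - {..<A}. real (x choose l) * u ^ l\<bar> \<le> (\<Sum>l\<in>{..<N} - {..<A}. real (x choose l) * \<upsilon> ^ A)"
  proof (rule order.trans[OF sum_abs sum_mono])
    fix l assume "l \<in> {..<N} - {..<A}"
    then have "\<bar>u\<bar> ^ l \<le> \<upsilon> ^ l" "\<upsilon> ^ l \<le> \<upsilon> ^ A" using assms u0 by (auto intro: power_mono power_decreasing)
    then show "\<bar>real (x choose l) * u ^ l\<bar> \<le> real (x choose l) * \<upsilon> ^ A"
      by (auto simp: abs_mult power_abs intro!: mult_left_mono)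
  qed
  also have "\<dots> \<le> 2 ^ x * \<upsilon> ^ A"
    using sub[of "{..<N} - {..<A}"] u0 by (simp add: mult_right_mono flip: sum_distrib_right)
  finally show "\<bar>(1 + u) ^ x - (\<Sum>l<A. real (x choose l) * u ^ l)\<bar> \<le> 2 ^ x * \<upsilon> ^ A" unfolding eq .
  have "\<bar>\<Sum>l<A. real (x choose l) * u ^ l\<bar> \<le> (\<Sum>l<A. real (x choose l))"
  proof (rule order.trans[OF sum_abs sum_mono])
    fix l
    have "\<bar>u\<bar> ^ l \<le> 1" using assms by (intro power_le_one) auto
    then show "\<bar>real (x choose l) * u ^ l\<bar> \<le> real (x choose l)"
      by (auto simp: abs_mult power_abs mult_left_le)
  qed
  then show "\<bar>\<Sum>l<A. real (x choose l) * u ^ l\<bar> \<le> 2 ^ x" using sub[of "{..<A}"] by simp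
qed

text \<open>Only 2 A conditions are imposed on A T unknowns: writing \<theta>^(c x) as (1 +
  (\<theta>^c - 1))^x and truncating at order A turns the exponential polynomial into a polynomial
  of degree below 2 A, which is controlled by its values at 2 A nodes. The second summand of the
  bound is the truncation error; 16^A bounds the matrix entries at the nodes.\<close>

lemma auxiliary_function:
  fixes \<theta> \<upsilon> \<delta> :: real and A T Nb W :: nat
  assumes u: "\<And>c. c < T \<Longrightarrow> \<bar>\<theta> ^ c - 1\<bar> \<le> \<upsilon>" "\<upsilon> \<le> 1" and \<delta>: "\<delta> > 0"
    and W: "2 * (real (A * T) * 16 ^ A * real Nb) / \<delta> + 2 \<le> real W" and pigeon: "W ^ (2 * A) < (Nb + 1) ^ (A * T)"
  obtains p :: "nat \<Rightarrow> nat \<Rightarrow> int" where "\<exists>a<A. \<exists>c<T. p a c \<noteq> 0" "\<And>a c. a < A \<Longrightarrow> c < T \<Longrightarrow> \<bar>p a c\<bar> \<le> int Nb"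
    "\<And>x. \<bar>\<Sum>a<A. \<Sum>c<T. real_of_int (p a c) * real (x choose a) * \<theta> ^ (c * x)\<bar>
       \<le> \<delta> * 4 ^ A * 2 ^ x + real (A * T) * real Nb * 4 ^ x * \<upsilon> ^ A"
proof -
  define t where "t = (\<lambda>c. \<Sum>l<A. smult ((\<theta> ^ c - 1) ^ l) (binomial_poly l))"
  have t: "poly (t c) (real x) = (\<Sum>l<A. real (x choose l) * (\<theta> ^ c - 1) ^ l)" for c x
    by (simp add: t_def poly_sum mult.commute)
  define J where "J = {..<A} \<times> {..<T}"
  have J: "finite J" "card J = A * T" by (auto simp: J_def)
  have C: "\<bar>case j of (a, c) \<Rightarrow> real (r choose a) * poly (t c) (real r)\<bar> \<le> 16 ^ A" if rj: "r < 2 * A" "j \<in> J" for r j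
  proof -
    obtain a c where j: "j = (a, c)" "c < T" using rj by (auto simp: J_def)
    have "\<bar>real (r choose a) * poly (t c) (real r)\<bar> \<le> 2 ^ r * 2 ^ r"
      unfolding abs_mult t using truncated_binomial(2)[OF u(1)[OF j(2)] u(2)] binomial_le_pow2[of r a]
      by (intro mult_mono) auto
    also have "\<dots> = (4::real) ^ r" by (simp flip: power_mult_distrib)
    also have "\<dots> \<le> 4 ^ (2 * A)" using that by (intro power_increasing) auto
    also have "\<dots> = 16 ^ A" by (simp add: power_mult)
    finally show ?thesis by (simp add: j)
  qed
  obtain q :: "nat \<times> nat \<Rightarrow> int" where q: "\<exists>j\<in>J. q j \<noteq> 0" "\<And>j. j \<in> J \<Longrightarrow> \<bar>q j\<bar> \<le> int Nb"
    "\<And>r. r < 2 * A \<Longrightarrow> \<bar>\<Sum>j\<in>J. real_of_int (q j) * (case j of (a, c) \<Rightarrow> real (r choose a) * poly (t c) (real r))\<bar> \<le> \<delta>"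
  proof (rule small_linear_forms[where n = "2 * A" and Nb = Nb and W = W and J = J and C = "16 ^ A" and \<delta> = \<delta>
        and a = "\<lambda>r j. case j of (a, c) \<Rightarrow> real (r choose a) * poly (t c) (real r)"])
  qed (use J C \<delta> W pigeon in auto)
  show thesis
  proof (rule that[of "\<lambda>a c. q (a, c)"])
    show "\<exists>a<A. \<exists>c<T. q (a, c) \<noteq> 0" using q(1) by (auto simp: J_def)
    show "\<bar>q (a, c)\<bar> \<le> int Nb" if "a < A" "c < T" for a c using q(2) that by (auto simp: J_def)
    fix x :: nat
    have p4: "(4::real) ^ x = 2 ^ x * 2 ^ x" by (simp flip: power_mult_distrib)
    have A: "A > 0" using q(1) by (auto simp: J_def)
    define G where "G = (\<Sum>j\<in>J. smult (real_of_int (q j)) (case j of (a, c) \<Rightarrow> binomial_poly a * t c))"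
    have G: "poly G (real y) = (\<Sum>j\<in>J. real_of_int (q j) * (case j of (a, c) \<Rightarrow> real (y choose a) * poly (t c) (real y)))" for y
      by (simp add: G_def poly_sum case_prod_unfold)
    have "Polynomial.degree (t c) \<le> A - 1" for c
      unfolding t_def by (intro degree_sum_le) (auto intro!: order.trans[OF degree_smult_le] simp: degree_binomial_poly)
    then have "Polynomial.degree G \<le> (A - 1) + (A - 1)"
      unfolding G_def by (intro degree_sum_le) (auto simp: J_def degree_binomial_poly
          intro!: order.trans[OF degree_smult_le] order.trans[OF degree_mult_le] add_mono)
    then have "Polynomial.degree G < 2 * A" using A by linarith
    then have Gx: "\<bar>poly G (real x)\<bar> \<le> \<delta> * 2 ^ (2 * A) * 2 ^ x"
      using q(3) \<delta> by (intro polynomial_growth_from_nodes) (auto simp: G)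
    have eq: "(\<Sum>a<A. \<Sum>c<T. real_of_int (q (a, c)) * real (x choose a) * \<theta> ^ (c * x)) - poly G (real x)
       = (\<Sum>(a, c)\<in>J. real_of_int (q (a, c)) * (real (x choose a) * ((1 + (\<theta> ^ c - 1)) ^ x - poly (t c) (real x))))"
      unfolding G J_def sum.cartesian_product by (simp add: case_prod_unfold power_mult right_diff_distrib mult.assoc sum_subtractf)
    have "\<bar>\<Sum>(a, c)\<in>J. real_of_int (q (a, c)) * (real (x choose a) * ((1 + (\<theta> ^ c - 1)) ^ x - poly (t c) (real x)))\<bar>
        \<le> (\<Sum>j\<in>J. real Nb * 4 ^ x * \<upsilon> ^ A)"
    proof (rule order.trans[OF sum_abs sum_mono])
      fix j assume j: "j \<in> J"
      then obtain a c where ac: "j = (a, c)" "c < T" by (auto simp: J_def)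
      have "\<bar>real_of_int (q j)\<bar> * (\<bar>real (x choose a)\<bar> * \<bar>(1 + (\<theta> ^ c - 1)) ^ x - poly (t c) (real x)\<bar>) \<le> real Nb * (2 ^ x * (2 ^ x * \<upsilon> ^ A))"
        using q(2)[OF j] binomial_le_pow2[of x a] truncated_binomial(1)[OF u(1)[OF ac(2)] u(2), of x A] unfolding t
        by (intro mult_mono) (auto simp flip: of_int_abs)
      also have "\<dots> = real Nb * 4 ^ x * \<upsilon> ^ A" by (simp add: p4)
      finally show "\<bar>case j of (a, c) \<Rightarrow> real_of_int (q (a, c)) * (real (x choose a) * ((1 + (\<theta> ^ c - 1)) ^ x - poly (t c) (real x)))\<bar>
          \<le> real Nb * 4 ^ x * \<upsilon> ^ A" by (simp add: ac abs_mult)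
    qed
    also have "\<dots> = real (A * T) * real Nb * 4 ^ x * \<upsilon> ^ A" by (simp add: J)
    finally have "\<bar>(\<Sum>a<A. \<Sum>c<T. real_of_int (q (a, c)) * real (x choose a) * \<theta> ^ (c * x)) - poly G (real x)\<bar>
       \<le> real (A * T) * real Nb * 4 ^ x * \<upsilon> ^ A" unfolding eq .
    moreover have "\<bar>poly G (real x)\<bar> \<le> \<delta> * 4 ^ A * 2 ^ x" using Gx by (simp add: power_mult)
    ultimately show "\<bar>\<Sum>a<A. \<Sum>c<T. real_of_int (q (a, c)) * real (x choose a) * \<theta> ^ (c * x)\<bar>
       \<le> \<delta> * 4 ^ A * 2 ^ x + real (A * T) * real Nb * 4 ^ x * \<upsilon> ^ A" by linarith
  qed
qed

section \<open>Integers of a biquadratic field\<close>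

text \<open>Integral trace \<epsilon> + 1/\<epsilon> means that \<epsilon> has norm 1 and its
  conjugate is its inverse, so the four embeddings are the four choices of signs of the exponents.
  Independence of 1, \<epsilon>, \<eta>, \<epsilon>\<eta> over the integers expresses that the field
  has degree 4.\<close>

locale biquadratic =
  fixes \<epsilon> \<eta> :: real and s t :: int
  assumes eps_gt_1: "\<epsilon> > 1" and eta_gt_1: "\<eta> > 1"
    and eps_trace: "\<epsilon> + inverse \<epsilon> = of_int s" and eta_trace: "\<eta> + inverse \<eta> = of_int t"
    and indep: "\<And>k l m n :: int. of_int k + of_int l * \<epsilon> + of_int m * \<eta> + of_int n * (\<epsilon> * \<eta>) = 0
      \<Longrightarrow> k = 0 \<and> l = 0 \<and> m = 0 \<and> n = 0"
begin

text \<open>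
  An element of the ring \<open>\<int>[\<epsilon>, \<eta>]\<close> is represented by the function assigning to the conjugates
  \<open>a\<close> of \<open>\<epsilon>\<close> and \<open>b\<close> of \<open>\<eta>\<close> the corresponding conjugate of the element.
\<close>

definition ring_elems :: "(real \<Rightarrow> real \<Rightarrow> real) set" where
  "ring_elems = {z. \<exists>k l m n :: int. \<forall>a\<in>{\<epsilon>, inverse \<epsilon>}. \<forall>b\<in>{\<eta>, inverse \<eta>}.
      z a b = of_int k + of_int l * a + of_int m * b + of_int n * (a * b)}"

lemma ring_elemsI:
  assumes "\<And>a b. a \<in> {\<epsilon>, inverse \<epsilon>} \<Longrightarrow> b \<in> {\<eta>, inverse \<eta>} \<Longrightarrow>
     z a b = of_int k + of_int l * a + of_int m * b + of_int n * (a * b)"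
  shows "z \<in> ring_elems"
  using assms unfolding ring_elems_def by blast

lemma conj_eqs:
  "a \<in> {\<epsilon>, inverse \<epsilon>} \<Longrightarrow> a * a = of_int s * a - 1" "a \<in> {\<epsilon>, inverse \<epsilon>} \<Longrightarrow> inverse a = of_int s - a"
  "b \<in> {\<eta>, inverse \<eta>} \<Longrightarrow> b * b = of_int t * b - 1" "b \<in> {\<eta>, inverse \<eta>} \<Longrightarrow> inverse b = of_int t - b"
  using eps_gt_1 eta_gt_1 by (auto simp flip: eps_trace eta_trace simp: algebra_simps)

lemma ring_int: "(\<lambda>a b. of_int k) \<in> ring_elems"
  by (rule ring_elemsI[of _ k 0 0 0]) auto

lemma ring_gens:
  "(\<lambda>a b. a) \<in> ring_elems" "(\<lambda>a b. b) \<in> ring_elems" "(\<lambda>a b. inverse a) \<in> ring_elems" "(\<lambda>a b. inverse b) \<in> ring_elems"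
  by (rule ring_elemsI[of _ 0 1 0 0], simp) (rule ring_elemsI[of _ 0 0 1 0], simp,
      rule ring_elemsI[of _ s "-1" 0 0], simp add: conj_eqs(2)[simplified], rule ring_elemsI[of _ t 0 "-1" 0], simp add: conj_eqs(4)[simplified])

lemma ring_add:
  assumes "z \<in> ring_elems" "w \<in> ring_elems"
  shows "(\<lambda>a b. z a b + w a b) \<in> ring_elems"
proof -
  obtain k l m n where z: "\<forall>a\<in>{\<epsilon>, inverse \<epsilon>}. \<forall>b\<in>{\<eta>, inverse \<eta>}. z a b = of_int k + of_int l * a + of_int m * b + of_int n * (a * b)"
    using assms(1) unfolding ring_elems_def by blast
  obtain k' l' m' n' where w: "\<forall>a\<in>{\<epsilon>, inverse \<epsilon>}. \<forall>b\<in>{\<eta>, inverse \<eta>}. w a b = of_int k' + of_int l' * a + of_int m' * b + of_int n' * (a * b)"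
    using assms(2) unfolding ring_elems_def by blast
  show ?thesis
    by (rule ring_elemsI[of _ "k + k'" "l + l'" "m + m'" "n + n'"]) (simp add: z[rule_format] w[rule_format] algebra_simps)
qed

lemma ring_mult:
  assumes "z \<in> ring_elems" "w \<in> ring_elems"
  shows "(\<lambda>a b. z a b * w a b) \<in> ring_elems"
proof -
  obtain k l m n where z: "\<forall>a\<in>{\<epsilon>, inverse \<epsilon>}. \<forall>b\<in>{\<eta>, inverse \<eta>}. z a b = of_int k + of_int l * a + of_int m * b + of_int n * (a * b)"
    using assms(1) unfolding ring_elems_def by blast
  obtain k' l' m' n' where w: "\<forall>a\<in>{\<epsilon>, inverse \<epsilon>}. \<forall>b\<in>{\<eta>, inverse \<eta>}. w a b = of_int k' + of_int l' * a + of_int m' * b + of_int n' * (a * b)"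
    using assms(2) unfolding ring_elems_def by blast
  show ?thesis
  proof (rule ring_elemsI[of _ "k * k' - l * l' - m * m' + n * n'"
        "k * l' + l * k' + s * l * l' - m * n' - n * m' - s * n * n'"
        "k * m' + m * k' + t * m * m' - l * n' - n * l' - t * n * n'"
        "k * n' + l * m' + m * l' + n * k' + s * (l * n' + n * l') + t * (m * n' + n * m') + s * t * n * n'"])
    fix a b assume ab: "a \<in> {\<epsilon>, inverse \<epsilon>}" "b \<in> {\<eta>, inverse \<eta>}"
    have zw: "z a b * w a b = (of_int k + of_int l * a + of_int m * b + of_int n * (a * b)) *
        (of_int k' + of_int l' * a + of_int m' * b + of_int n' * (a * b))"
      unfolding z[rule_format, OF ab] w[rule_format, OF ab] ..
    have aa: "a * a = of_int s * a - 1" and bb: "b * b = of_int t * b - 1" using conj_eqs ab by blast+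
    \<comment> \<open>The product reduced modulo the two quadratic relations. Their multiples are
      kept as explicit summands, which makes this a polynomial identity; they vanish
      afterwards.\<close>
    have "z a b * w a b = of_int (k * k' - l * l' - m * m' + n * n')
      + of_int (k * l' + l * k' + s * l * l' - m * n' - n * m' - s * n * n') * a
      + of_int (k * m' + m * k' + t * m * m' - l * n' - n * l' - t * n * n') * b
      + of_int (k * n' + l * m' + m * l' + n * k' + s * (l * n' + n * l') + t * (m * n' + n * m') + s * t * n * n') * (a * b)
      + (a * a - (of_int s * a - 1)) * (of_int (l * l') + of_int (l * n' + n * l') * b + of_int (n * n') * (b * b))
      + (b * b - (of_int t * b - 1)) * (of_int (m * m') + of_int (m * n' + n * m') * a + of_int (n * n') * (of_int s * a - 1))"
      unfolding zw by (simp add: algebra_simps)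
    then show "z a b * w a b = of_int (k * k' - l * l' - m * m' + n * n')
      + of_int (k * l' + l * k' + s * l * l' - m * n' - n * m' - s * n * n') * a
      + of_int (k * m' + m * k' + t * m * m' - l * n' - n * l' - t * n * n') * b
      + of_int (k * n' + l * m' + m * l' + n * k' + s * (l * n' + n * l') + t * (m * n' + n * m') + s * t * n * n') * (a * b)"
      unfolding aa bb by simp
  qed
qed

lemma ring_power: "z \<in> ring_elems \<Longrightarrow> (\<lambda>a b. z a b ^ n) \<in> ring_elems"
  using ring_int[of 1] by (induction n) (auto intro: ring_mult)

lemma ring_sum: "(\<And>i. i \<in> I \<Longrightarrow> z i \<in> ring_elems) \<Longrightarrow> (\<lambda>a b. \<Sum>i\<in>I. z i a b) \<in> ring_elems"
  using ring_int[of 0] by (induction I rule: infinite_finite_induct) (auto intro: ring_add)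

text \<open>The product is the norm, computed in two stages: over b it becomes g + h a, over a it
  becomes an integer. It is nonzero because each conjugate, expanded again in 1, \<epsilon>, \<eta>,
  \<epsilon>\<eta>, has coefficients that determine those of z.\<close>

lemma ring_elems_norm_ge_1:
  assumes "z \<in> ring_elems" "z \<epsilon> \<eta> \<noteq> 0"
  shows "1 \<le> \<bar>z \<epsilon> \<eta>\<bar> * \<bar>z \<epsilon> (inverse \<eta>)\<bar> * \<bar>z (inverse \<epsilon>) \<eta>\<bar> * \<bar>z (inverse \<epsilon>) (inverse \<eta>)\<bar>"
proof -
  obtain k l m n where z: "\<forall>a\<in>{\<epsilon>, inverse \<epsilon>}. \<forall>b\<in>{\<eta>, inverse \<eta>}. z a b = of_int k + of_int l * a + of_int m * b + of_int n * (a * b)"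
    using assms(1) unfolding ring_elems_def by blast
  have nz0: "\<not> (k = 0 \<and> l = 0 \<and> m = 0 \<and> n = 0)" using z assms(2) by auto
  have inv: "inverse \<epsilon> = of_int s - \<epsilon>" "inverse \<eta> = of_int t - \<eta>" using conj_eqs by auto
  have nz1: "z \<epsilon> (inverse \<eta>) \<noteq> 0"
    using indep[of "k + t * m" "l + t * n" "- m" "- n"] nz0 z unfolding inv by (auto simp: algebra_simps)
  have nz2: "z (inverse \<epsilon>) \<eta> \<noteq> 0"
    using indep[of "k + s * l" "- l" "m + s * n" "- n"] nz0 z unfolding inv by (auto simp: algebra_simps)
  have nz3: "z (inverse \<epsilon>) (inverse \<eta>) \<noteq> 0"
    using indep[of "k + s * l + t * (m + s * n)" "- l - t * n" "- m - s * n" "n"] nz0 z unfolding inv by (auto simp: algebra_simps)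
  define g where "g = k * k - l * l + t * (k * m - l * n) + m * m - n * n"
  define h where "h = 2 * k * l + s * l * l + t * (k * n + l * m + s * l * n) + 2 * m * n + s * n * n"
  have part: "z a \<eta> * z a (inverse \<eta>) = of_int g + of_int h * a" if "a \<in> {\<epsilon>, inverse \<epsilon>}" for a
  proof -
    have "z a \<eta> * z a (inverse \<eta>) = (of_int k + of_int l * a + of_int m * \<eta> + of_int n * (a * \<eta>)) *
        (of_int k + of_int l * a + of_int m * (of_int t - \<eta>) + of_int n * (a * (of_int t - \<eta>)))"
      using z that inv by auto
    also have "\<dots> = of_int g + of_int h * a
        + (a * a - (of_int s * a - 1)) * of_int (l * l + t * l * n + n * n)
        - (\<eta> * \<eta> - (of_int t * \<eta> - 1)) * ((of_int m + of_int n * a) * (of_int m + of_int n * a))"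
      unfolding g_def h_def by (simp add: algebra_simps)
    also have "\<dots> = of_int g + of_int h * a" using conj_eqs(1)[OF that] conj_eqs(3)[of \<eta>] by simp
    finally show ?thesis .
  qed
  have "z \<epsilon> \<eta> * z \<epsilon> (inverse \<eta>) * (z (inverse \<epsilon>) \<eta> * z (inverse \<epsilon>) (inverse \<eta>)) = (of_int g + of_int h * \<epsilon>) * (of_int g + of_int h * (of_int s - \<epsilon>))"
    using part inv by simp
  also have "\<dots> = of_int (g * g + g * h * s + h * h)
    - (\<epsilon> * \<epsilon> - (of_int s * \<epsilon> - 1)) * of_int (h * h)"
    by (simp add: algebra_simps)
  also have "\<dots> = of_int (g * g + g * h * s + h * h)" using conj_eqs(1)[of \<epsilon>] by simp
  finally have eq: "z \<epsilon> \<eta> * z \<epsilon> (inverse \<eta>) * z (inverse \<epsilon>) \<eta> * z (inverse \<epsilon>) (inverse \<eta>) = of_int (g * g + g * h * s + h * h)"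
    by (simp add: mult.assoc)
  then have "of_int (g * g + g * h * s + h * h) \<noteq> (0::real)" using assms(2) nz1 nz2 nz3 by (metis mult_eq_0_iff)
  then have "1 \<le> \<bar>g * g + g * h * s + h * h\<bar>" by (simp del: of_int_add of_int_mult)
  then have "1 \<le> \<bar>real_of_int (g * g + g * h * s + h * h)\<bar>" by linarith
  then show ?thesis unfolding eq[symmetric] by (simp add: abs_mult)
qed

end

section \<open>Elementary inequalities and values of the auxiliary function\<close>

lemma abs_power_diff_le:
  fixes y z B :: real
  assumes "\<bar>y\<bar> \<le> B" "\<bar>z\<bar> \<le> B" "1 \<le> B"
  shows "\<bar>y ^ m - z ^ m\<bar> \<le> real m * B ^ m * \<bar>y - z\<bar>"
proof (induction m)
  case (Suc m)
  have eq: "y ^ Suc m - z ^ Suc m = y * (y ^ m - z ^ m) + (y - z) * z ^ m" by (simp add: algebra_simps)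
  have "\<bar>y * (y ^ m - z ^ m) + (y - z) * z ^ m\<bar> \<le> \<bar>y\<bar> * \<bar>y ^ m - z ^ m\<bar> + \<bar>y - z\<bar> * \<bar>z\<bar> ^ m"
    by (rule order.trans[OF abs_triangle_ineq]) (simp add: abs_mult power_abs)
  also have "\<dots> \<le> B * (real m * B ^ m * \<bar>y - z\<bar>) + \<bar>y - z\<bar> * B ^ Suc m"
  proof (intro add_mono mult_mono Suc)
    have "\<bar>z\<bar> ^ m \<le> B ^ m" using assms by (intro power_mono) auto
    also have "\<dots> \<le> B ^ Suc m" using assms by (intro power_increasing) auto
    finally show "\<bar>z\<bar> ^ m \<le> B ^ Suc m" .
  qed (use assms in auto)
  finally show ?case unfolding eq by (simp add: algebra_simps)
qed simp

lemma power_split_11: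
  fixes x :: real
  assumes "c < 12"
  shows "x ^ (c * k) * x ^ ((11 - c) * k) = x ^ (11 * k)"
proof -
  have "c + (11 - c) = 11" using assms by simp
  then show ?thesis by (metis add_mult_distrib power_add)
qed

lemma abs_product_le:
  fixes a b x y :: real
  assumes "\<bar>a\<bar> \<le> a'" "\<bar>b\<bar> \<le> b'" "\<bar>x\<bar> \<le> x'" "\<bar>y\<bar> \<le> y'"
  shows "\<bar>a * b * (x * y)\<bar> \<le> a' * b' * (x' * y')"
proof -
  have "0 \<le> a'" "0 \<le> b'" "0 \<le> x'" "0 \<le> y'" using assms by linarith+
  then show ?thesis unfolding abs_mult using assms by (intro mult_mono mult_nonneg_nonneg) auto
qed

lemma exp_diff_le:
  fixes x :: real
  assumes "\<bar>x\<bar> \<le> 1"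
  shows "\<bar>exp x - 1\<bar> \<le> 2 * \<bar>x\<bar>"
proof (cases "x \<ge> 0")
  case True
  have "exp x \<le> 1 + x + x\<^sup>2" using exp_bound[of x] True assms by auto
  moreover have "x\<^sup>2 \<le> x" using True assms by (simp add: power2_eq_square mult_left_le)
  moreover have "exp x \<ge> 1" using True by simp
  ultimately have "\<bar>exp x - 1\<bar> \<le> 2 * x" by linarith
  then show ?thesis using True by simp
next
  case False
  then have "exp x \<le> 1" by simp
  then have "\<bar>exp x - 1\<bar> \<le> - 2 * x" using exp_ge_add_one_self[of x] False by linarith
  then show ?thesis using False by simp
qed

text \<open>Absorbs factors linear in L, such as 12 A, into the exponent at the cost of a
  thousandth.\<close>

lemma linear_le_exp:
  fixes L :: real
  assumes "L \<ge> 100000000"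
  shows "12 * L \<le> exp (L / 1000)"
proof -
  have "100000000 * L \<le> L * L" using assms by (intro mult_right_mono) auto
  moreover have "(1 + L / 2000) ^ 2 = 1 + L / 1000 + L * L / 4000000" by (simp add: power2_eq_square algebra_simps)
  ultimately have "12 * L \<le> (1 + L / 2000) ^ 2" using assms by linarith
  also have "\<dots> \<le> exp (L / 2000) ^ 2" using assms by (intro power_mono exp_ge_add_one_self) auto
  also have "\<dots> = exp (L / 1000)" by (simp flip: exp_double)
  finally show ?thesis .
qed

context biquadratic
begin

lemma ring_elems_zero:
  assumes "z \<in> ring_elems" "z \<epsilon> \<eta> = 0" "a \<in> {\<epsilon>, inverse \<epsilon>}" "b \<in> {\<eta>, inverse \<eta>}"
  shows "z a b = 0"
proof -
  obtain k l m n where z: "\<forall>a\<in>{\<epsilon>, inverse \<epsilon>}. \<forall>b\<in>{\<eta>, inverse \<eta>}. z a b = of_int k + of_int l * a + of_int m * b + of_int n * (a * b)"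
    using assms(1) unfolding ring_elems_def by blast
  then have "k = 0 \<and> l = 0 \<and> m = 0 \<and> n = 0" using assms(2) indep[of k l m n] by simp
  then show ?thesis using z assms(3,4) by auto
qed

lemma ring_diff:
  assumes "z \<in> ring_elems" "w \<in> ring_elems"
  shows "(\<lambda>a b. z a b - w a b) \<in> ring_elems"
  using ring_add[OF assms(1) ring_mult[OF ring_int[of "-1"] assms(2)]] by simp

text \<open>Conjugating \<epsilon> alone would turn equality into \<epsilon>^(- m) = \<eta>^n =
  \<epsilon>^m. This is what keeps \<theta> different from 1.\<close>

lemma unit_powers_distinct:
  assumes "m > 0"
  shows "\<epsilon> ^ m \<noteq> \<eta> ^ n"
proof
  assume eq: "\<epsilon> ^ m = \<eta> ^ n"
  have "(\<lambda>a b. a ^ m - b ^ n) \<in> ring_elems" by (intro ring_diff ring_power ring_gens)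
  then have "inverse \<epsilon> ^ m - \<eta> ^ n = 0" using ring_elems_zero[of "\<lambda>a b. a ^ m - b ^ n" "inverse \<epsilon>" \<eta>] eq by simp
  then have "inverse \<epsilon> ^ m = \<epsilon> ^ m" using eq by simp
  moreover have "\<epsilon> ^ m > 1" using eps_gt_1 assms by simp
  moreover have "inverse \<epsilon> ^ m \<le> 1" using eps_gt_1 by (intro power_le_one) (auto simp: inverse_le_1_iff)
  ultimately show False by simp
qed

text \<open>
  The auxiliary function at \<open>i + k M\<close>, with \<open>\<theta> ^ M\<close> replaced by \<open>V / U\<close> and multiplied by \<open>U ^ (11 k)\<close>,
  which clears the denominators of the powers up to \<open>c = 11\<close>.
\<close>

definition auxiliary_value :: "(nat \<Rightarrow> nat \<Rightarrow> int) \<Rightarrow> nat \<Rightarrow> nat \<Rightarrow> nat \<Rightarrow> nat \<Rightarrow>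
    (real \<Rightarrow> real \<Rightarrow> real) \<Rightarrow> (real \<Rightarrow> real \<Rightarrow> real) \<Rightarrow> (real \<Rightarrow> real \<Rightarrow> real) \<Rightarrow> real \<Rightarrow> real \<Rightarrow> real" where
  "auxiliary_value p A i k M \<theta> U V a b = (\<Sum>j<A. \<Sum>c<12. of_int (p j c) * real ((i + k * M) choose j) *
      (\<theta> a b ^ (c * i) * (V a b ^ (c * k) * U a b ^ ((11 - c) * k))))"

lemma auxiliary_value_ring:
  assumes "\<theta> \<in> ring_elems" "U \<in> ring_elems" "V \<in> ring_elems"
  shows "auxiliary_value p A i k M \<theta> U V \<in> ring_elems"
proof -
  have "(\<lambda>a b. \<Sum>j<A. \<Sum>c<12. of_int (p j c * int ((i + k * M) choose j)) *
      (\<theta> a b ^ (c * i) * (V a b ^ (c * k) * U a b ^ ((11 - c) * k)))) \<in> ring_elems"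
    by (intro ring_sum ring_mult ring_power ring_int assms)
  then show ?thesis unfolding auxiliary_value_def[abs_def] by simp
qed

lemma auxiliary_value_bound:
  assumes p: "\<And>j c. j < A \<Longrightarrow> c < 12 \<Longrightarrow> \<bar>p j c\<bar> \<le> int Nb"
    and \<theta>: "\<bar>\<theta> a b\<bar> \<le> E" "1 \<le> E" and B: "\<bar>U a b\<bar> \<le> B" "\<bar>V a b\<bar> \<le> B" "1 \<le> B"
    and "i \<le> I" "k \<le> K"
  shows "\<bar>auxiliary_value p A i k M \<theta> U V a b\<bar> \<le> 12 * real A * real Nb * 2 ^ (i + k * M) * E ^ (12 * I) * B ^ (12 * K)"
proof -
  have summand: "\<bar>of_int (p j c) * real ((i + k * M) choose j) * (\<theta> a b ^ (c * i) * (V a b ^ (c * k) * U a b ^ ((11 - c) * k)))\<bar>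
      \<le> real Nb * 2 ^ (i + k * M) * (E ^ (12 * I) * B ^ (12 * K))" if "j < A" "c < 12" for j c
  proof -
    have "\<bar>\<theta> a b ^ (c * i)\<bar> \<le> E ^ (c * i)" unfolding power_abs using \<theta> by (intro power_mono) auto
    also have "\<dots> \<le> E ^ (12 * I)" using \<theta> assms(7) that by (intro power_increasing mult_le_mono) auto
    finally have 1: "\<bar>\<theta> a b ^ (c * i)\<bar> \<le> E ^ (12 * I)" .
    have "\<bar>V a b ^ (c * k) * U a b ^ ((11 - c) * k)\<bar> \<le> B ^ (c * k) * B ^ ((11 - c) * k)"
      unfolding abs_mult power_abs using B by (intro mult_mono power_mono) auto
    also have "\<dots> = B ^ (11 * k)" by (rule power_split_11[OF that(2)])
    also have "\<dots> \<le> B ^ (12 * K)" using B assms(8) by (intro power_increasing mult_le_mono) auto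
    finally have 2: "\<bar>V a b ^ (c * k) * U a b ^ ((11 - c) * k)\<bar> \<le> B ^ (12 * K)" .
    have 3: "\<bar>real_of_int (p j c)\<bar> \<le> real Nb" using p[OF that] by linarith
    show ?thesis
      by (rule abs_product_le[OF 3 _ 1 2]) (use binomial_le_pow2[of "i + k * M" j] in simp)
  qed
  have "\<bar>auxiliary_value p A i k M \<theta> U V a b\<bar> \<le> (\<Sum>j<A. \<Sum>c<(12::nat). real Nb * 2 ^ (i + k * M) * (E ^ (12 * I) * B ^ (12 * K)))"
    unfolding auxiliary_value_def
    by (intro order.trans[OF sum_abs] sum_mono summand) auto
  then show ?thesis by (simp add: algebra_simps)
qed

text \<open>With U \<theta>^M in place of V the value would be exactly U^(11 k) times the
  exponential polynomial at i + k M. The difference of the powers with exponent c k contributes a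
  factor c k, at most 12 K, and one factor |V - U \<theta>^M|.\<close>

lemma auxiliary_value_near_main:
  assumes p: "\<And>j c. j < A \<Longrightarrow> c < 12 \<Longrightarrow> \<bar>p j c\<bar> \<le> int Nb"
    and \<theta>: "\<bar>\<theta> a b\<bar> \<le> E" "1 \<le> E" and B: "\<bar>U a b\<bar> \<le> B" "\<bar>V a b\<bar> \<le> B" "\<bar>U a b * \<theta> a b ^ M\<bar> \<le> B" "1 \<le> B"
    and "i \<le> I" "k \<le> K"
  shows "\<bar>auxiliary_value p A i k M \<theta> U V a b
      - U a b ^ (11 * k) * (\<Sum>j<A. \<Sum>c<12. of_int (p j c) * real ((i + k * M) choose j) * \<theta> a b ^ (c * (i + k * M)))\<bar>
    \<le> 12 * real A * real Nb * 2 ^ (i + k * M) * E ^ (12 * I) * B ^ (12 * K) * (12 * real K * \<bar>V a b - U a b * \<theta> a b ^ M\<bar>)"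
    (is "\<bar>_ - _\<bar> \<le> ?R")
proof -
  define w where "w = U a b * \<theta> a b ^ M"
  have split: "U a b ^ (11 * k) * \<theta> a b ^ (c * (i + k * M)) = \<theta> a b ^ (c * i) * (w ^ (c * k) * U a b ^ ((11 - c) * k))" if "c < 12" for c
  proof -
    have "U a b ^ (11 * k) = U a b ^ (c * k) * U a b ^ ((11 - c) * k)" by (rule power_split_11[OF that, symmetric])
    moreover have "\<theta> a b ^ (c * (i + k * M)) = \<theta> a b ^ (c * i) * (\<theta> a b ^ M) ^ (c * k)"
    proof -
      have "c * (i + k * M) = c * i + M * (c * k)" by (simp add: algebra_simps)
      then show ?thesis by (simp only: power_add power_mult)
    qed
    ultimately show ?thesis unfolding w_def by (simp only: power_mult_distrib mult_ac)
  qed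
  have summand: "\<bar>of_int (p j c) * real ((i + k * M) choose j) * (\<theta> a b ^ (c * i) * ((V a b ^ (c * k) - w ^ (c * k)) * U a b ^ ((11 - c) * k)))\<bar>
      \<le> real Nb * 2 ^ (i + k * M) * (E ^ (12 * I) * (B ^ (12 * K) * (12 * real K * \<bar>V a b - w\<bar>)))" if "j < A" "c < 12" for j c
  proof -
    have "\<bar>\<theta> a b ^ (c * i)\<bar> \<le> E ^ (c * i)" unfolding power_abs using \<theta> by (intro power_mono) auto
    also have "\<dots> \<le> E ^ (12 * I)" using \<theta> assms(8) that by (intro power_increasing mult_le_mono) auto
    finally have 1: "\<bar>\<theta> a b ^ (c * i)\<bar> \<le> E ^ (12 * I)" .
    note e = power_split_11[OF that(2), of B k]
    have "\<bar>(V a b ^ (c * k) - w ^ (c * k)) * U a b ^ ((11 - c) * k)\<bar>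
        \<le> (real (c * k) * B ^ (c * k) * \<bar>V a b - w\<bar>) * B ^ ((11 - c) * k)"
      unfolding abs_mult power_abs
      using B w_def by (intro mult_mono power_mono abs_power_diff_le) auto
    also have "\<dots> = real (c * k) * \<bar>V a b - w\<bar> * (B ^ (c * k) * B ^ ((11 - c) * k))" by (simp only: mult_ac)
    also have "\<dots> = real (c * k) * \<bar>V a b - w\<bar> * B ^ (11 * k)" by (simp only: e)
    also have "\<dots> \<le> (12 * real K) * \<bar>V a b - w\<bar> * B ^ (12 * K)"
      using B assms(9) that by (intro mult_mono power_increasing mult_le_mono) (auto intro: mult_mono)
    finally have 2: "\<bar>(V a b ^ (c * k) - w ^ (c * k)) * U a b ^ ((11 - c) * k)\<bar> \<le> B ^ (12 * K) * (12 * real K * \<bar>V a b - w\<bar>)"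
      by (simp add: algebra_simps)
    have 3: "\<bar>real_of_int (p j c)\<bar> \<le> real Nb" using p[OF that] by linarith
    show ?thesis
      by (rule abs_product_le[OF 3 _ 1 2]) (use binomial_le_pow2[of "i + k * M" j] in simp)
  qed
  have eq1: "auxiliary_value p A i k M \<theta> U V a b
      - U a b ^ (11 * k) * (\<Sum>j<A. \<Sum>c<12. of_int (p j c) * real ((i + k * M) choose j) * \<theta> a b ^ (c * (i + k * M)))
    = (\<Sum>j<A. \<Sum>c<12. of_int (p j c) * real ((i + k * M) choose j) * (\<theta> a b ^ (c * i) * (V a b ^ (c * k) * U a b ^ ((11 - c) * k)))
        - U a b ^ (11 * k) * (of_int (p j c) * real ((i + k * M) choose j) * \<theta> a b ^ (c * (i + k * M))))"
    by (simp only: auxiliary_value_def sum_distrib_left sum_subtractf)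
  also have eq2: "\<dots> = (\<Sum>j<A. \<Sum>c<12. of_int (p j c) * real ((i + k * M) choose j) * (\<theta> a b ^ (c * i) * ((V a b ^ (c * k) - w ^ (c * k)) * U a b ^ ((11 - c) * k))))"
  proof (intro sum.cong refl)
    fix j c assume c: "c \<in> {..<12::nat}"
    have "U a b ^ (11 * k) * (of_int (p j c) * real ((i + k * M) choose j) * \<theta> a b ^ (c * (i + k * M)))
      = of_int (p j c) * real ((i + k * M) choose j) * (\<theta> a b ^ (c * i) * (w ^ (c * k) * U a b ^ ((11 - c) * k)))"
      using split[of c] c by (simp only: lessThan_iff mult.left_commute[of "U a b ^ (11 * k)"])
    then show "of_int (p j c) * real ((i + k * M) choose j) * (\<theta> a b ^ (c * i) * (V a b ^ (c * k) * U a b ^ ((11 - c) * k)))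
      - U a b ^ (11 * k) * (of_int (p j c) * real ((i + k * M) choose j) * \<theta> a b ^ (c * (i + k * M)))
      = of_int (p j c) * real ((i + k * M) choose j) * (\<theta> a b ^ (c * i) * ((V a b ^ (c * k) - w ^ (c * k)) * U a b ^ ((11 - c) * k)))"
      by (simp only: left_diff_distrib right_diff_distrib)
  qed
  finally show ?thesis
  proof (rule ssubst)
    have "\<bar>\<Sum>j<A. \<Sum>c<12. of_int (p j c) * real ((i + k * M) choose j) * (\<theta> a b ^ (c * i) * ((V a b ^ (c * k) - w ^ (c * k)) * U a b ^ ((11 - c) * k)))\<bar>
      \<le> (\<Sum>j<A. \<Sum>c<(12::nat). real Nb * 2 ^ (i + k * M) * (E ^ (12 * I) * (B ^ (12 * K) * (12 * real K * \<bar>V a b - w\<bar>))))"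
      by (intro order.trans[OF sum_abs] sum_mono summand) auto
    then show "\<bar>\<Sum>j<A. \<Sum>c<12. of_int (p j c) * real ((i + k * M) choose j) * (\<theta> a b ^ (c * i) * ((V a b ^ (c * k) - w ^ (c * k)) * U a b ^ ((11 - c) * k)))\<bar> \<le> ?R"
      unfolding w_def by (simp add: mult_ac)
  qed
qed

end

section \<open>Approximation by powers of a unit\<close>

lemma mult_le_expI:
  fixes x y :: real
  assumes "x \<le> exp a" "y \<le> exp b" "0 \<le> x" "0 \<le> y" "a + b \<le> c"
  shows "x * y \<le> exp c"
proof -
  have "x * y \<le> exp a * exp b" using assms by (intro mult_mono) auto
  also have "\<dots> = exp (a + b)" by (simp add: exp_add)
  also have "\<dots> \<le> exp c" using assms by simp
  finally show ?thesis .
qed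

lemma power_le_expI:
  fixes x :: real
  assumes "x \<le> exp a" "0 \<le> x" "real n * a \<le> c"
  shows "x ^ n \<le> exp c"
proof -
  have "x ^ n \<le> exp a ^ n" using assms by (intro power_mono) auto
  also have "\<dots> = exp (real n * a)" by (simp add: exp_of_nat_mult)
  also have "\<dots> \<le> exp c" using assms by simp
  finally show ?thesis .
qed

lemma nat_floor_ge_half:
  fixes x :: real
  assumes "x \<ge> 1"
  shows "x / 2 \<le> real (nat \<lfloor>x\<rfloor>)" "real (nat \<lfloor>x\<rfloor>) \<le> x"
proof -
  show "real (nat \<lfloor>x\<rfloor>) \<le> x" using assms by linarith
  have "1 \<le> \<lfloor>x\<rfloor>" using assms by simp
  then show "x / 2 \<le> real (nat \<lfloor>x\<rfloor>)" by linarith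
qed

lemma two_le_exp_1: "(2::real) \<le> exp 1"
  using exp_ge_add_one_self[of "1::real"] by simp

context biquadratic
begin

text \<open>The budget in powers of exp L: the coefficients of the auxiliary function have 1/4, its
  value at the main place has at most -0.93, and each of the other three conjugates has at most
  0.256. As 3 times 0.256 is less than 0.93, a nonzero ring element would have norm below 1.\<close>

lemma no_close_pair:
  fixes L g :: real and d d' M :: nat and U V :: "real \<Rightarrow> real \<Rightarrow> real"
  defines "H \<equiv> real d * ln \<epsilon>"
  assumes g: "24 * exp 3000000000000 \<le> g"
    and H: "1000 \<le> H" and L: "100000000000000 \<le> L" "1000000 * H \<le> L"
    and dist: "\<bar>real d * ln \<epsilon> - real d' * ln \<eta>\<bar> \<le> 1 / g"
    and M: "L / (2 * H) \<le> real M" "real M \<le> L / H"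
    and UV: "U \<in> ring_elems" "V \<in> ring_elems" "U \<epsilon> \<eta> \<noteq> 0" "V \<epsilon> \<eta> \<noteq> 0"
    and U: "\<And>a b. a \<in> {\<epsilon>, inverse \<epsilon>} \<Longrightarrow> b \<in> {\<eta>, inverse \<eta>} \<Longrightarrow> \<bar>U a b\<bar> \<le> exp (4 * L / (g * H))"
    and V: "\<And>a b. a \<in> {\<epsilon>, inverse \<epsilon>} \<Longrightarrow> b \<in> {\<eta>, inverse \<eta>} \<Longrightarrow> \<bar>V a b\<bar> \<le> exp (4 * L / (g * H))"
    and close: "\<bar>V \<epsilon> \<eta> - U \<epsilon> \<eta> * (\<epsilon> ^ d * inverse \<eta> ^ d') ^ M\<bar> \<le> exp (- (199 / 100) * L)"
  shows False
proof -
  have pos: "H > 0" "L > 0" using H L by auto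
  have "(1::real) \<le> exp 3000000000000" by simp
  then have g60: "g \<ge> 24" using g by linarith
  have g1000: "g \<ge> 1000" using g exp_ge_add_one_self[of "3000000000000::real"] by linarith
  \<comment> \<open>B bounds U, V and U \<theta>^M. E bounds all conjugates of \<theta>: the power
    of \<epsilon> is at most exp H, that of \<eta> at most exp (2 H).\<close>
  define B where "B = exp (5 * L / (g * H))"
  define E where "E = exp (3 * H)"
  \<comment> \<open>K and I0 are small enough that i + k M is at most L / 900 and that powers of
    \<theta>, U, V cost a few thousandths of L. Still I0 K is at least L / 144000000, and A is
    chosen so that 2^12 A stays below this. The 12 added in I are the shifts of the zero
    estimate.\<close>
  define A where "A = nat \<lfloor>L / 1000000000000\<rfloor>"
  define K where "K = nat \<lfloor>H / 1000\<rfloor>"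
  define I0 where "I0 = nat \<lfloor>L / (36000 * H)\<rfloor>"
  define I where "I = I0 + 12"
  define Nb where "Nb = nat \<lfloor>exp (L / 4)\<rfloor>"
  define W where "W = nat \<lfloor>exp (121 / 100 * L)\<rfloor>"
  define \<upsilon> where "\<upsilon> = 24 / g"
  define \<delta> where "\<delta> = exp (- (95 / 100) * L)"
  define \<theta> where "\<theta> = (\<lambda>a b. a ^ d * inverse b ^ d' :: real)"
  define lam where "lam = real d * ln \<epsilon> - real d' * ln \<eta>"
  have A: "L / 2000000000000 \<le> real A" "real A \<le> L / 1000000000000"
    using nat_floor_ge_half[of "L / 1000000000000"] L unfolding A_def by simp_all
  have A1: "A \<ge> 1" using A(1) L by linarith
  have K: "H / 2000 \<le> real K" "real K \<le> H / 1000"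
    using nat_floor_ge_half[of "H / 1000"] H unfolding K_def by simp_all
  have "1 \<le> L / (36000 * H)" using pos L by (simp add: field_simps)
  from nat_floor_ge_half[OF this] have I0: "L / (72000 * H) \<le> real I0" "real I0 \<le> L / (36000 * H)"
    unfolding I0_def by simp_all
  have "12 \<le> L / (36000 * H)" using pos L by (simp add: field_simps)
  then have I: "real I \<le> L / (18000 * H)" using I0(2) unfolding I_def by (simp add: field_simps)
  have Nb: "real Nb \<le> exp (L / 4)" "exp (L / 4) \<le> real Nb + 1"
    using exp_ge_zero[of "L / 4"] unfolding Nb_def by linarith+
  have W': "real W \<le> exp (121 / 100 * L)" "exp (121 / 100 * L) - 1 \<le> real W"
    using exp_ge_zero[of "121 / 100 * L"] unfolding W_def by linarith+
  have xb: "real (i + k * M) \<le> L / 900" if "i \<le> I" "k \<le> K" for i k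
  proof -
    have "real k * real M \<le> (H / 1000) * (L / H)"
      using that K(2) M(2) pos by (intro mult_mono) (auto intro: order.trans)
    also have "\<dots> = L / 1000" using pos by simp
    finally have 1: "real k * real M \<le> L / 1000" .
    have "L / (18000 * H) \<le> L / 18000" using H pos by (simp add: field_simps)
    then have "real i \<le> L / 18000" using that(1) I by linarith
    then show ?thesis using 1 pos by simp
  qed
  have \<theta>exp: "\<theta> \<epsilon> \<eta> = exp lam"
    using eps_gt_1 eta_gt_1 by (simp add: \<theta>_def lam_def exp_diff exp_of_nat_mult field_simps)
  have \<theta>1: "\<theta> \<epsilon> \<eta> \<noteq> 1"
  proof -
    have "d > 0" using pos unfolding H_def by (cases d) auto
    then show ?thesis using unit_powers_distinct[of d d'] eta_gt_1 by (simp add: \<theta>_def field_simps)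
  qed
  have lamg: "\<bar>lam\<bar> \<le> 1 / g" using dist by (simp add: lam_def)
  have \<upsilon>1: "\<upsilon> \<le> 1" using g60 by (simp add: \<upsilon>_def)
  have u: "\<bar>\<theta> \<epsilon> \<eta> ^ c - 1\<bar> \<le> \<upsilon>" if "c < 12" for c
  proof -
    have "\<bar>real c * lam\<bar> \<le> 12 * (1 / g)" unfolding abs_mult using that lamg by (intro mult_mono) auto
    moreover have "12 * (1 / g) \<le> 1" using g60 by simp
    ultimately have "\<bar>exp (real c * lam) - 1\<bar> \<le> 2 * (12 * (1 / g))" using exp_diff_le[of "real c * lam"] by linarith
    then show ?thesis by (simp add: \<theta>exp \<upsilon>_def exp_of_nat_mult)
  qed
  \<comment> \<open>A is at least L / 2000000000000 and \<upsilon> at most exp (- 3000000000000);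
    this is the step that dictates the threshold for g.\<close>
  have \<upsilon>A: "\<upsilon> ^ A \<le> exp (- (3 / 2) * L)"
  proof (rule power_le_expI)
    have "24 / g \<le> 24 / (24 * exp 3000000000000)" using g using g60 by (intro divide_left_mono) auto
    then show "\<upsilon> \<le> exp (- 3000000000000)" by (simp add: \<upsilon>_def exp_minus field_simps)
    show "0 \<le> \<upsilon>" using g60 by (simp add: \<upsilon>_def)
    show "real A * - 3000000000000 \<le> - (3 / 2) * L" using A(1) by simp
  qed
  have A12: "12 * real A \<le> exp (L / 1000)"
    using linear_le_exp[of L] A(2) L by linarith
  have pow2: "2 ^ n \<le> exp (real n)" for n
    using power_le_expI[OF two_le_exp_1, of n "real n"] by simp
  have pow4: "4 ^ n \<le> exp (2 * real n)" for n
  proof -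
    have "(4::real) ^ n = 2 ^ n * 2 ^ n" by (simp flip: power_mult_distrib)
    also have "\<dots> \<le> exp (2 * real n)" by (rule mult_le_expI[OF pow2 pow2]) auto
    finally show ?thesis .
  qed
  have pow16: "16 ^ n \<le> exp (4 * real n)" for n
  proof -
    have "(16::real) ^ n = 4 ^ n * 4 ^ n" by (simp flip: power_mult_distrib)
    also have "\<dots> \<le> exp (4 * real n)" by (rule mult_le_expI[OF pow4 pow4]) auto
    finally show ?thesis .
  qed
  \<comment> \<open>The exponent 1.202 is 0.95 from \<delta>, 0.25 from the coefficients and 0.002
    from the other factors; 1.21 leaves room for the constant factor, the summand 2 and the
    rounding.\<close>
  have W: "2 * (real (A * 12) * 16 ^ A * real Nb) / \<delta> + 2 \<le> real W"
  proof -
    have "real (A * 12) * 16 ^ A * real Nb \<le> exp (252 / 1000 * L)"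
    proof (rule mult_le_expI[OF _ Nb(1)])
      show "real (A * 12) * 16 ^ A \<le> exp (2 / 1000 * L)"
        using A12 A L by (intro mult_le_expI[OF _ pow16, where a = "L / 1000"]) auto
    qed auto
    then have "2 * (real (A * 12) * 16 ^ A * real Nb) / \<delta> \<le> 2 * exp (252 / 1000 * L) / \<delta>"
      by (intro divide_right_mono mult_left_mono) (auto simp: \<delta>_def)
    also have "\<dots> = 2 * exp (1202 / 1000 * L)" by (simp add: \<delta>_def exp_minus field_simps flip: exp_add)
    finally have 1: "2 * (real (A * 12) * 16 ^ A * real Nb) / \<delta> \<le> 2 * exp (1202 / 1000 * L)" .
    have "exp (121 / 100 * L) = exp (8 / 1000 * L) * exp (1202 / 1000 * L)" by (simp add: field_simps flip: exp_add)
    moreover have "5 * exp (1202 / 1000 * L) \<le> exp (8 / 1000 * L) * exp (1202 / 1000 * L)"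
    proof (rule mult_right_mono)
      show "5 \<le> exp (8 / 1000 * L)" using exp_ge_add_one_self[of "8 / 1000 * L"] L by linarith
    qed simp
    moreover have "1 \<le> exp (1202 / 1000 * L)" using pos by simp
    ultimately show ?thesis using 1 W'(2) by linarith
  qed
  \<comment> \<open>12 A unknowns with about exp (L / 4) choices each, against 2 A forms with about
    exp (1.21 L) boxes each: 3 exceeds 2.42.\<close>
  have pigeon: "W ^ (2 * A) < (Nb + 1) ^ (A * 12)"
  proof -
    have "real W ^ (2 * A) \<le> exp (242 / 100 * real A * L)" by (rule power_le_expI[OF W'(1)]) auto
    also have "\<dots> < exp (3 * real A * L)" using A1 pos by simp
    also have "\<dots> = exp (real (A * 12) * (L / 4))" by simp
    also have "\<dots> = exp (L / 4) ^ (A * 12)" by (rule exp_of_nat_mult)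
    also have "\<dots> \<le> (real Nb + 1) ^ (A * 12)" by (intro power_mono Nb) auto
    finally have "real (W ^ (2 * A)) < real ((Nb + 1) ^ (A * 12))" by (simp add: add.commute)
    then show ?thesis by (simp only: of_nat_less_iff)
  qed
  have \<delta>0: "\<delta> > 0" by (simp add: \<delta>_def)
  obtain p :: "nat \<Rightarrow> nat \<Rightarrow> int" where p: "\<exists>a<A. \<exists>c<12. p a c \<noteq> 0" "\<And>a c. a < A \<Longrightarrow> c < 12 \<Longrightarrow> \<bar>p a c\<bar> \<le> int Nb"
    "\<And>x. \<bar>\<Sum>a<A. \<Sum>c<12. real_of_int (p a c) * real (x choose a) * \<theta> \<epsilon> \<eta> ^ (c * x)\<bar>
       \<le> \<delta> * 4 ^ A * 2 ^ x + real (A * 12) * real Nb * 4 ^ x * \<upsilon> ^ A"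
    using auxiliary_function[OF u \<upsilon>1 \<delta>0 W pigeon] by blast
  define P where "P = (\<lambda>c. \<Sum>a<A. smult (real_of_int (p a c)) (binomial_poly a))"
  obtain a0 c0 where ac0: "a0 < A" "c0 < 12" "p a0 c0 \<noteq> 0" using p(1) by blast
  have Pnz: "P c0 \<noteq> 0"
    unfolding P_def using ac0 by (intro sum_binomial_poly_nonzero[of _ a0]) auto
  have Pdeg: "Polynomial.degree (P c) \<le> A" for c
    unfolding P_def by (intro degree_sum_le) (auto intro!: order.trans[OF degree_smult_le] simp: degree_binomial_poly)
  define \<gamma> where "\<gamma> = V \<epsilon> \<eta> / U \<epsilon> \<eta>"
  have \<gamma>0: "\<gamma> \<noteq> 0" using UV by (simp add: \<gamma>_def)
  have I0M: "I0 \<le> M"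
  proof -
    have "real I0 \<le> L / (36000 * H)" by (rule I0)
    also have "\<dots> \<le> L / (2 * H)" using pos by (simp add: field_simps)
    also have "\<dots> \<le> real M" by (rule M)
    finally show ?thesis by simp
  qed
  have I0K: "2 ^ 12 * A < I0 * K"
  proof -
    have "real (2 ^ 12 * A) < L / 144000000" using A(2) pos by simp
    also have "\<dots> = L / (72000 * H) * (H / 2000)" using pos by simp
    also have "\<dots> \<le> real I0 * real K" using I0 K pos by (intro mult_mono) auto
    finally have "real (2 ^ 12 * A) < real (I0 * K)" by simp
    then show ?thesis by (simp only: of_nat_less_iff)
  qed
  have \<theta>0: "\<theta> \<epsilon> \<eta> > 0" by (simp add: \<theta>exp)
  obtain i k where ik: "i < I0 + 12" "k < K"
      "(\<Sum>c<12. poly (P c) (real (i + k * M)) * (\<theta> \<epsilon> \<eta> ^ (c * i) * \<gamma> ^ (c * k))) \<noteq> 0"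
    using zero_estimate[where p = P and T = 12 and D = A and \<gamma> = \<gamma> and \<theta> = "\<theta> \<epsilon> \<eta>" and I = I0 and K = K and M = M, OF \<theta>0 \<theta>1 \<gamma>0 ac0(2) Pnz Pdeg I0M I0K] by blast
  have iI: "i \<le> I" "k \<le> K" using ik by (auto simp: I_def)
  define \<Phi> where "\<Phi> = auxiliary_value p A i k M \<theta> U V"
  have \<theta>ring: "\<theta> \<in> ring_elems" unfolding \<theta>_def by (intro ring_mult ring_power ring_gens)
  have \<Phi>ring: "\<Phi> \<in> ring_elems" unfolding \<Phi>_def by (intro auxiliary_value_ring \<theta>ring UV)
  \<comment> \<open>Clearing denominators multiplies the nonvanishing sum from the zero estimate by
    U^(11 k), which is nonzero.\<close>
  have \<Phi>nz: "\<Phi> \<epsilon> \<eta> \<noteq> 0"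
  proof -
    have "V \<epsilon> \<eta> ^ (c * k) * U \<epsilon> \<eta> ^ ((11 - c) * k) = U \<epsilon> \<eta> ^ (11 * k) * \<gamma> ^ (c * k)" if "c < 12" for c
    proof -
      have "V \<epsilon> \<eta> = \<gamma> * U \<epsilon> \<eta>" using UV by (simp add: \<gamma>_def)
      then show ?thesis using power_split_11[OF that, of "U \<epsilon> \<eta>" k] by (simp add: power_mult_distrib mult_ac)
    qed
    then have "\<Phi> \<epsilon> \<eta> = (\<Sum>j<A. \<Sum>c<12. of_int (p j c) * real ((i + k * M) choose j) *
        (\<theta> \<epsilon> \<eta> ^ (c * i) * (U \<epsilon> \<eta> ^ (11 * k) * \<gamma> ^ (c * k))))"
      unfolding \<Phi>_def auxiliary_value_def by (intro sum.cong refl) simp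
    also have "\<dots> = (\<Sum>c<12. \<Sum>j<A. of_int (p j c) * real ((i + k * M) choose j) *
        (\<theta> \<epsilon> \<eta> ^ (c * i) * (U \<epsilon> \<eta> ^ (11 * k) * \<gamma> ^ (c * k))))" by (rule sum.swap)
    also have "\<dots> = (\<Sum>c<12. U \<epsilon> \<eta> ^ (11 * k) * (poly (P c) (real (i + k * M)) * (\<theta> \<epsilon> \<eta> ^ (c * i) * \<gamma> ^ (c * k))))"
      unfolding P_def poly_sum poly_smult poly_binomial_poly sum_distrib_left sum_distrib_right
      by (intro sum.cong refl) (simp add: mult_ac)
    also have "\<dots> = U \<epsilon> \<eta> ^ (11 * k) * (\<Sum>c<12. poly (P c) (real (i + k * M)) * (\<theta> \<epsilon> \<eta> ^ (c * i) * \<gamma> ^ (c * k)))"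
      by (simp only: sum_distrib_left)
    finally show ?thesis using ik(3) UV(3) by simp
  qed
  have gH: "0 < g * H" using g60 pos by simp
  have B1: "1 \<le> B" using pos gH by (simp add: B_def)
  have E1: "1 \<le> E" using pos by (simp add: E_def)
  have B4: "exp (4 * L / (g * H)) \<le> B" using pos gH by (simp add: B_def divide_right_mono)
  have x2: "2 ^ (i + k * M) \<le> exp (L / 900)" by (rule order.trans[OF pow2]) (use xb[OF iI] in simp)
  have x4: "4 ^ (i + k * M) \<le> exp (L / 450)" by (rule order.trans[OF pow4]) (use xb[OF iI] in simp)
  have EI: "E ^ (12 * I) \<le> exp (L / 500)"
  proof (rule power_le_expI[of _ "3 * H"])
    have "real I * (36 * H) \<le> L / (18000 * H) * (36 * H)" using I pos by (intro mult_right_mono) auto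
    then show "real (12 * I) * (3 * H) \<le> L / 500" using pos by simp
  qed (auto simp: E_def)
  have BK: "B ^ (12 * K) \<le> exp (L / 1000)"
  proof (rule power_le_expI[of _ "5 * L / (g * H)"])
    have "real (12 * K) * (5 * L / (g * H)) \<le> (12 * (H / 1000)) * (5 * L / (g * H))"
      using K pos gH by (intro mult_right_mono) auto
    also have "\<dots> = 60 * L / (1000 * g)" using pos g60 by (simp add: field_simps)
    also have "\<dots> \<le> L / 1000" using pos g1000 by (simp add: field_simps)
    finally show "real (12 * K) * (5 * L / (g * H)) \<le> L / 1000" .
  qed (auto simp: B_def)
  define D where "D = 12 * real A * real Nb * 2 ^ (i + k * M) * E ^ (12 * I) * B ^ (12 * K)"
  have D: "D \<le> exp (256 / 1000 * L)"
  proof -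
    have 1: "12 * real A * real Nb \<le> exp (251 / 1000 * L)" by (rule mult_le_expI[OF A12 Nb(1)]) auto
    have 2: "12 * real A * real Nb * 2 ^ (i + k * M) \<le> exp (2522 / 10000 * L)"
      by (rule mult_le_expI[OF 1 x2]) (use pos in auto)
    have 3: "12 * real A * real Nb * 2 ^ (i + k * M) * E ^ (12 * I) \<le> exp (2542 / 10000 * L)"
      by (rule mult_le_expI[OF 2 EI]) (use pos E1 in auto)
    show ?thesis unfolding D_def
      by (rule mult_le_expI[OF 3 BK]) (use pos E1 B1 in auto)
  qed
  have D0: "D \<ge> 0" using E1 B1 by (simp add: D_def)
  have \<theta>E: "\<bar>\<theta> a b\<bar> \<le> E" if ab: "a \<in> {\<epsilon>, inverse \<epsilon>}" "b \<in> {\<eta>, inverse \<eta>}" for a b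
  proof -
    have inv: "inverse \<epsilon> \<le> \<epsilon>" "inverse \<eta> \<le> \<eta>" "0 < \<epsilon>" "0 < \<eta>"
      using eps_gt_1 eta_gt_1 one_less_inverse_iff[of \<epsilon>] one_less_inverse_iff[of \<eta>] by linarith+
    have "a ^ d \<le> \<epsilon> ^ d" using ab inv by (intro power_mono) auto
    also have "\<epsilon> ^ d = exp H" using inv by (simp add: H_def exp_of_nat_mult)
    finally have 1: "a ^ d \<le> exp H" .
    have "1 / g \<le> 1" using g60 by simp
    then have d'2: "real d' * ln \<eta> \<le> 2 * H" using dist H unfolding H_def by linarith
    have "inverse b ^ d' \<le> \<eta> ^ d'" using ab inv by (intro power_mono) auto
    also have "\<eta> ^ d' = exp (real d' * ln \<eta>)" using inv by (simp add: exp_of_nat_mult)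
    also have "\<dots> \<le> exp (2 * H)" using d'2 by simp
    finally have 2: "inverse b ^ d' \<le> exp (2 * H)" .
    have "0 \<le> a ^ d" "0 \<le> inverse b ^ d'" using ab inv by auto
    with 1 2 show ?thesis unfolding \<theta>_def E_def by (simp add: mult_le_expI)
  qed
  have UB: "\<bar>U a b\<bar> \<le> B" "\<bar>V a b\<bar> \<le> B" if "a \<in> {\<epsilon>, inverse \<epsilon>}" "b \<in> {\<eta>, inverse \<eta>}" for a b
    using U[OF that] V[OF that] B4 by linarith+
  have place: "\<bar>\<Phi> a b\<bar> \<le> exp (256 / 1000 * L)" if "a \<in> {\<epsilon>, inverse \<epsilon>}" "b \<in> {\<eta>, inverse \<eta>}" for a b
  proof -
    have "\<bar>\<Phi> a b\<bar> \<le> D" unfolding \<Phi>_def D_def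
      by (rule auxiliary_value_bound) (use p(2) \<theta>E[OF that] E1 UB[OF that] B1 iI in auto)
    then show ?thesis using D by linarith
  qed
  have UM: "\<bar>U \<epsilon> \<eta> * \<theta> \<epsilon> \<eta> ^ M\<bar> \<le> B"
  proof -
    have "\<theta> \<epsilon> \<eta> ^ M \<le> exp (L / (g * H))"
    proof (rule power_le_expI[of _ lam])
      have "real M * lam \<le> real M * \<bar>lam\<bar>" by (intro mult_left_mono) auto
      also have "\<dots> \<le> (L / H) * (1 / g)" using M(2) lamg pos by (intro mult_mono) auto
      finally have "real M * lam \<le> (L / H) * (1 / g)" .
      then show "real M * lam \<le> L / (g * H)" by (simp add: field_simps)
    qed (auto simp: \<theta>exp)
    then have "\<bar>U \<epsilon> \<eta>\<bar> * \<theta> \<epsilon> \<eta> ^ M \<le> B" unfolding B_def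
      by (intro mult_le_expI[OF U]) (auto simp: \<theta>exp simp flip: add_divide_distrib)
    then show ?thesis by (simp add: abs_mult \<theta>exp)
  qed
  define F where "F = (\<Sum>j<A. \<Sum>c<12. of_int (p j c) * real ((i + k * M) choose j) * \<theta> \<epsilon> \<eta> ^ (c * (i + k * M)))"
  \<comment> \<open>Two contributions: the replacement of V by U \<theta>^M, and F itself, whose
    size is propagated from the nodes with the truncation error added.\<close>
  have main: "\<bar>\<Phi> \<epsilon> \<eta>\<bar> \<le> exp (- (93 / 100) * L)"
  proof -
    have "\<bar>\<Phi> \<epsilon> \<eta> - U \<epsilon> \<eta> ^ (11 * k) * F\<bar> \<le> D * (12 * real K * \<bar>V \<epsilon> \<eta> - U \<epsilon> \<eta> * \<theta> \<epsilon> \<eta> ^ M\<bar>)"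
      unfolding \<Phi>_def D_def F_def
      by (rule auxiliary_value_near_main[where Nb = Nb]) (use p(2) \<theta>E UB UM E1 B1 iI in auto)
    also have "\<dots> \<le> exp (- (94 / 100) * L)"
    proof (rule mult_le_expI[OF D])
      have "12 * real K \<le> exp (1 / 1000 * L)" using K(2) L linear_le_exp[of L] pos by simp
      then show "12 * real K * \<bar>V \<epsilon> \<eta> - U \<epsilon> \<eta> * \<theta> \<epsilon> \<eta> ^ M\<bar> \<le> exp (- (1989 / 1000) * L)"
        using close unfolding \<theta>_def by (rule mult_le_expI) auto
    qed (use D0 pos in auto)
    finally have 1: "\<bar>\<Phi> \<epsilon> \<eta> - U \<epsilon> \<eta> ^ (11 * k) * F\<bar> \<le> exp (- (94 / 100) * L)" .
    have "\<bar>F\<bar> \<le> \<delta> * 4 ^ A * 2 ^ (i + k * M) + 12 * real A * real Nb * 4 ^ (i + k * M) * \<upsilon> ^ A"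
      using p(3)[of "i + k * M"] unfolding F_def by (simp add: mult.commute)
    also have "\<dots> \<le> exp (- (945 / 1000) * L) + exp (- (945 / 1000) * L)"
    proof (rule add_mono)
      have a: "\<delta> * 4 ^ A \<le> exp (- (949 / 1000) * L)"
        using A L unfolding \<delta>_def by (intro mult_le_expI[OF _ pow4]) auto
      show "\<delta> * 4 ^ A * 2 ^ (i + k * M) \<le> exp (- (945 / 1000) * L)"
        by (rule mult_le_expI[OF a x2]) (use pos \<delta>0 in auto)
      have 1: "12 * real A * real Nb \<le> exp (251 / 1000 * L)" by (rule mult_le_expI[OF A12 Nb(1)]) auto
      have 2: "12 * real A * real Nb * 4 ^ (i + k * M) \<le> exp (254 / 1000 * L)"
        by (rule mult_le_expI[OF 1 x4]) (use pos in auto)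
      show "12 * real A * real Nb * 4 ^ (i + k * M) * \<upsilon> ^ A \<le> exp (- (945 / 1000) * L)"
        by (rule mult_le_expI[OF 2 \<upsilon>A]) (use pos g60 in \<open>auto simp: \<upsilon>_def\<close>)
    qed
    finally have "\<bar>F\<bar> \<le> 2 * exp (- (945 / 1000) * L)" by simp
    moreover have "2 * exp (- (945 / 1000) * L) \<le> exp (- (944 / 1000) * L)"
    proof (rule mult_le_expI[of _ "1 / 1000 * L"])
      show "2 \<le> exp (1 / 1000 * L)" using exp_ge_add_one_self[of "1 / 1000 * L"] L by linarith
    qed auto
    ultimately have Fb: "\<bar>F\<bar> \<le> exp (- (944 / 1000) * L)" by linarith
    have "\<bar>U \<epsilon> \<eta> ^ (11 * k)\<bar> \<le> B ^ (11 * k)" unfolding power_abs using UB[of \<epsilon> \<eta>] by (intro power_mono) auto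
    also have "\<dots> \<le> B ^ (12 * K)" using B1 iI by (intro power_increasing) auto
    also note BK
    finally have "\<bar>U \<epsilon> \<eta> ^ (11 * k)\<bar> * \<bar>F\<bar> \<le> exp (- (94 / 100) * L)"
      using Fb by (rule mult_le_expI) (use pos in auto)
    then have "\<bar>U \<epsilon> \<eta> ^ (11 * k) * F\<bar> \<le> exp (- (94 / 100) * L)" by (simp add: abs_mult)
    with 1 have "\<bar>\<Phi> \<epsilon> \<eta>\<bar> \<le> 2 * exp (- (94 / 100) * L)" by linarith
    also have "\<dots> \<le> exp (- (93 / 100) * L)"
    proof (rule mult_le_expI[of _ "1 / 100 * L"])
      show "2 \<le> exp (1 / 100 * L)" using exp_ge_add_one_self[of "1 / 100 * L"] L by linarith
    qed auto
    finally show ?thesis .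
  qed
  have "\<bar>\<Phi> \<epsilon> \<eta>\<bar> * \<bar>\<Phi> \<epsilon> (inverse \<eta>)\<bar> * \<bar>\<Phi> (inverse \<epsilon>) \<eta>\<bar> * \<bar>\<Phi> (inverse \<epsilon>) (inverse \<eta>)\<bar> \<le> exp (- (16 / 100) * L)"
  proof -
    have 1: "\<bar>\<Phi> \<epsilon> \<eta>\<bar> * \<bar>\<Phi> \<epsilon> (inverse \<eta>)\<bar> \<le> exp (- (674 / 1000) * L)"
      by (rule mult_le_expI[OF main place]) (use pos in auto)
    have 2: "\<bar>\<Phi> \<epsilon> \<eta>\<bar> * \<bar>\<Phi> \<epsilon> (inverse \<eta>)\<bar> * \<bar>\<Phi> (inverse \<epsilon>) \<eta>\<bar> \<le> exp (- (418 / 1000) * L)"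
      by (rule mult_le_expI[OF 1 place]) (use pos in auto)
    show ?thesis by (rule mult_le_expI[OF 2 place]) (use pos in auto)
  qed
  moreover have "exp (- (16 / 100) * L) < 1" using pos by simp
  ultimately show False using ring_elems_norm_ge_1[OF \<Phi>ring \<Phi>nz] by linarith
qed

text \<open>The trace is an integer above 2, hence at least 3, while the inverse is below 1. So the
  logarithms of all units in question have an absolute positive lower bound.\<close>

lemma eps_bounds: "2 < \<epsilon>" "2 < \<eta>"
proof -
  have a: "2 < x" if "x > 1" "x + inverse x = of_int n" for x :: real and n :: int
  proof -
    have "inverse x < 1" using that by (simp add: inverse_less_1_iff)
    then have "0 < (x - 1) * (1 - inverse x)" using that by (intro mult_pos_pos) auto
    also have "(x - 1) * (1 - inverse x) = x + inverse x - 2" using that by (simp add: left_diff_distrib right_diff_distrib)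
    finally have "2 < x + inverse x" by simp
    then have "n \<ge> 3" using that(2) by linarith
    then have "real_of_int n \<ge> 3" by simp
    then show ?thesis using that(2) \<open>inverse x < 1\<close> by linarith
  qed
  show "2 < \<epsilon>" by (rule a[OF eps_gt_1 eps_trace])
  show "2 < \<eta>" by (rule a[OF eta_gt_1 eta_trace])
qed

text \<open>Dirichlet's theorem for 2000 ln \<epsilon> / ln \<eta> with denominators up to g ln
  \<eta>, rounded up: the error 1/N times ln \<eta> is at most 1/g. The size of the denominators
  brings in the second logarithm, and so the product. The factor 2000 ensures the lower bound 1000,
  because ln \<epsilon> is at least 1/2.\<close>

lemma common_multiple_of_logs:
  fixes g :: real and i j :: nat
  assumes g: "1 \<le> g" and ij: "\<epsilon> \<le> 2 ^ i" "\<eta> \<le> 2 ^ j"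
  obtains d d' :: nat where "\<bar>real d * ln \<epsilon> - real d' * ln \<eta>\<bar> \<le> 1 / g"
    "1000 \<le> real d * ln \<epsilon>" "real d * ln \<epsilon> \<le> 2000 * (g + 1) * real i * real j"
proof -
  define R where "R = ln \<epsilon>"
  define S where "S = ln \<eta>"
  have half: "1 / 2 \<le> ln x" if "2 < x" for x :: real
  proof -
    have "exp (1 / 2 :: real) \<le> 1 + 1/2 + (1/2)\<^sup>2" by (rule exp_bound) auto
    also have "\<dots> \<le> x" using that by (simp add: power2_eq_square)
    finally show ?thesis using that by (subst ln_ge_iff) auto
  qed
  have lnle: "ln x \<le> real n" if "2 < x" "x \<le> 2 ^ n" for x :: real and n
  proof -
    have "ln x \<le> ln (2 ^ n)" using that by (subst ln_le_cancel_iff) auto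
    also have "\<dots> = real n * ln 2" by (simp add: ln_realpow)
    also have "\<dots> \<le> real n * 1" using ln_2_less_1 by (intro mult_left_mono) auto
    finally show ?thesis by simp
  qed
  have RS: "1 / 2 \<le> R" "1 / 2 \<le> S" "R \<le> real i" "S \<le> real j"
    unfolding R_def S_def using half lnle eps_bounds ij by auto
  have j1: "1 \<le> real j" using RS(2,4) by (cases j) auto
  define N where "N = nat \<lceil>g * S\<rceil>"
  have gS: "0 < g * S" using g RS by (intro mult_pos_pos) auto
  have N: "g * S \<le> real N" "real N \<le> g * S + 1" "N > 0" using gS unfolding N_def by linarith+
  obtain h n where hn: "0 < n" "n \<le> int N" "\<bar>of_int n * (2000 * R / S) - of_int h\<bar> < 1 / N"
    using Dirichlet_approx[OF N(3)] by blast
  have "\<bar>of_int n * (2000 * R) - of_int h * S\<bar> = \<bar>of_int n * (2000 * R / S) - of_int h\<bar> * S"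
  proof -
    have "of_int n * (2000 * R) - of_int h * S = (of_int n * (2000 * R / S) - of_int h) * S" using RS(2) by (simp add: field_simps)
    then show ?thesis using RS(2) by (simp add: abs_mult)
  qed
  also have "\<dots> \<le> 1 / real N * S" using hn(3) RS by (intro mult_right_mono) auto
  also have "\<dots> \<le> 1 / g" using N g by (simp add: field_simps)
  finally have close: "\<bar>of_int n * (2000 * R) - of_int h * S\<bar> \<le> 1 / g" .
  have "1 * (2000 * (1/2)) \<le> real_of_int n * (2000 * R)" using hn(1) RS by (intro mult_mono) auto
  then have big: "1000 \<le> real_of_int n * (2000 * R)" by simp
  have "1 / g \<le> 1" using g by simp
  then have "0 < of_int h * S" using close big by linarith
  then have h: "h > 0" using RS(2) by (simp add: zero_less_mult_iff)
  have "real_of_int n * (2000 * R) \<le> (g * S + 1) * (2000 * real i)"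
    using hn(2) N(2) RS gS by (intro mult_mono) auto
  also have "\<dots> \<le> ((g + 1) * real j) * (2000 * real i)"
  proof (intro mult_right_mono)
    have "g * S \<le> g * real j" using RS g by (intro mult_left_mono) auto
    then show "g * S + 1 \<le> (g + 1) * real j" using j1 by (simp add: algebra_simps)
  qed auto
  finally have up: "real_of_int n * (2000 * R) \<le> 2000 * (g + 1) * real i * real j" by (simp add: mult_ac)
  show thesis
  proof (rule that[of "nat (2000 * n)" "nat h"])
    have e: "real (nat (2000 * n)) = 2000 * of_int n" "real (nat h) = of_int h" using hn(1) h by auto
    show "\<bar>real (nat (2000 * n)) * ln \<epsilon> - real (nat h) * ln \<eta>\<bar> \<le> 1 / g"
      "1000 \<le> real (nat (2000 * n)) * ln \<epsilon>" "real (nat (2000 * n)) * ln \<epsilon> \<le> 2000 * (g + 1) * real i * real j"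
      using close big up unfolding e R_def S_def by (simp_all add: mult_ac)
  qed
qed

text \<open>An approximation of this quality gives algebraic integers of size about q at one place
  and about 1/q at the conjugate place. The units \<epsilon>^(M d) and \<eta>^(M d'), of size about
  q and with inverse conjugates, even them out.\<close>

lemma no_good_approximation:
  fixes g N L \<tau> \<xi> \<zeta> :: real and i j :: nat and w u v w' u' v' p q r :: int
  assumes g: "24 * exp 3000000000000 \<le> g" and ij: "\<epsilon> \<le> 2 ^ i" "\<eta> \<le> 2 ^ j"
    and \<tau>: "0 \<le> \<tau>" "\<tau> * (2000 * g * (g + 1) * real i * real j) \<le> 1"
    and \<xi>: "of_int w * \<xi> = of_int u + of_int v * inverse \<epsilon>" "v \<noteq> 0"
    and \<zeta>: "of_int w' * \<zeta> = of_int u' + of_int v' * inverse \<eta>" "v' \<noteq> 0"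
    and N: "\<bar>of_int w\<bar> \<le> N" "\<bar>of_int v\<bar> \<le> N" "\<bar>of_int w'\<bar> \<le> N" "\<bar>of_int v'\<bar> \<le> N" "\<epsilon> \<le> N" "\<eta> \<le> N"
    and q: "q \<ge> 1" "L = ln (of_int q)"
    and L: "100000000000000 \<le> L" "1000000 * (2000 * (g + 1) * real i * real j) \<le> L"
      "g * (2000 * (g + 1) * real i * real j)\<^sup>2 \<le> L" "g * (2000 * (g + 1) * real i * real j) * (2 * N ^ 4) \<le> L"
    and appr: "\<bar>of_int q * \<xi> - of_int p\<bar> \<le> exp ((\<tau> - 1) * L)" "\<bar>of_int q * \<zeta> - of_int r\<bar> \<le> exp ((\<tau> - 1) * L)"
  shows False
proof -
  have g1000: "g \<ge> 1000" using g exp_ge_add_one_self[of "3000000000000::real"] by linarith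
  obtain d d' where dd: "\<bar>real d * ln \<epsilon> - real d' * ln \<eta>\<bar> \<le> 1 / g"
    "1000 \<le> real d * ln \<epsilon>" "real d * ln \<epsilon> \<le> 2000 * (g + 1) * real i * real j"
    using common_multiple_of_logs[OF _ ij, of g] g1000 by auto
  define H where "H = real d * ln \<epsilon>"
  define M where "M = nat \<lfloor>L / H\<rfloor>"
  have Hm: "H \<le> 2000 * (g + 1) * real i * real j" "1000 \<le> H" using dd by (auto simp: H_def)
  \<comment> \<open>The unit of loss: the assumptions on L and \<tau> make each of H, ln (2 N^4) and
    \<tau> L at most y, so all losses add up to a few multiples of y.\<close>
  define y where "y = L / (g * H)"
  have gH: "0 < g * H" "1000000 \<le> g * H" using g1000 Hm mult_mono[of 1000 g 1000 H] by auto
  have L0: "L > 0" using L by simp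
  have y0: "0 < y" using L0 gH by (simp add: y_def)
  have y1: "1000000 * y \<le> L"
    unfolding y_def using gH L0 by (simp add: field_simps)
  have "1000000 * H \<le> L" using Hm L(2) by linarith
  have Hy: "H \<le> y"
  proof -
    have "g * (H * H) \<le> g * (2000 * (g + 1) * real i * real j)\<^sup>2"
      unfolding power2_eq_square using Hm g1000 by (intro mult_left_mono mult_mono) auto
    then show ?thesis using L(3) gH by (simp add: y_def field_simps)
  qed
  have Ny: "2 * N ^ 4 \<le> exp y"
  proof -
    have "g * H * (2 * N ^ 4) \<le> g * (2000 * (g + 1) * real i * real j) * (2 * N ^ 4)"
      using Hm g1000 by (intro mult_right_mono mult_left_mono) auto
    then have "2 * N ^ 4 \<le> y" using L(4) gH by (simp add: y_def field_simps)
    then show ?thesis using exp_ge_add_one_self[of y] by linarith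
  qed
  have \<tau>y: "\<tau> * L \<le> y"
  proof -
    have "\<tau> * (g * H) \<le> \<tau> * (g * (2000 * (g + 1) * real i * real j))"
      using Hm g1000 \<tau> by (intro mult_left_mono) auto
    then have "\<tau> * (g * H) \<le> 1" using \<tau>(2) by (simp add: mult_ac)
    then have "\<tau> * (g * H) * L \<le> 1 * L" using L0 by (intro mult_right_mono) auto
    then show ?thesis using gH by (simp add: y_def field_simps)
  qed
  have N2: "2 < N" using N(5) eps_bounds by simp
  have "1 \<le> L / H" using \<open>1000000 * H \<le> L\<close> Hm by (simp add: field_simps)
  note M = nat_floor_ge_half[OF this, folded M_def]
  have M': "L / (2 * H) \<le> real M" using M(1) by simp
  have M1: "L / H - 1 \<le> real M" unfolding M_def by linarith
  have MH: "L - H \<le> real M * H" "real M * H \<le> L"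
    using mult_right_mono[OF M1, of H] mult_right_mono[OF M(2), of H] Hm by (auto simp: algebra_simps)
  have Mg: "real M * (1 / g) \<le> y"
    using mult_right_mono[OF M(2), of "1 / g"] g1000 by (simp add: y_def field_simps)
  have MH': "real M * (real d' * ln \<eta>) \<le> L + y" "L - H - y \<le> real M * (real d' * ln \<eta>)"
  proof -
    have "real M * \<bar>H - real d' * ln \<eta>\<bar> \<le> real M * (1 / g)" using dd(1) unfolding H_def by (intro mult_left_mono) auto
    then have "\<bar>real M * H - real M * (real d' * ln \<eta>)\<bar> \<le> y" using Mg
      by (simp add: abs_mult right_diff_distrib[symmetric])
    then show "real M * (real d' * ln \<eta>) \<le> L + y" "L - H - y \<le> real M * (real d' * ln \<eta>)" using MH by linarith+
  qed
  define Q where "Q = real_of_int q"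
  have Q: "Q = exp L" "Q \<ge> 1" using q by (auto simp: Q_def)
  \<comment> \<open>At the inverse of \<epsilon> this is w (q \<xi> - p), hence small; at \<epsilon>
    it differs from that by v q (\<epsilon> - 1/\<epsilon>).\<close>
  define al where "al = (\<lambda>a. of_int (u * q - w * p) + of_int (v * q) * a :: real)"
  define be where "be = (\<lambda>b. of_int (u' * q - w' * r) + of_int (v' * q) * b :: real)"
  have alinv: "al (inverse \<epsilon>) = of_int w * (of_int q * \<xi> - of_int p)"
  proof -
    have "of_int w * (of_int q * \<xi> - of_int p) = of_int q * (of_int w * \<xi>) - of_int w * of_int p" by (simp add: algebra_simps)
    then show ?thesis unfolding \<xi>(1) by (simp add: al_def algebra_simps)
  qed
  have beinv: "be (inverse \<eta>) = of_int w' * (of_int q * \<zeta> - of_int r)"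
  proof -
    have "of_int w' * (of_int q * \<zeta> - of_int r) = of_int q * (of_int w' * \<zeta>) - of_int w' * of_int r" by (simp add: algebra_simps)
    then show ?thesis unfolding \<zeta>(1) by (simp add: be_def algebra_simps)
  qed
  have small: "\<bar>al (inverse \<epsilon>)\<bar> \<le> N * exp (y - L)" "\<bar>be (inverse \<eta>)\<bar> \<le> N * exp (y - L)"
  proof -
    have e: "exp ((\<tau> - 1) * L) \<le> exp (y - L)" using \<tau>y by (simp add: algebra_simps)
    show "\<bar>al (inverse \<epsilon>)\<bar> \<le> N * exp (y - L)" unfolding alinv abs_mult
      by (rule mult_mono[OF N(1) order.trans[OF appr(1) e]]) (use N(1) in auto)
    show "\<bar>be (inverse \<eta>)\<bar> \<le> N * exp (y - L)" unfolding beinv abs_mult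
      by (rule mult_mono[OF N(3) order.trans[OF appr(2) e]]) (use N(3) in auto)
  qed
  have inv: "0 < inverse \<epsilon>" "inverse \<epsilon> < 1" "0 < inverse \<eta>" "inverse \<eta> < 1"
    using eps_gt_1 eta_gt_1 by (auto simp: inverse_less_1_iff)
  have diff: "\<bar>\<epsilon> - inverse \<epsilon>\<bar> \<le> N" "\<bar>\<eta> - inverse \<eta>\<bar> \<le> N"
    using inv N eps_gt_1 eta_gt_1 by linarith+
  have alal: "al \<epsilon> = al (inverse \<epsilon>) + of_int v * Q * (\<epsilon> - inverse \<epsilon>)"
    "be \<eta> = be (inverse \<eta>) + of_int v' * Q * (\<eta> - inverse \<eta>)"
    by (auto simp: al_def be_def Q_def algebra_simps)
  have NN: "N * exp (y - L) \<le> N * N * Q"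
  proof -
    have "exp (y - L) \<le> 1" using y0 y1 by simp
    also have "1 \<le> N * Q" using mult_mono[of 1 N 1 Q] N2 Q by simp
    finally show ?thesis using N2 by simp
  qed
  have large: "\<bar>al \<epsilon>\<bar> \<le> 2 * N ^ 2 * Q" "\<bar>be \<eta>\<bar> \<le> 2 * N ^ 2 * Q"
  proof -
    have "\<bar>of_int v * Q * (\<epsilon> - inverse \<epsilon>)\<bar> \<le> N * Q * N" unfolding abs_mult
      using N diff Q N2 by (intro mult_mono) auto
    then show "\<bar>al \<epsilon>\<bar> \<le> 2 * N ^ 2 * Q" unfolding alal using small NN by (simp add: power2_eq_square algebra_simps)
    have "\<bar>of_int v' * Q * (\<eta> - inverse \<eta>)\<bar> \<le> N * Q * N" unfolding abs_mult
      using N diff Q N2 by (intro mult_mono) auto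
    then show "\<bar>be \<eta>\<bar> \<le> 2 * N ^ 2 * Q" unfolding alal using small NN by (simp add: power2_eq_square algebra_simps)
  qed
  \<comment> \<open>The crossed factors v' (b - 1/b) and v (a - 1/a) give \<open>al\<close> and
    \<open>be\<close> the same leading term v v' q (\<epsilon> - 1/\<epsilon>) (\<eta> - 1/\<eta>)
    at the main place.\<close>
  define U where "U = (\<lambda>a b. of_int v' * (b - inverse b) * al a * inverse a ^ (M * d))"
  define V where "V = (\<lambda>a b. of_int v * (a - inverse a) * be b * inverse b ^ (M * d'))"
  have rings: "U \<in> ring_elems" "V \<in> ring_elems"
    unfolding U_def V_def al_def be_def
    by (intro ring_mult ring_power ring_diff ring_add ring_int ring_gens)+
  have alnz: "al \<epsilon> \<noteq> 0" "be \<eta> \<noteq> 0"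
    using indep[of "u * q - w * p" "v * q" 0 0] indep[of "u' * q - w' * r" 0 "v' * q" 0] q(1) \<xi>(2) \<zeta>(2)
    by (auto simp: al_def be_def)
  have nz: "U \<epsilon> \<eta> \<noteq> 0" "V \<epsilon> \<eta> \<noteq> 0"
    using alnz inv eps_gt_1 eta_gt_1 \<xi>(2) \<zeta>(2) by (auto simp: U_def V_def)
  have diffs: "\<bar>a - inverse a\<bar> \<le> N" if "a \<in> {\<epsilon>, inverse \<epsilon>, \<eta>, inverse \<eta>}" for a
    using that diff by (auto simp: abs_minus_commute)
  have powers: "\<epsilon> ^ (M * d) = exp (real M * H)" "\<eta> ^ (M * d') = exp (real M * (real d' * ln \<eta>))"
  proof -
    have "real M * H = real (M * d) * ln \<epsilon>" "real M * (real d' * ln \<eta>) = real (M * d') * ln \<eta>" by (simp_all add: H_def)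
    then show "\<epsilon> ^ (M * d) = exp (real M * H)" "\<eta> ^ (M * d') = exp (real M * (real d' * ln \<eta>))"
      using eps_gt_1 eta_gt_1 by (simp_all only: exp_of_nat_mult exp_ln)
  qed
  have NQ: "2 * N ^ 2 * Q * N ^ 2 = 2 * N ^ 4 * exp L" "N * exp (y - L) * N ^ 2 \<le> 2 * N ^ 4 * exp (y - L)"
    using N2 power_increasing[of 3 4 N] by (auto simp: Q power2_eq_square power3_eq_cube power4_eq_xxxx)
  have bound: "\<bar>c * (x - inverse x) * z * t\<bar> \<le> exp (4 * y)"
    if "\<bar>c\<bar> \<le> N" "\<bar>x - inverse x\<bar> \<le> N" "\<bar>z\<bar> * N ^ 2 \<le> 2 * N ^ 4 * exp m" "\<bar>t\<bar> \<le> exp n" "m + n \<le> 3 * y" for c x z t m n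
  proof -
    have "\<bar>c\<bar> * \<bar>x - inverse x\<bar> \<le> N * N" using that N2 by (intro mult_mono) auto
    then have "\<bar>c\<bar> * \<bar>x - inverse x\<bar> * \<bar>z\<bar> \<le> N * N * \<bar>z\<bar>" by (intro mult_right_mono) auto
    also have "\<dots> \<le> 2 * N ^ 4 * exp m" using that(3) by (simp add: power2_eq_square mult_ac)
    also have "\<dots> \<le> exp (y + m)" by (rule mult_le_expI[OF Ny]) (use N2 in auto)
    finally have "\<bar>c\<bar> * \<bar>x - inverse x\<bar> * \<bar>z\<bar> * \<bar>t\<bar> \<le> exp (4 * y)"
      by (rule mult_le_expI) (use that in auto)
    then show ?thesis by (simp add: abs_mult)
  qed
  have yy: "4 * L / (g * H) = 4 * y" by (simp add: y_def)
  have U: "\<bar>U a b\<bar> \<le> exp (4 * L / (g * H))" if ab: "a \<in> {\<epsilon>, inverse \<epsilon>}" "b \<in> {\<eta>, inverse \<eta>}" for a b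
  proof (cases "a = \<epsilon>")
    case True
    show ?thesis unfolding U_def yy
    proof (rule bound[where m = L and n = "H - L"])
      show "\<bar>al a\<bar> * N ^ 2 \<le> 2 * N ^ 4 * exp L" using mult_right_mono[OF large(1), of "N ^ 2"] NQ True by simp
      show "\<bar>inverse a ^ (M * d)\<bar> \<le> exp (H - L)"
        using MH True powers(1) eps_gt_1 by (simp add: power_inverse flip: exp_minus)
    qed (use N diffs ab Hy y0 in auto)
  next
    case False
    then have a: "a = inverse \<epsilon>" using ab by auto
    show ?thesis unfolding U_def yy
    proof (rule bound[where m = "y - L" and n = L])
      show "\<bar>al a\<bar> * N ^ 2 \<le> 2 * N ^ 4 * exp (y - L)" unfolding a by (rule order.trans[OF mult_right_mono[OF small(1)] NQ(2)]) simp
      show "\<bar>inverse a ^ (M * d)\<bar> \<le> exp L" using MH a powers(1) eps_gt_1 by simp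
    qed (use N diffs ab y0 in auto)
  qed
  have V: "\<bar>V a b\<bar> \<le> exp (4 * L / (g * H))" if ab: "a \<in> {\<epsilon>, inverse \<epsilon>}" "b \<in> {\<eta>, inverse \<eta>}" for a b
  proof (cases "b = \<eta>")
    case True
    show ?thesis unfolding V_def yy
    proof (rule bound[where m = L and n = "H + y - L"])
      show "\<bar>be b\<bar> * N ^ 2 \<le> 2 * N ^ 4 * exp L" using mult_right_mono[OF large(2), of "N ^ 2"] NQ True by simp
      show "\<bar>inverse b ^ (M * d')\<bar> \<le> exp (H + y - L)"
        using MH' True powers(2) eta_gt_1 by (simp add: power_inverse flip: exp_minus)
    qed (use N diffs ab Hy y0 in auto)
  next
    case False
    then have b: "b = inverse \<eta>" using ab by auto
    show ?thesis unfolding V_def yy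
    proof (rule bound[where m = "y - L" and n = "L + y"])
      show "\<bar>be b\<bar> * N ^ 2 \<le> 2 * N ^ 4 * exp (y - L)" unfolding b by (rule order.trans[OF mult_right_mono[OF small(2)] NQ(2)]) simp
      show "\<bar>inverse b ^ (M * d')\<bar> \<le> exp (L + y)" using MH' b powers(2) eta_gt_1 by simp
    qed (use N diffs ab y0 in auto)
  qed
  have close: "\<bar>V \<epsilon> \<eta> - U \<epsilon> \<eta> * (\<epsilon> ^ d * inverse \<eta> ^ d') ^ M\<bar> \<le> exp (- (199 / 100) * L)"
  proof -
    \<comment> \<open>The leading terms cancel and leave the small conjugates, of size about exp (-
      L); the power of 1/\<eta> contributes almost another exp (- L).\<close>
    define z where "z = of_int v * (\<epsilon> - inverse \<epsilon>) * be (inverse \<eta>) - of_int v' * (\<eta> - inverse \<eta>) * al (inverse \<epsilon>)"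
    have "U \<epsilon> \<eta> * (\<epsilon> ^ d * inverse \<eta> ^ d') ^ M = of_int v' * (\<eta> - inverse \<eta>) * al \<epsilon> * inverse \<eta> ^ (M * d')"
    proof -
      have "(\<epsilon> ^ d * inverse \<eta> ^ d') ^ M = \<epsilon> ^ (M * d) * inverse \<eta> ^ (M * d')"
        by (simp add: power_mult_distrib mult.commute[of M] power_mult)
      moreover have "inverse \<epsilon> ^ (M * d) * \<epsilon> ^ (M * d) = 1" using eps_gt_1 by (simp flip: power_mult_distrib)
      ultimately show ?thesis by (simp add: U_def mult_ac)
    qed
    then have eq: "V \<epsilon> \<eta> - U \<epsilon> \<eta> * (\<epsilon> ^ d * inverse \<eta> ^ d') ^ M = z * inverse \<eta> ^ (M * d')"
      unfolding V_def z_def alal by (simp add: algebra_simps)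
    have t: "\<bar>c * (x - inverse x) * e\<bar> \<le> N * N * (N * exp (y - L))" if "\<bar>c\<bar> \<le> N" "\<bar>x - inverse x\<bar> \<le> N" "\<bar>e\<bar> \<le> N * exp (y - L)" for c x e
      unfolding abs_mult using that N2 by (intro mult_mono) auto
    have "\<bar>z\<bar> \<le> 2 * (N * N * (N * exp (y - L)))"
      unfolding z_def using t[OF N(2) diffs small(2), of \<epsilon>] t[OF N(4) diffs small(1), of \<eta>] by simp
    also have "\<dots> = 2 * N ^ 3 * exp (y - L)" by (simp add: power3_eq_cube)
    also have "\<dots> \<le> 2 * N ^ 4 * exp (y - L)" using N2 by (intro mult_right_mono mult_left_mono power_increasing) auto
    also have "\<dots> \<le> exp (2 * y - L)" by (rule mult_le_expI[OF Ny]) (use N2 in auto)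
    finally have z: "\<bar>z\<bar> \<le> exp (2 * y - L)" .
    have "\<bar>inverse \<eta> ^ (M * d')\<bar> \<le> exp (H + y - L)"
      using MH' powers(2) eta_gt_1 by (simp add: power_inverse flip: exp_minus)
    then have "\<bar>z\<bar> * \<bar>inverse \<eta> ^ (M * d')\<bar> \<le> exp (- (199 / 100) * L)"
      by (rule mult_le_expI[OF z]) (use Hy y1 L0 in auto)
    then show ?thesis unfolding eq by (simp add: abs_mult)
  qed
  show False
    by (rule no_close_pair[where d = d and d' = d' and M = M and U = U and V = V and g = g and L = L])
      (use g Hm L \<open>1000000 * H \<le> L\<close> dd M' M(2) rings nz U V close in \<open>auto simp: H_def\<close>)
qed

end

section \<open>Recursive functions\<close>

lemma recursive_id: "recursive (\<lambda>x. x)"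
proof -
  have "recursive (\<lambda>x. prod_encode (fst (prod_decode x), snd (prod_decode x)))"
    by (intro recursive.pair recursive.fst recursive.snd)
  then show ?thesis by simp
qed

lemma recursive_const: "recursive (\<lambda>_. n)"
proof (induction n)
  case (Suc n)
  then show ?case using recursive.comp[OF recursive.suc, of "\<lambda>_. n"] by simp
qed (rule recursive.zero)

lemma recursive_Suc: "recursive f \<Longrightarrow> recursive (\<lambda>x. Suc (f x))"
  using recursive.comp[OF recursive.suc] .

lemma recursive_fst: "recursive f \<Longrightarrow> recursive (\<lambda>x. fst (prod_decode (f x)))"
  using recursive.comp[OF recursive.fst] .

lemma recursive_snd: "recursive f \<Longrightarrow> recursive (\<lambda>x. snd (prod_decode (f x)))"
  using recursive.comp[OF recursive.snd] .

text \<open>The step function receives parameter, counter and accumulator as one nested pair; hence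
  the encoded and decoded pairs in the applications that follow.\<close>

lemma recursive_rec_nat:
  assumes "recursive f" "recursive g" "recursive a" "recursive n"
  shows "recursive (\<lambda>x. rec_nat (f (a x)) (\<lambda>k r. g (prod_encode (a x, prod_encode (k, r)))) (n x))"
  using recursive.comp[OF recursive.prim_rec[OF assms(1,2)] recursive.pair[OF assms(3,4)]] by simp

lemma recursive_add:
  assumes "recursive f" "recursive g"
  shows "recursive (\<lambda>x. f x + g x)"
proof -
  have "recursive (\<lambda>x. rec_nat (f x) (\<lambda>k r. Suc (snd (prod_decode (snd (prod_decode (prod_encode (f x, prod_encode (k, r)))))))) (g x))"
    by (rule recursive_rec_nat[where f = "\<lambda>x. x"]) (intro recursive_id recursive_Suc recursive_snd assms)+
  moreover have "rec_nat a (\<lambda>k r. Suc r) b = a + b" for a b by (induction b) auto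
  ultimately show ?thesis by simp
qed

lemma recursive_mult:
  assumes "recursive f" "recursive g"
  shows "recursive (\<lambda>x. f x * g x)"
proof -
  have "recursive (\<lambda>x. rec_nat 0 (\<lambda>k r. snd (prod_decode (snd (prod_decode (prod_encode (f x, prod_encode (k, r)))))) +
      fst (prod_decode (prod_encode (f x, prod_encode (k, r))))) (g x))"
    by (rule recursive_rec_nat[where f = "\<lambda>x. 0"]) (intro recursive_id recursive_const recursive_add recursive_fst recursive_snd assms)+
  moreover have "rec_nat 0 (\<lambda>k r. r + a) b = a * b" for a b by (induction b) auto
  ultimately show ?thesis by simp
qed

lemma recursive_power:
  assumes "recursive f" "recursive g"
  shows "recursive (\<lambda>x. f x ^ g x)"
proof -
  have "recursive (\<lambda>x. rec_nat 1 (\<lambda>k r. snd (prod_decode (snd (prod_decode (prod_encode (f x, prod_encode (k, r)))))) *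
      fst (prod_decode (prod_encode (f x, prod_encode (k, r))))) (g x))"
    by (rule recursive_rec_nat[where f = "\<lambda>x. 1"]) (intro recursive_id recursive_const recursive_mult recursive_fst recursive_snd assms)+
  moreover have "rec_nat 1 (\<lambda>k r. r * a) b = a ^ b" for a b :: nat by (induction b) auto
  ultimately show ?thesis by simp
qed

lemma recursive_diff:
  assumes "recursive f" "recursive g"
  shows "recursive (\<lambda>x. f x - g x)"
proof -
  have pred: "recursive (\<lambda>x. h x - 1)" if "recursive h" for h
  proof -
    have "recursive (\<lambda>x. rec_nat 0 (\<lambda>k r. fst (prod_decode (snd (prod_decode (prod_encode (h x, prod_encode (k, r))))))) (h x))"
      by (rule recursive_rec_nat[where f = "\<lambda>x. 0"]) (intro recursive_id recursive_const recursive_fst recursive_snd that)+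
    moreover have "rec_nat 0 (\<lambda>k r. k) b = b - 1" for b by (induction b) auto
    ultimately show ?thesis by simp
  qed
  have "recursive (\<lambda>x. rec_nat (f x) (\<lambda>k r. snd (prod_decode (snd (prod_decode (prod_encode (f x, prod_encode (k, r)))))) - 1) (g x))"
    by (rule recursive_rec_nat[where f = "\<lambda>x. x"]) (intro pred recursive_id recursive_snd assms)+
  moreover have "rec_nat a (\<lambda>k r. r - 1) b = a - b" for a b :: nat by (induction b) auto
  ultimately show ?thesis by simp
qed

text \<open>Zero stands for truth, as in \<open>minimize\<close>; then sums express conjunction, and
  truncated subtraction expresses comparison and negation.\<close>

definition decidable :: "(nat \<Rightarrow> bool) \<Rightarrow> bool" where
  "decidable P \<longleftrightarrow> (\<exists>f. recursive f \<and> (\<forall>x. P x \<longleftrightarrow> f x = 0))"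

lemma decidable_le:
  assumes "recursive f" "recursive g"
  shows "decidable (\<lambda>x. f x \<le> g x)"
  unfolding decidable_def by (rule exI[of _ "\<lambda>x. f x - g x"]) (auto intro: recursive_diff assms)

lemma decidable_conj:
  assumes "decidable P" "decidable Q"
  shows "decidable (\<lambda>x. P x \<and> Q x)"
proof -
  obtain f g where "recursive f" "recursive g" "\<forall>x. P x \<longleftrightarrow> f x = 0" "\<forall>x. Q x \<longleftrightarrow> g x = 0"
    using assms unfolding decidable_def by blast
  then show ?thesis unfolding decidable_def by (intro exI[of _ "\<lambda>x. f x + g x"]) (auto intro: recursive_add)
qed

lemma decidable_not:
  assumes "decidable P"
  shows "decidable (\<lambda>x. \<not> P x)"
proof -
  obtain f where "recursive f" "\<forall>x. P x \<longleftrightarrow> f x = 0" using assms unfolding decidable_def by blast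
  then show ?thesis unfolding decidable_def
    by (intro exI[of _ "\<lambda>x. 1 - f x"]) (auto intro: recursive_diff recursive_const)
qed

lemma decidable_disj: "decidable P \<Longrightarrow> decidable Q \<Longrightarrow> decidable (\<lambda>x. P x \<or> Q x)"
  using decidable_not[OF decidable_conj[OF decidable_not decidable_not], of P Q] by simp

lemma decidable_eq:
  assumes "recursive f" "recursive g"
  shows "decidable (\<lambda>x. f x = g x)"
  using decidable_conj[OF decidable_le[OF assms] decidable_le[OF assms(2,1)]] by (simp add: order_eq_iff)

lemma decidable_less:
  assumes "recursive f" "recursive g"
  shows "decidable (\<lambda>x. f x < g x)"
  using decidable_le[OF recursive_Suc[OF assms(1)] assms(2)] by (simp add: Suc_le_eq)

lemma recursive_if:
  assumes "decidable P" "recursive f" "recursive g"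
  shows "recursive (\<lambda>x. if P x then f x else g x)"
proof -
  obtain p where p: "recursive p" "\<And>x. P x \<longleftrightarrow> p x = 0" using assms(1) unfolding decidable_def by blast
  have "recursive (\<lambda>x. f x * (1 - p x) + g x * (1 - (1 - p x)))"
    by (intro recursive_add recursive_mult recursive_diff recursive_const assms p)
  moreover have "f x * (1 - p x) + g x * (1 - (1 - p x)) = (if P x then f x else g x)" for x
    by (auto simp: p(2))
  ultimately show ?thesis by simp
qed

lemma recursive_Least:
  assumes "decidable (\<lambda>y. P (fst (prod_decode y)) (snd (prod_decode y)))" "\<And>x. \<exists>n. P x n"
  shows "recursive (\<lambda>x. LEAST n. P x n)"
proof -
  obtain p where p: "recursive p" "\<And>y. P (fst (prod_decode y)) (snd (prod_decode y)) \<longleftrightarrow> p y = 0"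
    using assms(1) unfolding decidable_def by blast
  have "P x n \<longleftrightarrow> p (prod_encode (x, n)) = 0" for x n using p(2)[of "prod_encode (x, n)"] by simp
  then show ?thesis using recursive.minimize[OF p(1)] assms(2) by simp
qed

text \<open>The quotient is the least m with f x < (m + 1) g x, and a positive divisor makes this
  search total.\<close>

lemma recursive_div:
  assumes "recursive f" "recursive g" "\<And>x. g x > 0"
  shows "recursive (\<lambda>x. f x div g x)"
proof -
  have iff: "f x < Suc m * g x \<longleftrightarrow> f x div g x \<le> m" for x m
    using div_less_iff_less_mult[OF assms(3), of "f x" x "Suc m"] by (simp add: less_Suc_eq_le)
  have "recursive (\<lambda>x. LEAST m. f x < Suc m * g x)"
  proof (rule recursive_Least)
    show "decidable (\<lambda>y. f (fst (prod_decode y)) < Suc (snd (prod_decode y)) * g (fst (prod_decode y)))"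
      by (intro decidable_less recursive_mult recursive_Suc recursive_snd recursive_id
          recursive.comp[OF assms(1)] recursive.comp[OF assms(2)] recursive_fst)
    show "\<exists>m. f x < Suc m * g x" for x unfolding iff by blast
  qed
  moreover have "(LEAST m. f x < Suc m * g x) = f x div g x" for x
    unfolding iff by (rule Least_equality) auto
  ultimately show ?thesis by simp
qed

text \<open>\<open>int_decode\<close> sends even codes to nonnegative and odd codes to negative
  integers. With the parts separated, integer equations can be decided on natural numbers by moving
  negative terms to the other side.\<close>

definition nat_part :: "nat \<Rightarrow> nat" where
  "nat_part n = (if even n then n div 2 else 0)"

definition neg_part :: "nat \<Rightarrow> nat" where
  "neg_part n = (if odd n then Suc (n div 2) else 0)"

lemma int_decode_parts: "int_decode n = int (nat_part n) - int (neg_part n)"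
  by (auto simp: int_decode_def sum_decode_def nat_part_def neg_part_def)

lemma abs_int_decode: "\<bar>int_decode n\<bar> = int (nat_part n) + int (neg_part n)"
  by (auto simp: int_decode_def sum_decode_def nat_part_def neg_part_def)

lemma int_decode_double: "int_decode (2 * n) = int n"
  by (simp add: int_decode_def sum_decode_def)

lemma decidable_even:
  assumes "recursive f"
  shows "decidable (\<lambda>x. even (f x))"
proof -
  have "decidable (\<lambda>x. 2 * (f x div 2) = f x)"
    by (intro decidable_eq recursive_mult recursive_div recursive_const assms) simp
  moreover have "2 * (n div 2) = n \<longleftrightarrow> even n" for n :: nat by presburger
  ultimately show ?thesis by simp
qed

lemma recursive_parts:
  assumes "recursive f"
  shows "recursive (\<lambda>x. nat_part (f x))" "recursive (\<lambda>x. neg_part (f x))"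
  unfolding nat_part_def neg_part_def
  by (intro recursive_if decidable_even decidable_not recursive_div recursive_const recursive_Suc assms; simp)+

section \<open>Effective constants\<close>

text \<open>The inverse units, and with them the units, are nonconstant rational affine functions of
  \<xi> and \<zeta>, so 1, \<epsilon>, \<eta> inherit independence; the product \<epsilon>\<eta> is
  then eliminated by a norm.\<close>

lemma lin_indep_biquadratic:
  fixes \<epsilon> \<eta> \<xi> \<zeta> :: real and s t u v w u' v' w' :: int
  assumes indep: "lin_indep_1_Q \<xi> \<zeta>"
    and eps: "\<epsilon> > 1" "\<epsilon> + inverse \<epsilon> = of_int s" and eta: "\<eta> > 1" "\<eta> + inverse \<eta> = of_int t"
    and \<xi>: "of_int w * \<xi> = of_int u + of_int v * inverse \<epsilon>" "v \<noteq> 0" "w \<noteq> 0"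
    and \<zeta>: "of_int w' * \<zeta> = of_int u' + of_int v' * inverse \<eta>" "v' \<noteq> 0" "w' \<noteq> 0"
  shows "biquadratic \<epsilon> \<eta> s t"
proof
  have lin: "k = 0 \<and> l = 0 \<and> m = 0" if "of_int k + of_int l * \<epsilon> + of_int m * \<eta> = 0" for k l m :: int
  proof -
    have "inverse \<epsilon> = (of_int w * \<xi> - of_int u) / of_int v" "inverse \<eta> = (of_int w' * \<zeta> - of_int u') / of_int v'"
      using \<xi>(2) \<zeta>(2) unfolding \<xi>(1) \<zeta>(1) by simp_all
    then have e: "\<epsilon> = of_int s - (of_int w * \<xi> - of_int u) / of_int v"
      and h: "\<eta> = of_int t - (of_int w' * \<zeta> - of_int u') / of_int v'"
      using eps(2) eta(2) by linarith+
    define x where "x = of_int k + of_int l * (of_int s + of_int u / of_int v) + of_int m * (of_int t + of_int u' / of_int v') + (0::real)"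
    define y where "y = - (of_int l * of_int w / of_int v) + (0::real)"
    define z where "z = - (of_int m * of_int w' / of_int v') + (0::real)"
    have "x + y * \<xi> + z * \<zeta> = of_int k + of_int l * \<epsilon> + of_int m * \<eta>"
      unfolding e h x_def y_def z_def by (simp add: algebra_simps diff_divide_distrib)
    moreover have "x \<in> \<rat>" "y \<in> \<rat>" "z \<in> \<rat>" by (auto simp: x_def y_def z_def)
    ultimately have "x = 0" "y = 0" "z = 0" using indep that unfolding lin_indep_1_Q_def by auto
    then have "l = 0" "m = 0" using \<xi> \<zeta> by (auto simp: y_def z_def)
    then show ?thesis using \<open>x = 0\<close> by (simp add: x_def)
  qed
  show "1 < \<epsilon>" "1 < \<eta>" "\<epsilon> + inverse \<epsilon> = of_int s" "\<eta> + inverse \<eta> = of_int t" using eps eta by auto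
  fix k l m n :: int
  assume z: "of_int k + of_int l * \<epsilon> + of_int m * \<eta> + of_int n * (\<epsilon> * \<eta>) = 0"
  have "(\<epsilon> + inverse \<epsilon>) * \<epsilon> = \<epsilon> * \<epsilon> + 1" using eps(1) by (simp add: distrib_right)
  then have ee: "\<epsilon> * \<epsilon> = of_int s * \<epsilon> - 1" unfolding eps(2) by simp
  \<comment> \<open>The relation reads (k + l \<epsilon>) + (m + n \<epsilon>) \<eta> = 0.
    Multiplying by the conjugate of m + n \<epsilon> removes \<epsilon>\<eta> and turns the
    coefficient of \<eta> into a norm, which must vanish.\<close>
  have "(of_int k + of_int l * \<epsilon> + of_int m * \<eta> + of_int n * (\<epsilon> * \<eta>)) * (of_int (m + n * s) - of_int n * \<epsilon>)
      = of_int (k * (m + n * s) + l * n) + of_int (l * m - k * n) * \<epsilon> + of_int (m * m + m * n * s + n * n) * \<eta>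
       - (\<epsilon> * \<epsilon> - (of_int s * \<epsilon> - 1)) * of_int n * (of_int l + of_int n * \<eta>)"
    by (simp add: algebra_simps)
  then have "of_int (k * (m + n * s) + l * n) + of_int (l * m - k * n) * \<epsilon> + of_int (m * m + m * n * s + n * n) * \<eta> = 0"
    unfolding z ee by simp
  from lin[OF this] have c: "m * m + m * n * s + n * n = 0" by blast
  have "(of_int m + of_int n * \<epsilon>) * (of_int (m + n * s) - of_int n * \<epsilon>) = of_int (m * m + m * n * s + n * n)
      - (\<epsilon> * \<epsilon> - (of_int s * \<epsilon> - 1)) * of_int (n * n)"
    by (simp add: algebra_simps)
  then have "of_int m + of_int n * \<epsilon> + of_int 0 * \<eta> = 0 \<or> of_int (m + n * s) + of_int (- n) * \<epsilon> + of_int 0 * \<eta> = 0"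
    unfolding c ee by simp
  then have mn: "m = 0 \<and> n = 0" using lin[of m n 0] lin[of "m + n * s" "- n" 0] by auto
  then have "of_int k + of_int l * \<epsilon> + of_int 0 * \<eta> = 0" using z by simp
  from lin[OF this] mn show "k = 0 \<and> l = 0 \<and> m = 0 \<and> n = 0" by blast
qed

text \<open>
  The unit \<open>\<epsilon> = (t + sqrt (t\<^sup>2 - 4)) / 2\<close> lies in the field of the quadratic number with code
  \<open>(a, b, c)\<close>, as witnessed by \<open>e\<close> and \<open>f\<close>; \<open>i\<close> and \<open>N\<close> bound the data.
\<close>

definition presents_unit :: "int \<times> int \<times> int \<Rightarrow> nat \<Rightarrow> nat \<Rightarrow> nat \<Rightarrow> nat \<Rightarrow> nat \<Rightarrow> bool" where
  "presents_unit = (\<lambda>(a, b, c) t e f i N. 3 \<le> t \<and> t \<le> 2 ^ i \<and> 1 \<le> e \<and> 1 \<le> f \<and> t \<le> N \<and> 2 * e \<le> N \<and>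
     2 * \<bar>a\<bar> * int f \<le> int N \<and> (b\<^sup>2 - 4 * a * c) * (int f)\<^sup>2 = ((int t)\<^sup>2 - 4) * (int e)\<^sup>2)"

lemma presented_unit:
  assumes "quadratic_code x \<xi>" "presents_unit x t e f i N"
  obtains \<epsilon> :: real and u v w :: int where "\<epsilon> > 1" "\<epsilon> + inverse \<epsilon> = of_int (int t)" "\<epsilon> \<le> 2 ^ i" "\<epsilon> \<le> real N"
    "of_int w * \<xi> = of_int u + of_int v * inverse \<epsilon>" "v \<noteq> 0" "w \<noteq> 0"
    "\<bar>of_int w\<bar> \<le> real N" "\<bar>of_int v\<bar> \<le> real N"
proof -
  obtain a b c where x: "x = (a, b, c)" by (metis prod_cases3)
  have code: "a \<noteq> 0" "b\<^sup>2 - 4 * a * c \<ge> 0" "\<xi> = (- real_of_int b + sqrt (real_of_int (b\<^sup>2 - 4 * a * c))) / (2 * real_of_int a)"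
    using assms(1) by (auto simp: quadratic_code_def x)
  have unit: "3 \<le> t" "t \<le> 2 ^ i" "1 \<le> e" "1 \<le> f" "t \<le> N" "2 * e \<le> N" "2 * \<bar>a\<bar> * int f \<le> int N"
    "(b\<^sup>2 - 4 * a * c) * (int f)\<^sup>2 = ((int t)\<^sup>2 - 4) * (int e)\<^sup>2"
    using assms(2) by (auto simp: presents_unit_def x)
  define D where "D = b\<^sup>2 - 4 * a * c"
  define r where "r = sqrt ((real t)\<^sup>2 - 4)"
  have "(real t)\<^sup>2 \<ge> 9" using power_mono[of 3 "real t" 2] unit(1) by simp
  then have r: "r > 0" "r\<^sup>2 = (real t)\<^sup>2 - 4" by (auto simp: r_def)
  have rt: "r < real t" using power2_less_imp_less[of r "real t"] r by simp
  define \<epsilon> where "\<epsilon> = (real t + r) / 2"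
  have inv: "inverse \<epsilon> = (real t - r) / 2"
  proof (rule inverse_unique)
    have "(real t + r) * (real t - r) = 4" using r by (simp add: power2_eq_square algebra_simps)
    then show "\<epsilon> * ((real t - r) / 2) = 1" by (simp add: \<epsilon>_def)
  qed
  have "real_of_int (D * (int f)\<^sup>2) = real_of_int (((int t)\<^sup>2 - 4) * (int e)\<^sup>2)"
    using unit(8) unfolding D_def by (simp only:)
  then have "of_int D * (real f)\<^sup>2 = ((real t)\<^sup>2 - 4) * (real e)\<^sup>2" by simp
  then have "sqrt (of_int D * (real f)\<^sup>2) = sqrt (((real t)\<^sup>2 - 4) * (real e)\<^sup>2)" by simp
  then have sq: "sqrt (of_int D) * real f = r * real e"
    by (simp add: real_sqrt_mult r_def)
  \<comment> \<open>From sqrt D f = r e follows 2 a f \<xi> = - b f + e r, and r = t - 2/\<epsilon>;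
    this gives the three witnesses.\<close>
  show thesis
  proof (rule that[of \<epsilon> "2 * a * int f" "- b * int f + int e * int t" "- 2 * int e"])
    show "\<epsilon> > 1" using unit(1) r by (simp add: \<epsilon>_def)
    show "\<epsilon> + inverse \<epsilon> = of_int (int t)" unfolding inv by (simp add: \<epsilon>_def flip: add_divide_distrib)
    have "\<epsilon> \<le> real t" using rt by (simp add: \<epsilon>_def)
    moreover have "real t \<le> 2 ^ i" using unit(2) by (metis of_nat_le_iff of_nat_numeral of_nat_power)
    ultimately show "\<epsilon> \<le> 2 ^ i" by linarith
    show "\<epsilon> \<le> real N" using \<open>\<epsilon> \<le> real t\<close> unit(5) by linarith
    have "2 * of_int a * \<xi> = - real_of_int b + sqrt (of_int D)"
      using code(1) unfolding code(3) D_def by simp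
    moreover have "of_int (2 * a * int f) * \<xi> = real f * (2 * of_int a * \<xi>)" by simp
    ultimately have "of_int (2 * a * int f) * \<xi> = real f * (- real_of_int b + sqrt (of_int D))" by simp
    also have "\<dots> = - real_of_int b * real f + r * real e" using sq by (simp add: algebra_simps)
    also have "\<dots> = of_int (- b * int f + int e * int t) + of_int (- 2 * int e) * inverse \<epsilon>"
      unfolding inv by (simp add: algebra_simps)
    finally show "of_int (2 * a * int f) * \<xi> = of_int (- b * int f + int e * int t) + of_int (- 2 * int e) * inverse \<epsilon>" .
    have "\<bar>real_of_int (2 * a * int f)\<bar> = real_of_int (2 * \<bar>a\<bar> * int f)" by (simp add: abs_mult)
    also have "\<dots> \<le> real_of_int (int N)" using unit(7) by (simp only: of_int_le_iff)
    finally show "\<bar>real_of_int (2 * a * int f)\<bar> \<le> real N" by simp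
    show "\<bar>real_of_int (- 2 * int e)\<bar> \<le> real N" using unit(6) by linarith
  qed (use code unit in auto)
qed

text \<open>Excludes small q: a counterexample to a bound with a tiny constant can escape this
  inequality only if q is large.\<close>

lemma (in biquadratic) liouville:
  fixes N \<xi> :: real and u v w p q :: int
  assumes \<xi>: "of_int w * \<xi> = of_int u + of_int v * inverse \<epsilon>" "v \<noteq> 0"
    and N: "\<bar>of_int w\<bar> \<le> N" "\<bar>of_int v\<bar> \<le> N" "\<epsilon> \<le> N" and q: "q \<ge> 1" and small: "\<bar>of_int q * \<xi> - of_int p\<bar> \<le> 1"
  shows "1 \<le> 2 * N ^ 3 * of_int q * \<bar>of_int q * \<xi> - of_int p\<bar>"
proof -
  define al where "al = (\<lambda>a. of_int (u * q - w * p) + of_int (v * q) * a :: real)"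
  have ring: "(\<lambda>a b. al a) \<in> ring_elems" unfolding al_def by (intro ring_mult ring_add ring_int ring_gens)
  have nz: "al \<epsilon> \<noteq> 0"
    using indep[of "u * q - w * p" "v * q" 0 0] q \<xi>(2) by (auto simp: al_def)
  have "of_int w * (of_int q * \<xi> - of_int p) = of_int q * (of_int w * \<xi>) - of_int w * of_int p" by (simp add: algebra_simps)
  then have alinv: "al (inverse \<epsilon>) = of_int w * (of_int q * \<xi> - of_int p)" unfolding \<xi>(1) by (simp add: al_def algebra_simps)
  have 1: "\<bar>al (inverse \<epsilon>)\<bar> \<le> N * \<bar>of_int q * \<xi> - of_int p\<bar>" unfolding alinv abs_mult using N by (intro mult_right_mono) auto
  have inv: "0 < inverse \<epsilon>" "inverse \<epsilon> < 1" using eps_gt_1 by (auto simp: inverse_less_1_iff)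
  have N1: "1 < N" using N(3) eps_gt_1 by simp
  have "al \<epsilon> = al (inverse \<epsilon>) + of_int v * of_int q * (\<epsilon> - inverse \<epsilon>)" by (simp add: al_def algebra_simps)
  moreover have "\<bar>of_int v * of_int q * (\<epsilon> - inverse \<epsilon>)\<bar> \<le> N * of_int q * N"
  proof -
    have "\<bar>\<epsilon> - inverse \<epsilon>\<bar> \<le> N" "\<bar>of_int q :: real\<bar> \<le> of_int q" using N inv eps_gt_1 q by linarith+
    then show ?thesis unfolding abs_mult using N N1 q by (intro mult_mono) auto
  qed
  moreover have "\<bar>al (inverse \<epsilon>)\<bar> \<le> N * of_int q * N"
  proof -
    have "N * \<bar>of_int q * \<xi> - of_int p\<bar> \<le> N * (of_int q * N)"
      using small N1 q mult_mono[of 1 "of_int q" 1 N] by (intro mult_left_mono) auto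
    then show ?thesis using 1 by (simp add: mult_ac)
  qed
  ultimately have 2: "\<bar>al \<epsilon>\<bar> \<le> 2 * (N * N * of_int q)" by (simp add: mult_ac)
  \<comment> \<open>\<open>al\<close> does not involve b, so the norm over four places is the square
    of the norm over two.\<close>
  have "1 \<le> (\<bar>al \<epsilon>\<bar> * \<bar>al (inverse \<epsilon>)\<bar>)\<^sup>2"
    using ring_elems_norm_ge_1[OF ring] nz by (simp add: power2_eq_square mult_ac)
  then have "1 \<le> \<bar>al \<epsilon>\<bar> * \<bar>al (inverse \<epsilon>)\<bar>" by (intro power2_le_imp_le[of 1]) auto
  also have "\<dots> \<le> 2 * (N * N * of_int q) * (N * \<bar>of_int q * \<xi> - of_int p\<bar>)"
    using 1 2 N1 q by (intro mult_mono) auto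
  finally show ?thesis by (simp add: power3_eq_cube mult_ac)
qed

text \<open>
  With \<open>g = 24 exp 3000000000000\<close>, the threshold in \<open>no_close_pair\<close>, this is at least \<open>2000 g (g + 1)\<close>, and
  \<open>2000 (g + 1) i i'\<close> bounds the common multiple of the logarithms of the units.
\<close>

definition exponent_const :: nat where
  "exponent_const = nat \<lceil>2000 * (24 * exp 3000000000000) * (24 * exp 3000000000000 + 1 :: real)\<rceil>"

text \<open>One third of the exponent formed with it is the n of the next proof, which dominates
  every lower bound required of L. The factor 3 splits 2^(3 n) into 2^n, which absorbs 2 N^3, and
  4^n, which is at least exp n.\<close>

definition size_const :: nat where
  "size_const = 3000000000000000 * exponent_const ^ 2"

lemma approximation_bound_of_presented_units:
  fixes \<mu> :: real
  assumes indep: "lin_indep_1_Q \<xi> \<zeta>" and codes: "quadratic_code x \<xi>" "quadratic_code y \<zeta>"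
    and units: "presents_unit x t e f i N" "presents_unit y t' e' f' i' N"
    and \<mu>: "2 - 1 / real (exponent_const * (i * i')) \<le> \<mu>"
    and k: "2 ^ (size_const * (i * i') ^ 2 * N ^ 4) \<le> k"
  shows "approximation_bound \<xi> \<zeta> \<mu> (1 / (real k + 1))"
  unfolding approximation_bound_def
proof (intro allI impI, rule ccontr)
  fix p q r :: int
  assume q: "1 \<le> q" and "\<not> max \<bar>\<xi> - of_int p / of_int q\<bar> \<bar>\<zeta> - of_int r / of_int q\<bar> > 1 / (real k + 1) / of_int q powr \<mu>"
  then have close: "\<bar>\<xi> - of_int p / of_int q\<bar> \<le> 1 / (real k + 1) / of_int q powr \<mu>"
    "\<bar>\<zeta> - of_int r / of_int q\<bar> \<le> 1 / (real k + 1) / of_int q powr \<mu>" by auto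
  obtain \<epsilon> u v w where eps: "\<epsilon> > 1" "\<epsilon> + inverse \<epsilon> = of_int (int t)" "\<epsilon> \<le> 2 ^ i" "\<epsilon> \<le> real N"
    "of_int w * \<xi> = of_int u + of_int v * inverse \<epsilon>" "v \<noteq> 0" "w \<noteq> 0" "\<bar>of_int w\<bar> \<le> real N" "\<bar>of_int v\<bar> \<le> real N"
    using presented_unit[OF codes(1) units(1)] by metis
  obtain \<eta> u' v' w' where eta: "\<eta> > 1" "\<eta> + inverse \<eta> = of_int (int t')" "\<eta> \<le> 2 ^ i'" "\<eta> \<le> real N"
    "of_int w' * \<zeta> = of_int u' + of_int v' * inverse \<eta>" "v' \<noteq> 0" "w' \<noteq> 0" "\<bar>of_int w'\<bar> \<le> real N" "\<bar>of_int v'\<bar> \<le> real N"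
    using presented_unit[OF codes(2) units(2)] by metis
  interpret biquadratic \<epsilon> \<eta> "int t" "int t'"
    by (rule lin_indep_biquadratic[OF indep eps(1,2) eta(1,2) eps(5-7) eta(5-7)])
  define g :: real where "g = 24 * exp 3000000000000"
  define G where "G = exponent_const"
  define \<tau> where "\<tau> = 1 / real (G * (i * i'))"
  define L where "L = ln (of_int q :: real)"
  define n where "n = 1000000000000000 * G ^ 2 * (i * i') ^ 2 * N ^ 4"
  have "g \<ge> 1000" unfolding g_def using exp_ge_add_one_self[of "3000000000000::real"] by linarith
  have G: "2000 * g * (g + 1) \<le> real G"
    unfolding G_def exponent_const_def g_def by linarith
  have G': "2000 * (g + 1) \<le> real G"
  proof -
    have "1 * (2000 * (g + 1)) \<le> g * (2000 * (g + 1))" using \<open>g \<ge> 1000\<close> by (intro mult_right_mono) auto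
    then show ?thesis using G by (simp add: mult_ac)
  qed
  have i: "i \<ge> 1" "i' \<ge> 1" using eps_gt_1 eta_gt_1 eps(3) eta(3) by (cases i; cases i'; simp)+
  have G1: "G \<ge> 1" using G' \<open>g \<ge> 1000\<close> by (cases G) auto
  have N1: "N \<ge> 1" using eps_gt_1 eps(4) by (cases N) auto
  have pos: "real (G * (i * i')) > 0" using G1 i by simp
  have \<tau>: "0 \<le> \<tau>" "\<tau> \<le> 1" "2 - \<tau> \<le> \<mu>" using pos G1 i \<mu> by (auto simp: \<tau>_def G_def[symmetric] divide_le_eq_1 Suc_le_eq simp flip: of_nat_mult)
  have L0: "0 \<le> L" using q by (simp add: L_def)
  have Q: "of_int q = exp L" using q by (simp add: L_def)
  have appr: "\<bar>of_int q * \<theta> - of_int m\<bar> \<le> 1 / (real k + 1) * exp ((\<tau> - 1) * L)"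
    if "\<bar>\<theta> - of_int m / of_int q\<bar> \<le> 1 / (real k + 1) / of_int q powr \<mu>" for \<theta> m
  proof -
    have "of_int q * \<theta> - of_int m = exp L * (\<theta> - of_int m / of_int q)" using q by (simp add: Q[symmetric] field_simps)
    then have "\<bar>of_int q * \<theta> - of_int m\<bar> = exp L * \<bar>\<theta> - of_int m / of_int q\<bar>" by (simp add: abs_mult)
    also have "\<dots> \<le> exp L * (1 / (real k + 1) / of_int q powr \<mu>)" using that by (intro mult_left_mono) auto
    also have "\<dots> = 1 / (real k + 1) * exp ((1 - \<mu>) * L)"
      using q by (simp add: powr_def L_def[symmetric] left_diff_distrib exp_diff)
    also have "\<dots> \<le> 1 / (real k + 1) * exp ((\<tau> - 1) * L)"
      using \<tau>(3) L0 by (intro mult_left_mono) (auto intro: mult_right_mono)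
    finally show ?thesis .
  qed
  have le1: "1 / (real k + 1) * exp ((\<tau> - 1) * L) \<le> exp ((\<tau> - 1) * L)"
    using mult_right_mono[of "1 / (real k + 1)" 1 "exp ((\<tau> - 1) * L)"] by simp
  note a = order.trans[OF appr[OF close(1)] le1] order.trans[OF appr[OF close(2)] le1]
  have "(\<tau> - 1) * L \<le> 0" using \<tau> L0 by (simp add: mult_nonpos_nonneg)
  then have "exp ((\<tau> - 1) * L) \<le> 1" by simp
  \<comment> \<open>The Liouville bound against the assumed quality gives k + 1 \<le> 2 N^3
    q^\<tau>, and the size of k then forces L to be at least n.\<close>
  with a(1) have "1 \<le> 2 * real N ^ 3 * of_int q * \<bar>of_int q * \<xi> - of_int p\<bar>"
    by (intro liouville[OF eps(5,6,8,9,4) q]) linarith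
  also have "\<dots> \<le> 2 * real N ^ 3 * of_int q * (1 / (real k + 1) * exp ((\<tau> - 1) * L))"
    using appr[OF close(1)] q by (intro mult_left_mono) auto
  also have "\<dots> = 2 * real N ^ 3 / (real k + 1) * exp (\<tau> * L)" by (simp add: Q left_diff_distrib exp_diff)
  also have "\<dots> \<le> 2 * real N ^ 3 / (real k + 1) * exp L"
    using \<tau> L0 mult_right_mono[of \<tau> 1 L] by (intro mult_left_mono) auto
  finally have kq: "real k + 1 \<le> 2 * real N ^ 3 * exp L" by (simp add: field_simps)
  have n2: "2 * N ^ 4 \<le> n"
    using mult_le_mono1[of 2 "1000000000000000 * G ^ 2 * (i * i') ^ 2" "N ^ 4"] G1 i unfolding n_def
    by (simp add: Suc_le_eq mult_ac)
  have "2 * N ^ 3 \<le> 2 * N ^ 4" using N1 by (intro mult_left_mono power_increasing) auto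
  then have "2 * N ^ 3 \<le> 2 ^ n" using n2 less_exp[of n] by linarith
  then have "real (2 * N ^ 3) \<le> real (2 ^ n)" by (simp only: of_nat_le_iff)
  then have Nn: "2 * real N ^ 3 \<le> 2 ^ n" by simp
  have "3 * n = size_const * (i * i') ^ 2 * N ^ 4" by (simp add: n_def size_const_def G_def)
  then have "real (2 ^ (3 * n)) \<le> real k" using k by (simp only: of_nat_le_iff)
  then have "(2::real) ^ (3 * n) \<le> real k" by simp
  moreover have "(2::real) ^ (3 * n) = 2 ^ n * 4 ^ n" by (simp add: power_mult flip: power_mult_distrib)
  ultimately have "2 ^ n * 4 ^ n \<le> 2 * real N ^ 3 * exp L" using kq by linarith
  also have "\<dots> \<le> 2 ^ n * exp L" using Nn by (intro mult_right_mono) auto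
  finally have "4 ^ n \<le> exp L" by simp
  moreover have "exp (real n) \<le> 4 ^ n"
  proof -
    have "exp (1::real) ^ n \<le> 4 ^ n" by (rule power_mono) (use exp_le in linarith, simp)
    then show ?thesis using exp_of_nat_mult[of n "1::real"] by simp
  qed
  ultimately have Ln: "real n \<le> L" using exp_le_cancel_iff[of "real n" L] by linarith
  have part: "g * (2000 * (g + 1) * real i * real i') \<le> real (G * (i * i'))"
    using mult_right_mono[OF G, of "real i * real i'"] by (simp add: mult_ac)
  have part': "2000 * (g + 1) * real i * real i' \<le> real (G * (i * i'))"
    using mult_right_mono[OF G', of "real i * real i'"] by (simp add: mult_ac)
  have nn: "real (m) \<le> L" if "m \<le> n" for m using that Ln by simp
  have n1: "1000000000000000 * (G * (i * i')) * N ^ 4 \<le> n"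
  proof -
    have "G * (i * i') \<le> (G * (i * i')) ^ 2" by (simp add: power2_eq_square)
    then have "1000000000000000 * (G * (i * i')) * N ^ 4 \<le> 1000000000000000 * (G * (i * i')) ^ 2 * N ^ 4"
      by (intro mult_le_mono) auto
    then show ?thesis by (simp add: n_def power_mult_distrib mult_ac)
  qed
  have N4: "1 \<le> N ^ 4" and Gii: "1 \<le> G * (i * i')" using N1 G1 i by (simp_all add: Suc_le_eq)
  show False
  proof (rule no_good_approximation[where g = g and N = "real N" and \<tau> = \<tau> and L = L])
    show "24 * exp 3000000000000 \<le> g" by (simp add: g_def)
    show "\<tau> * (2000 * g * (g + 1) * real i * real i') \<le> 1"
    proof -
      have "\<tau> * (2000 * g * (g + 1) * real i * real i') \<le> \<tau> * real (G * (i * i'))"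
        using part \<tau> by (intro mult_left_mono) (simp_all add: mult_ac)
      also have "\<dots> = 1" unfolding \<tau>_def using pos by (simp del: of_nat_mult)
      finally show ?thesis .
    qed
    have "100000000000000 \<le> 1000000000000000 * (G * (i * i')) * N ^ 4"
      using mult_le_mono[OF Gii N4] by simp
    then have "100000000000000 \<le> n" using n1 by linarith
    then have "real 100000000000000 \<le> L" by (rule nn)
    then show "100000000000000 \<le> L" by simp
    have "1000000 * (G * (i * i')) \<le> 1000000000000000 * (G * (i * i')) * N ^ 4"
      using mult_le_mono[of "1000000 * (G * (i * i'))" "1000000000000000 * (G * (i * i'))" 1 "N ^ 4"] N4 by simp
    then have "real (1000000 * (G * (i * i'))) \<le> L" using n1 by (intro nn) linarith
    then show "1000000 * (2000 * (g + 1) * real i * real i') \<le> L" using part' by simp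
    have "g * (2000 * (g + 1) * real i * real i')\<^sup>2 \<le> real (G * (i * i')) * real (G * (i * i'))"
      using mult_mono[OF part part'] \<open>g \<ge> 1000\<close> by (simp add: power2_eq_square mult_ac)
    also have "\<dots> = real ((G * (i * i')) ^ 2)" by (simp add: power2_eq_square)
    also have "\<dots> \<le> L"
    proof (rule nn)
      have "1 * (G * (i * i')) ^ 2 * 1 \<le> 1000000000000000 * (G * (i * i')) ^ 2 * N ^ 4"
        using N4 by (intro mult_le_mono) auto
      then show "(G * (i * i')) ^ 2 \<le> n" by (simp add: n_def power_mult_distrib mult_ac)
    qed
    finally show "g * (2000 * (g + 1) * real i * real i')\<^sup>2 \<le> L" .
    have "g * (2000 * (g + 1) * real i * real i') * (2 * real N ^ 4) \<le> real (G * (i * i')) * (2 * real N ^ 4)"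
      using part by (intro mult_right_mono) auto
    also have "\<dots> = real (G * (i * i') * (2 * N ^ 4))" by simp
    also have "\<dots> \<le> L"
      using n1 by (intro nn) (simp add: mult_ac)
    finally show "g * (2000 * (g + 1) * real i * real i') * (2 * real N ^ 4) \<le> L" .
  qed (rule eps eta q \<tau> L_def a)+
qed

section \<open>Coding and checking of certificates\<close>

fun entry :: "nat \<Rightarrow> nat \<Rightarrow> nat" where
  "entry 0 n = fst (prod_decode n)"
| "entry (Suc j) n = entry j (snd (prod_decode n))"

fun tuple_code :: "nat list \<Rightarrow> nat" where
  "tuple_code [] = 0"
| "tuple_code (x # xs) = prod_encode (x, tuple_code xs)"

lemma entry_tuple_code: "j < length xs \<Longrightarrow> entry j (tuple_code xs) = xs ! j"
  by (induction xs arbitrary: j) (auto simp: less_Suc_eq_0_disj nth_Cons')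

lemma entry_le: "entry j n \<le> n"
proof (induction j arbitrary: n)
  case 0
  then show ?case using le_prod_encode_1[of "fst (prod_decode n)" "snd (prod_decode n)"] by simp
next
  case (Suc j)
  have "snd (prod_decode n) \<le> n" using le_prod_encode_2[of "snd (prod_decode n)" "fst (prod_decode n)"] by simp
  then show ?case using Suc[of "snd (prod_decode n)"] by simp
qed

lemma recursive_entry: "recursive f \<Longrightarrow> recursive (\<lambda>x. entry j (f x))"
  by (induction j arbitrary: f) (auto intro: recursive_fst recursive_snd)

text \<open>Entries 0 to 3 and 4 to 7 are t, e, f, i for the two units, entry 8 is the common bound
  N, entry 9 the reciprocal size k of the constant. The third condition is 2 - 1/m \<le> \<nu>
  multiplied by m, where m is \<open>exponent_const\<close> times entries 3 and 7.\<close>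

definition certificate :: "int \<times> int \<times> int \<Rightarrow> int \<times> int \<times> int \<Rightarrow> rat \<Rightarrow> nat \<Rightarrow> bool" where
  "certificate x y \<nu> n \<longleftrightarrow>
     presents_unit x (entry 0 n) (entry 1 n) (entry 2 n) (entry 3 n) (entry 8 n) \<and>
     presents_unit y (entry 4 n) (entry 5 n) (entry 6 n) (entry 7 n) (entry 8 n) \<and>
     2 * of_nat (exponent_const * (entry 3 n * entry 7 n)) - 1 \<le> \<nu> * of_nat (exponent_const * (entry 3 n * entry 7 n)) \<and>
     2 ^ (size_const * (entry 3 n * entry 7 n) ^ 2 * entry 8 n ^ 4) \<le> entry 9 n"

text \<open>
  The number of a certificate exceeds its last entry, so its reciprocal is an admissible constant;
  searching for a certificate up to \<open>k\<close> computes the constant to precision \<open>1 / (k + 1)\<close>.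
\<close>

definition certified_constant :: constants where
  "certified_constant x y \<nu> =
     (if \<exists>n. certificate x y \<nu> n then 1 / (real (LEAST n. certificate x y \<nu> n) + 1) else 0)"

lemma approximation_bound_mono:
  assumes "approximation_bound \<xi> \<zeta> \<mu> c" "c' \<le> c"
  shows "approximation_bound \<xi> \<zeta> \<mu> c'"
  unfolding approximation_bound_def
proof (intro allI impI)
  fix p q r :: int
  assume "1 \<le> q"
  moreover have "c' / of_int q powr \<mu> \<le> c / of_int q powr \<mu>" using assms(2) by (intro divide_right_mono) auto
  ultimately show "c' / of_int q powr \<mu> < max \<bar>\<xi> - of_int p / of_int q\<bar> \<bar>\<zeta> - of_int r / of_int q\<bar>"
    using assms(1) unfolding approximation_bound_def by (meson le_less_trans)
qed

lemma exponent_const_pos: "exponent_const > 0"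
  unfolding exponent_const_def by (simp add: add_pos_pos)

lemma presents_unit_exponent_pos:
  assumes "presents_unit x t e f i N"
  shows "i > 0"
proof (rule ccontr)
  assume "\<not> i > 0"
  moreover have "3 \<le> t" "t \<le> 2 ^ i" using assms by (auto simp: presents_unit_def split: prod.splits)
  ultimately show False by simp
qed

lemma certificate_sound:
  assumes "certificate x y \<nu> n" "lin_indep_1_Q \<xi> \<zeta>" "quadratic_code x \<xi>" "quadratic_code y \<zeta>"
  shows "approximation_bound \<xi> \<zeta> (of_rat \<nu>) (1 / (real n + 1))"
proof -
  define m where "m = exponent_const * (entry 3 n * entry 7 n)"
  note cert = assms(1)[unfolded certificate_def]
  have m: "m > 0" unfolding m_def
    using presents_unit_exponent_pos[OF conjunct1[OF cert]] presents_unit_exponent_pos[OF conjunct1[OF conjunct2[OF cert]]]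
      exponent_const_pos by simp
  have "2 * of_nat m - 1 \<le> \<nu> * of_nat m" using cert by (simp add: m_def)
  then have "real_of_rat (2 * of_nat m - 1) \<le> real_of_rat (\<nu> * of_nat m)" by (simp only: of_rat_less_eq)
  then have "2 * real m - 1 \<le> real_of_rat \<nu> * real m" by (simp add: of_rat_diff of_rat_mult)
  then have "(2 * real m - 1) / real m \<le> real_of_rat \<nu>" using m by (simp add: pos_divide_le_eq)
  then have "2 - 1 / real m \<le> real_of_rat \<nu>" using m by (simp add: diff_divide_distrib)
  then have "approximation_bound \<xi> \<zeta> (of_rat \<nu>) (1 / (real (entry 9 n) + 1))"
    using cert unfolding m_def by (intro approximation_bound_of_presented_units[OF assms(2-4)]) auto
  moreover have "1 / (real n + 1) \<le> 1 / (real (entry 9 n) + 1)"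
    using entry_le[of 9 n] by (intro divide_left_mono) auto
  ultimately show ?thesis by (rule approximation_bound_mono)
qed

lemma certified_constant_sound:
  assumes "certified_constant x y \<nu> > 0" "lin_indep_1_Q \<xi> \<zeta>" "quadratic_code x \<xi>" "quadratic_code y \<zeta>"
  shows "approximation_bound \<xi> \<zeta> (of_rat \<nu>) (certified_constant x y \<nu>)"
proof -
  have ex: "\<exists>n. certificate x y \<nu> n" using assms(1) by (auto simp: certified_constant_def split: if_splits)
  then have "certificate x y \<nu> (LEAST n. certificate x y \<nu> n)" by (rule LeastI_ex)
  from certificate_sound[OF this assms(2-)] show ?thesis using ex by (simp add: certified_constant_def)
qed

text \<open>Subtraction of codes is truncated, so every negative term is moved to the other side;
  sums, products and comparisons of natural numbers remain.\<close>

lemma presents_unit_decode: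
  "presents_unit (decode_triple u) t e f i N \<longleftrightarrow>
     (let a = entry 0 u; b = entry 1 u; c = snd (prod_decode (snd (prod_decode u))) in
      3 \<le> t \<and> t \<le> 2 ^ i \<and> 1 \<le> e \<and> 1 \<le> f \<and> t \<le> N \<and> 2 * e \<le> N \<and> 2 * (nat_part a + neg_part a) * f \<le> N \<and>
      (nat_part b + neg_part b) ^ 2 * f ^ 2 + 4 * (nat_part a * neg_part c + neg_part a * nat_part c) * f ^ 2 + 4 * e ^ 2
        = t ^ 2 * e ^ 2 + 4 * (nat_part a * nat_part c + neg_part a * neg_part c) * f ^ 2)"
proof -
  define a where "a = fst (prod_decode u)"
  define b where "b = fst (prod_decode (snd (prod_decode u)))"
  define c where "c = snd (prod_decode (snd (prod_decode u)))"
  have u: "decode_triple u = (int_decode a, int_decode b, int_decode c)"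
    by (simp add: decode_triple_def a_def b_def c_def case_prod_unfold)
  have 1: "2 * \<bar>int_decode a\<bar> * int f \<le> int N \<longleftrightarrow> 2 * (nat_part a + neg_part a) * f \<le> N"
  proof -
    have "2 * \<bar>int_decode a\<bar> * int f = int (2 * (nat_part a + neg_part a) * f)" by (simp add: abs_int_decode)
    then show ?thesis by (simp only: of_nat_le_iff)
  qed
  define l where "l = (nat_part b + neg_part b) ^ 2 * f ^ 2 + 4 * (nat_part a * neg_part c + neg_part a * nat_part c) * f ^ 2 + 4 * e ^ 2"
  define r where "r = t ^ 2 * e ^ 2 + 4 * (nat_part a * nat_part c + neg_part a * neg_part c) * f ^ 2"
  have b2: "(int_decode b)\<^sup>2 = (int (nat_part b) + int (neg_part b))\<^sup>2" using abs_int_decode[of b] by (metis power2_abs)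
  have "((int_decode b)\<^sup>2 - 4 * int_decode a * int_decode c) * (int f)\<^sup>2 - ((int t)\<^sup>2 - 4) * (int e)\<^sup>2 = int l - int r"
    unfolding b2 by (simp add: l_def r_def int_decode_parts[of a] int_decode_parts[of c] algebra_simps)
  then have 2: "((int_decode b)\<^sup>2 - 4 * int_decode a * int_decode c) * (int f)\<^sup>2 = ((int t)\<^sup>2 - 4) * (int e)\<^sup>2 \<longleftrightarrow> l = r"
    by linarith
  show ?thesis unfolding u presents_unit_def using 1 2 by (simp add: l_def r_def a_def b_def c_def Let_def)
qed

lemma decidable_presents_unit:
  assumes "recursive u" "recursive t" "recursive e" "recursive f" "recursive i" "recursive N"
  shows "decidable (\<lambda>x. presents_unit (decode_triple (u x)) (t x) (e x) (f x) (i x) (N x))"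
  unfolding presents_unit_decode Let_def
  by (intro decidable_conj decidable_le decidable_eq recursive_add recursive_mult recursive_power recursive_const
      recursive_parts recursive_entry recursive_snd assms)

lemma exponent_condition_decode:
  fixes m w :: nat
  shows "2 * of_nat m - 1 \<le> decode_rat w * of_nat m \<longleftrightarrow>
    2 * m * Suc (snd (prod_decode w)) + neg_part (fst (prod_decode w)) * m \<le> nat_part (fst (prod_decode w)) * m + Suc (snd (prod_decode w))"
proof -
  define p where "p = fst (prod_decode w)"
  define d where "d = Suc (snd (prod_decode w))"
  have w: "decode_rat w = of_int (int_decode p) / of_nat d" by (simp add: decode_rat_def p_def d_def case_prod_unfold)
  have d: "(of_nat d :: rat) > 0" by (simp add: d_def)
  have "2 * of_nat m - 1 \<le> decode_rat w * of_nat m \<longleftrightarrow> (2 * of_nat m - 1 :: rat) \<le> of_int (int_decode p) * of_nat m / of_nat d"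
    unfolding w by simp
  also have "\<dots> \<longleftrightarrow> (2 * of_nat m - 1) * of_nat d \<le> (of_int (int_decode p) * of_nat m :: rat)"
    using d by (rule pos_le_divide_eq)
  also have "\<dots> \<longleftrightarrow> (of_nat (2 * m * d + neg_part p * m) :: rat) \<le> of_nat (nat_part p * m + d)"
    by (simp add: int_decode_parts algebra_simps)
  also have "\<dots> \<longleftrightarrow> 2 * m * d + neg_part p * m \<le> nat_part p * m + d" by (rule of_nat_le_iff)
  finally show ?thesis by (simp add: p_def d_def)
qed

lemma decidable_certificate:
  assumes "recursive u" "recursive v" "recursive w" "recursive n"
  shows "decidable (\<lambda>x. certificate (decode_triple (u x)) (decode_triple (v x)) (decode_rat (w x)) (n x))"
  unfolding certificate_def exponent_condition_decode
  by (intro decidable_conj decidable_presents_unit decidable_le recursive_add recursive_mult recursive_power recursive_const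
      recursive_parts recursive_entry recursive_fst recursive_snd recursive_Suc assms)

lemma computable_certified_constant: "computable_constants certified_constant"
proof -
  define cert where "cert = (\<lambda>x n. certificate (decode_triple (fst (prod_decode x)))
    (decode_triple (fst (prod_decode (snd (prod_decode x))))) (decode_rat (snd (prod_decode (snd (prod_decode x))))) n)"
  \<comment> \<open>The first alternative stops the search just beyond the precision k, so it is
    total even if there is no certificate.\<close>
  define h where "h = (\<lambda>y. LEAST n. snd (prod_decode y) < n \<or> cert (fst (prod_decode y)) n)"
  \<comment> \<open>Doubling encodes a nonnegative integer. If the search finds l \<le> k, then (k +
    1) div (l + 1) is below (k + 1) / (l + 1) by less than 1; otherwise the constant is below 1 / (k
    + 1), and 0 is close enough.\<close>
  define f where "f = (\<lambda>y. if h y \<le> snd (prod_decode y) then 2 * (Suc (snd (prod_decode y)) div Suc (h y)) else 0)"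
  have h: "recursive h" unfolding h_def
  proof (rule recursive_Least)
    show "decidable (\<lambda>y. snd (prod_decode (fst (prod_decode y))) < snd (prod_decode y) \<or>
        cert (fst (prod_decode (fst (prod_decode y)))) (snd (prod_decode y)))"
      unfolding cert_def
      by (intro decidable_disj decidable_less decidable_certificate recursive_fst recursive_snd recursive_id)
    show "\<exists>n. snd (prod_decode x) < n \<or> cert (fst (prod_decode x)) n" for x by blast
  qed
  have f: "recursive f" unfolding f_def
    by (intro recursive_if decidable_le recursive_mult recursive_div recursive_Suc recursive_snd recursive_id recursive_const h) simp
  have main: "\<bar>(if \<exists>n. cert x n then 1 / (real (LEAST n. cert x n) + 1) else 0) -
      of_int (int_decode (f (prod_encode (x, k)))) / (real k + 1)\<bar> \<le> 1 / (real k + 1)" for x k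
  proof -
    have hk: "h (prod_encode (x, k)) = (LEAST n. k < n \<or> cert x n)" by (simp add: h_def)
    show ?thesis
    proof (cases "\<exists>n\<le>k. cert x n")
      case True
      define l where "l = (LEAST n. cert x n)"
      obtain n where "n \<le> k" "cert x n" using True by blast
      then have l: "cert x l" "l \<le> k" unfolding l_def by (auto intro: LeastI Least_le[THEN order.trans])
      have hl: "h (prod_encode (x, k)) = l" unfolding hk
        using l by (intro Least_equality) (auto simp: l_def intro: Least_le)
      define d where "d = Suc k div Suc l"
      have fd: "int_decode (f (prod_encode (x, k))) = int d" using l hl by (simp add: f_def int_decode_double d_def)
      have "d * Suc l \<le> Suc k" "Suc k < Suc d * Suc l"
        using div_times_less_eq_dividend[of "Suc k" "Suc l"] dividend_less_div_times[of "Suc l" "Suc k"] by (simp_all add: d_def add.commute)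
      then have "real (d * Suc l) \<le> real (Suc k)" "real (Suc k) \<le> real (Suc d * Suc l)" by (simp_all only: of_nat_le_iff less_imp_le)
      then have 1: "real d * (real l + 1) \<le> real k + 1" "real k + 1 \<le> (real d + 1) * (real l + 1)" by (simp_all add: algebra_simps)
      have 2: "real d / (real k + 1) \<le> 1 / (real l + 1)" "1 / (real l + 1) \<le> (real d + 1) / (real k + 1)"
        using 1 by (simp_all add: divide_simps)
      then have "\<bar>1 / (real l + 1) - real d / (real k + 1)\<bar> \<le> 1 / (real k + 1)" by (simp add: add_divide_distrib)
      then show ?thesis using l(1) fd by (auto simp: l_def)
    next
      case False
      then have none: "cert x n \<Longrightarrow> k < n" for n by (meson not_le)
      have "h (prod_encode (x, k)) = Suc k" unfolding hk
        using none by (intro Least_equality) (auto simp: Suc_le_eq)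
      then have f0: "int_decode (f (prod_encode (x, k))) = 0" using int_decode_double[of 0] by (simp add: f_def)
      show ?thesis
      proof (cases "\<exists>n. cert x n")
        case True
        then have "cert x (LEAST n. cert x n)" by (rule LeastI_ex)
        then have "k < (LEAST n. cert x n)" by (rule none)
        then have "1 / (real (LEAST n. cert x n) + 1) \<le> 1 / (real k + 1)" by (intro divide_left_mono) auto
        then show ?thesis using True f0 by simp
      qed (use f0 in simp)
    qed
  qed
  have eq: "(case prod_decode x of (u, m) \<Rightarrow> case prod_decode m of (v, w) \<Rightarrow>
      certified_constant (decode_triple u) (decode_triple v) (decode_rat w)) =
      (if \<exists>n. cert x n then 1 / (real (LEAST n. cert x n) + 1) else 0)" for x
    unfolding cert_def certified_constant_def case_prod_unfold ..
  show ?thesis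
    unfolding computable_constants_def computable_family_def eq using f main by blast
qed

lemma effective_certified_constant: "effective_constants certified_constant"
  unfolding effective_constants_def using computable_certified_constant certified_constant_sound by blast

lemma ex_presents_unit:
  fixes \<epsilon> :: real and t e f :: nat
  assumes \<epsilon>: "\<epsilon> > 1" "\<epsilon> + inverse \<epsilon> = real t"
    and "1 \<le> e" "1 \<le> f" "(b\<^sup>2 - 4 * a * c) * (int f)\<^sup>2 = ((int t)\<^sup>2 - 4) * (int e)\<^sup>2"
  obtains i N0 where "real i \<le> 6 * ln \<epsilon>" "\<And>N. N0 \<le> N \<Longrightarrow> presents_unit (a, b, c) t e f i N"
proof -
  have inv: "inverse \<epsilon> < 1" using \<epsilon>(1) by (simp add: inverse_less_1_iff)
  then have "0 < (\<epsilon> - 1) * (1 - inverse \<epsilon>)" using \<epsilon>(1) by (intro mult_pos_pos) auto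
  also have "(\<epsilon> - 1) * (1 - inverse \<epsilon>) = \<epsilon> + inverse \<epsilon> - 2" using \<epsilon>(1) by (simp add: left_diff_distrib right_diff_distrib)
  finally have t3: "3 \<le> t" using \<epsilon>(2) by linarith
  then have e2: "2 < \<epsilon>" using \<epsilon>(2) inv by linarith
  have "ln 2 \<le> ln \<epsilon>" using e2 by simp
  have ln2: "1 / 2 \<le> ln (2::real)" using ln_ge_iff[of 2 "1/2"] exp_bound[of "1/2::real"] by (simp add: power2_eq_square)
  \<comment> \<open>The trace is at most 2 \<epsilon>. As ln 2 is at least 1/2, the rounded
    logarithm is at most 2 + 2 ln \<epsilon>, and ln \<epsilon> \<ge> 1/2 turns this into 6 ln
    \<epsilon>.\<close>
  define i where "i = nat \<lceil>log 2 (2 * \<epsilon>)\<rceil>"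
  have "log 2 (2 * \<epsilon>) = 1 + ln \<epsilon> / ln 2" using \<epsilon>(1) by (simp add: log_mult) (simp add: log_def)
  also have "ln \<epsilon> / ln 2 \<le> ln \<epsilon> / (1 / 2)" using ln2 \<epsilon>(1) by (intro divide_left_mono) auto
  finally have l: "log 2 (2 * \<epsilon>) \<le> 1 + 2 * ln \<epsilon>" by simp
  have lpos: "0 \<le> log 2 (2 * \<epsilon>)" using \<epsilon>(1) by simp
  have "real i \<le> log 2 (2 * \<epsilon>) + 1" using lpos unfolding i_def by linarith
  then have i1: "real i \<le> 6 * ln \<epsilon>" using l ln2 \<open>ln 2 \<le> ln \<epsilon>\<close> by linarith
  have "real t \<le> 2 * \<epsilon>" using \<epsilon> inv by linarith
  also have "2 * \<epsilon> = 2 powr log 2 (2 * \<epsilon>)" using \<epsilon>(1) by simp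
  also have "\<dots> \<le> 2 powr real i" using lpos unfolding i_def by (intro powr_mono) auto
  also have "\<dots> = real (2 ^ i)" by (simp add: powr_realpow)
  finally have t2: "t \<le> 2 ^ i" by (simp only: of_nat_le_iff)
  show thesis
  proof (rule that[OF i1, of "t + 2 * e + nat (2 * \<bar>a\<bar> * int f)"])
    fix N assume N: "t + 2 * e + nat (2 * \<bar>a\<bar> * int f) \<le> N"
    have "2 * \<bar>a\<bar> * int f \<le> int (nat (2 * \<bar>a\<bar> * int f))" by simp
    then have "2 * \<bar>a\<bar> * int f \<le> int N" using N by linarith
    then show "presents_unit (a, b, c) t e f i N" unfolding presents_unit_def using assms(3-) t3 t2 N by simp
  qed
qed

text \<open>There is a certificate for the exponent 2 - 1/m with m =
  \<open>exponent_const * (i * i')\<close>, and 36 is 6 times 6 from rounding the two logarithms to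
  i and i'.\<close>

lemma mu_eff_le:
  fixes \<epsilon> \<eta> :: real and t e f t' e' f' :: nat
  assumes indep: "lin_indep_1_Q \<xi> \<zeta>" and codes: "quadratic_code (a, b, c) \<xi>" "quadratic_code (a', b', c') \<zeta>"
    and \<epsilon>: "\<epsilon> > 1" "\<epsilon> + inverse \<epsilon> = real t" "1 \<le> e" "1 \<le> f" "(b\<^sup>2 - 4 * a * c) * (int f)\<^sup>2 = ((int t)\<^sup>2 - 4) * (int e)\<^sup>2"
    and \<eta>: "\<eta> > 1" "\<eta> + inverse \<eta> = real t'" "1 \<le> e'" "1 \<le> f'" "(b'\<^sup>2 - 4 * a' * c') * (int f')\<^sup>2 = ((int t')\<^sup>2 - 4) * (int e')\<^sup>2"
  shows "mu_eff certified_constant \<xi> \<zeta> \<le> ereal (2 - inverse (36 * real exponent_const * ln \<epsilon> * ln \<eta>))"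
proof -
  obtain i N0 where i: "real i \<le> 6 * ln \<epsilon>" "\<And>N. N0 \<le> N \<Longrightarrow> presents_unit (a, b, c) t e f i N"
    using ex_presents_unit[OF \<epsilon>] by blast
  obtain i' N0' where i': "real i' \<le> 6 * ln \<eta>" "\<And>N. N0' \<le> N \<Longrightarrow> presents_unit (a', b', c') t' e' f' i' N"
    using ex_presents_unit[OF \<eta>] by blast
  define N where "N = N0 + N0'"
  have units: "presents_unit (a, b, c) t e f i N" "presents_unit (a', b', c') t' e' f' i' N"
    by (simp_all add: i i' N_def)
  define m where "m = exponent_const * (i * i')"
  have m: "m > 0" using presents_unit_exponent_pos[OF units(1)] presents_unit_exponent_pos[OF units(2)] exponent_const_pos
    by (simp add: m_def)
  define k :: nat where "k = 2 ^ (size_const * (i * i') ^ 2 * N ^ 4)"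
  define n where "n = tuple_code [t, e, f, i, t', e', f', i', N, k]"
  define \<nu> where "\<nu> = (2 - 1 / of_nat m :: rat)"
  have entries: "entry 0 n = t" "entry 1 n = e" "entry 2 n = f" "entry 3 n = i" "entry 4 n = t'" "entry 5 n = e'"
    "entry 6 n = f'" "entry 7 n = i'" "entry 8 n = N" "entry 9 n = k"
    unfolding n_def by (subst entry_tuple_code; simp)+
  have "certificate (a, b, c) (a', b', c') \<nu> n"
    unfolding certificate_def entries using units m
    by (simp add: m_def[symmetric] k_def \<nu>_def left_diff_distrib del: of_nat_mult)
  then have pos: "certified_constant (a, b, c) (a', b', c') \<nu> > 0" by (auto simp: certified_constant_def)
  have "effective_irrationality_measure certified_constant \<xi> \<zeta> (of_rat \<nu>)"
    unfolding effective_irrationality_measure_def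
    using codes pos certified_constant_sound[OF pos indep codes] by blast
  then have "mu_eff certified_constant \<xi> \<zeta> \<le> ereal (of_rat \<nu>)"
    unfolding mu_eff_def by (intro INF_lower) auto
  also have "ereal (of_rat \<nu>) \<le> ereal (2 - inverse (36 * real exponent_const * ln \<epsilon> * ln \<eta>))"
  proof -
    have "real i * real i' \<le> (6 * ln \<epsilon>) * (6 * ln \<eta>)" using i i' by (intro mult_mono) auto
    then have "real exponent_const * (real i * real i') \<le> real exponent_const * ((6 * ln \<epsilon>) * (6 * ln \<eta>))"
      by (intro mult_left_mono) auto
    then have "real m \<le> 36 * real exponent_const * ln \<epsilon> * ln \<eta>" by (simp add: m_def mult_ac)
    then have "inverse (36 * real exponent_const * ln \<epsilon> * ln \<eta>) \<le> inverse (real m)" using m by (intro le_imp_inverse_le) auto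
    moreover have "real_of_rat \<nu> = 2 - inverse (real m)" by (simp add: \<nu>_def of_rat_diff of_rat_divide of_rat_inverse divide_inverse)
    ultimately show ?thesis by simp
  qed
  finally show ?thesis .
qed

section \<open>Small solutions of Pell's equation\<close>

lemma sqrt_rat_imp_square:
  assumes "sqrt (real n) \<in> \<rat>"
  shows "is_square n"
proof -
  have "algebraic_int (sqrt (real n))" by (intro algebraic_int_sqrt algebraic_int_of_nat)
  then have "sqrt (real n) \<in> \<int>" using assms by (rule rational_algebraic_int_is_int)
  then obtain k where k: "sqrt (real n) = of_int k" by (elim Ints_cases)
  then have "real n = (of_int k)\<^sup>2" by (metis of_nat_0_le_iff real_sqrt_pow2)
  then have "int n = k\<^sup>2" by (metis of_int_eq_iff of_int_of_nat_eq of_int_power)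
  then have "n = (nat \<bar>k\<bar>)\<^sup>2" by (metis nat_int nat_power_eq abs_ge_zero power2_abs)
  then show ?thesis by blast
qed

section \<open>Weighted divisor sums\<close>

lemma sum_inverse_sqrt_le: "(\<Sum>v = 1..n. 1 / sqrt (real v)) \<le> 2 * sqrt (real n)"
proof (induction n)
  case (Suc n)
  define x where "x = sqrt (real n)"
  define y where "y = sqrt (real (Suc n))"
  have xy: "0 \<le> x" "0 < y" "y * y = x * x + 1" by (auto simp: x_def y_def)
  have "0 \<le> (y - x) * (y - x)" by simp
  then have "1 \<le> 2 * (y - x) * y" using xy(3) by (simp add: algebra_simps)
  then have "1 / y \<le> 2 * (y - x)" using xy(2) by (simp add: pos_divide_le_eq)
  then show ?case using Suc.IH by (simp add: x_def y_def)
qed simp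

lemma harm_le_ln:
  assumes "n > 0"
  shows "harm n \<le> 1 + ln (real n)"
proof -
  obtain k where k: "n = Suc k" using assms by (cases n) auto
  have "harm (Suc k) - ln (real (Suc k)) \<le> harm (Suc 0) - ln (real (Suc 0))"
    using decseqD[OF decseq_harm_diff_ln, of 0 k] by simp
  then show ?thesis by (simp add: k harm_expand)
qed

text \<open>With n = u v and u outside, the inner sum of sqrt (B / (u v)) is at most 2 B / u. The
  weight comes from counting how often one approximation of norm n can recur; it leaves the order of
  the plain divisor sum unchanged.\<close>

lemma sum_divisors_weighted:
  "(\<Sum>n = 1..B. real (card {u. u dvd n}) * sqrt (real B / real n)) \<le> 2 * real B * harm B"
proof -
  define F where "F = (\<lambda>n::nat. sqrt (real B / real n))"
  have "(\<Sum>n = 1..B. real (card {u. u dvd n}) * F n) = (\<Sum>n = 1..B. \<Sum>u | u \<in> {1..B} \<and> u dvd n. F n)"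
  proof (rule sum.cong[OF refl])
    fix n assume n: "n \<in> {1..B}"
    have "{u. u \<in> {1..B} \<and> u dvd n} = {u. u dvd n}"
      using n by (auto dest: dvd_imp_le simp: Suc_le_eq intro: Nat.gr0I)
    then show "real (card {u. u dvd n}) * F n = (\<Sum>u | u \<in> {1..B} \<and> u dvd n. F n)" by simp
  qed
  also have "\<dots> = (\<Sum>u = 1..B. \<Sum>n | n \<in> {1..B} \<and> u dvd n. F n)" by (rule sum.swap_restrict) auto
  also have "\<dots> \<le> (\<Sum>u = 1..B. 2 * real B * (1 / real u))"
  proof (rule sum_mono)
    fix u assume u: "u \<in> {1..B}"
    have img: "{n. n \<in> {1..B} \<and> u dvd n} = (\<lambda>v. u * v) ` {1..B div u}"
    proof (intro equalityI subsetI)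
      fix n assume "n \<in> {n. n \<in> {1..B} \<and> u dvd n}"
      then obtain v where v: "n = u * v" "1 \<le> n" "n \<le> B" by auto
      then have "1 \<le> v" by (cases v) auto
      moreover have "v \<le> B div u" using v u by (simp add: less_eq_div_iff_mult_less_eq mult.commute)
      ultimately show "n \<in> (\<lambda>v. u * v) ` {1..B div u}" using v by auto
    next
      fix n assume "n \<in> (\<lambda>v. u * v) ` {1..B div u}"
      then obtain v where "v \<in> {1..B div u}" and v: "n = u * v" by blast
      then have v: "n = u * v" "1 \<le> v" "v \<le> B div u" by auto
      then have "u * v \<le> B" using u by (simp add: less_eq_div_iff_mult_less_eq mult.commute)
      then show "n \<in> {n. n \<in> {1..B} \<and> u dvd n}" using v u by (auto simp: Suc_le_eq)
    qed
    have "(\<Sum>n | n \<in> {1..B} \<and> u dvd n. F n) = (\<Sum>v = 1..B div u. F (u * v))"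
      unfolding img using u by (subst sum.reindex) (auto simp: inj_on_def)
    also have "\<dots> = sqrt (real B / real u) * (\<Sum>v = 1..B div u. 1 / sqrt (real v))"
      unfolding sum_distrib_left F_def by (simp add: real_sqrt_divide real_sqrt_mult)
    also have "\<dots> \<le> sqrt (real B / real u) * (2 * sqrt (real (B div u)))"
      by (intro mult_left_mono sum_inverse_sqrt_le) auto
    also have "\<dots> \<le> sqrt (real B / real u) * (2 * sqrt (real B / real u))"
      by (intro mult_left_mono real_sqrt_le_mono of_nat_div_le_of_nat) auto
    also have "\<dots> = 2 * (sqrt (real B / real u) * sqrt (real B / real u))" by (simp only: mult.left_commute)
    also have "\<dots> = 2 * real B * (1 / real u)" by (subst real_sqrt_mult_self) simp
    finally show "(\<Sum>n | n \<in> {1..B} \<and> u dvd n. F n) \<le> 2 * real B * (1 / real u)" .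
  qed
  also have "\<dots> = 2 * real B * harm B" by (simp add: harm_def sum_distrib_left divide_inverse)
  finally show ?thesis by (simp add: F_def)
qed

section \<open>Square roots modulo m\<close>

definition square_roots_mod :: "nat \<Rightarrow> nat \<Rightarrow> nat set" where
  "square_roots_mod a m = {r. r < m \<and> int m dvd (int r)\<^sup>2 - int a}"

text \<open>
  Two roots \<open>r\<close>, \<open>r\<^sub>0\<close> with \<open>gcd m (r - r\<^sub>0) = d\<close> satisfy \<open>r \<equiv> r\<^sub>0\<close> mod \<open>d\<close> and \<open>r \<equiv> - r\<^sub>0\<close> mod \<open>m / d\<close>;
  since \<open>a\<close> is squarefree, \<open>d\<close> and \<open>m / d\<close> have at most the factor \<open>2\<close> in common.
\<close>

lemma card_square_roots_mod:
  assumes sf: "squarefree a" and m: "m > 0"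
  shows "card (square_roots_mod a m) \<le> 2 * card {d. d dvd m}"
proof (cases "square_roots_mod a m = {}")
  case False
  define S where "S = square_roots_mod a m"
  obtain r0 where r0: "r0 \<in> S" using False by (auto simp: S_def)
  define g where "g = (\<lambda>r. nat (gcd (int m) (int r - int r0)))"
  have gd: "g r dvd m" for r
  proof -
    have "int (g r) dvd int m" by (simp add: g_def)
    then show ?thesis by simp
  qed
  have two: "int m dvd 2 * (int r - int r')" if r: "r \<in> S" "r' \<in> S" "g r = g r'" for r r'
  proof -
    define d where "d = gcd (int m) (int r - int r0)"
    define h where "h = int m div d"
    have d: "d > 0" "int m = d * h" using m by (auto simp: d_def h_def)
    have h0: "h > 0" using d m by (metis of_nat_0_less_iff zero_less_mult_pos)
    have plus: "h dvd int x + int r0" if x: "x \<in> S" "g x = nat d" for x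
    proof -
      have "gcd (int m) (int x - int r0) = d" using x(2) d(1) by (simp add: g_def)
      define k where "k = (int x - int r0) div d"
      have k: "int x - int r0 = d * k" "coprime h k"
        using div_gcd_coprime[of "int m" "int x - int r0"] m unfolding k_def h_def \<open>gcd _ _ = d\<close>[symmetric] by auto
      have "int m dvd (int x)\<^sup>2 - int a" "int m dvd (int r0)\<^sup>2 - int a"
        using x(1) r0 unfolding S_def square_roots_mod_def by auto
      then have "int m dvd ((int x)\<^sup>2 - int a) - ((int r0)\<^sup>2 - int a)" by (rule dvd_diff)
      also have "((int x)\<^sup>2 - int a) - ((int r0)\<^sup>2 - int a) = d * (k * (int x + int r0))"
        unfolding mult.assoc[symmetric] k(1)[symmetric] by (simp add: power2_eq_square algebra_simps)
      finally have "h dvd k * (int x + int r0)" unfolding d(2) using d(1) by (simp add: dvd_mult_cancel_left)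
      then show ?thesis using k(2) by (simp add: coprime_dvd_mult_right_iff)
    qed
    have gr: "g r = nat d" by (simp add: g_def d_def)
    have h2: "h dvd int r - int r'"
    proof -
      have "h dvd (int r + int r0) - (int r' + int r0)" using plus r gr by (intro dvd_diff) auto
      then show ?thesis by simp
    qed
    have d2: "d dvd int r - int r'"
    proof -
      have "gcd (int m) (int r' - int r0) = d" using r(3) gr d(1) by (simp add: g_def)
      then have "d dvd int r' - int r0" by auto
      moreover have "d dvd int r - int r0" by (simp add: d_def)
      ultimately have "d dvd (int r - int r0) - (int r' - int r0)" by (rule dvd_diff[rotated])
      then show ?thesis by simp
    qed
    \<comment> \<open>e divides r - r0 and r + r0, so e^2 divides 4 r0^2; it also divides d h = m,
      hence r0^2 - a. Thus e^2 divides 4 a, and squarefreeness leaves e dvd 2.\<close>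
    define e where "e = gcd d h"
    have e: "e > 0" "e dvd d" "e dvd h" using d by (auto simp: e_def)
    have "d dvd int r - int r0" by (simp add: d_def)
    with e(2) have "e dvd int r - int r0" by (rule dvd_trans)
    with dvd_trans[OF e(3) plus[OF r(1) gr]] have "e dvd (int r + int r0) - (int r - int r0)" by (rule dvd_diff)
    then have "e dvd 2 * int r0" by simp
    then have "e ^ 2 dvd (2 * int r0) ^ 2" by (rule dvd_power_same)
    moreover have "e ^ 2 dvd (int r0)\<^sup>2 - int a"
    proof -
      have "e * e dvd d * h" using e by (intro mult_dvd_mono)
      also have "d * h dvd (int r0)\<^sup>2 - int a" using r0 d by (simp add: S_def square_roots_mod_def)
      finally show ?thesis by (simp add: power2_eq_square)
    qed
    ultimately have "e ^ 2 dvd (2 * int r0) ^ 2 - 4 * ((int r0)\<^sup>2 - int a)" by (rule dvd_diff[OF _ dvd_mult])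
    then have "e ^ 2 dvd int (4 * a)" by (simp add: power_mult_distrib)
    then have "(nat e) ^ 2 dvd 4 * a" using e(1) by (metis int_dvd_int_iff nat_0_le of_nat_power order_less_imp_le)
    then have "nat e dvd 2"
    proof (cases "even (nat e)")
      case True
      then obtain k where k: "nat e = 2 * k" by blast
      then have "4 * k ^ 2 dvd 4 * a" using \<open>(nat e) ^ 2 dvd 4 * a\<close> by (simp add: power_mult_distrib)
      then have "k dvd 1" using squarefreeD[OF sf, of k] by simp
      then show ?thesis using k by simp
    next
      case False
      then have "coprime ((nat e) ^ 2) 4" using coprime_power_right_iff[of "(nat e)\<^sup>2" 2 2] by simp
      then have "(nat e) ^ 2 dvd a" using \<open>(nat e) ^ 2 dvd 4 * a\<close> by (simp add: coprime_dvd_mult_right_iff)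
      then show ?thesis using squarefreeD[OF sf, of "nat e"] by simp
    qed
    then have e2: "e dvd 2" using e(1) by (metis int_dvd_int_iff nat_0_le of_nat_numeral order_less_imp_le)
    have "int m = e * lcm d h" using d h0 gcd_mult_lcm[of d h] by (simp add: e_def)
    also have "\<dots> dvd 2 * (int r - int r')" using e2 h2 d2 by (intro mult_dvd_mono lcm_least)
    finally show ?thesis .
  qed
  have fiber: "card {r \<in> S. g r = d} \<le> 2" for d
  proof (cases "{r \<in> S. g r = d} = {}")
    case True
    show ?thesis unfolding True by simp
  next
    case False
    then obtain r where r: "r \<in> S" "g r = d" by blast
    \<comment> \<open>By \<open>two\<close>, another root of the fiber differs from r by half of m;
      the formula gives r + m/2 or r - m/2, whichever is in range.\<close>
    have "{r \<in> S. g r = d} \<subseteq> {r, (2 * r + m) mod (2 * m) div 2}"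
    proof
      fix x assume x: "x \<in> {r \<in> S. g r = d}"
      have lt: "x < m" "r < m" using x r by (auto simp: S_def square_roots_mod_def)
      have "int m dvd 2 * (int x - int r)" using two[of x r] x r by simp
      then obtain k where k: "2 * (int x - int r) = int m * k" by blast
      have "\<bar>2 * (int x - int r)\<bar> < 2 * int m" using lt by (simp add: abs_if)
      then have "\<bar>int m * k\<bar> < 2 * int m" unfolding k .
      then have "int m * \<bar>k\<bar> < int m * 2" by (simp add: abs_mult)
      then have "\<bar>k\<bar> < 2" using m by (simp only: mult_less_cancel_left_pos of_nat_0_less_iff)
      then consider "k = 0" | "k = 1" | "k = -1" by linarith
      then show "x \<in> {r, (2 * r + m) mod (2 * m) div 2}"
      proof cases
        case 2
        then have "2 * (int x - int r) = int m" using k by simp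
        then have "int (2 * r + m) = int (2 * x)" by simp
        then have "2 * r + m = 2 * x" by (simp only: of_nat_eq_iff)
        moreover have "(2 * x) mod (2 * m) = 2 * x" using lt by simp
        ultimately show ?thesis by simp
      next
        case 3
        then have "2 * (int x - int r) = - int m" using k by simp
        then have "int (2 * r + m) = int (2 * x + 2 * m)" by simp
        then have "2 * r + m = 2 * x + 2 * m" by (simp only: of_nat_eq_iff)
        then have "(2 * r + m) mod (2 * m) = (2 * x) mod (2 * m)" by simp
        also have "\<dots> = 2 * x" using lt by simp
        finally show ?thesis by simp
      qed (use k in simp)
    qed
    then have "card {r \<in> S. g r = d} \<le> card {r, (2 * r + m) mod (2 * m) div 2}" by (intro card_mono) auto
    also have "\<dots> \<le> 2" by (rule card_insert_le_m1) auto
    finally show ?thesis .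
  qed
  have "S = (\<Union>d\<in>{d. d dvd m}. {r \<in> S. g r = d})" using gd by auto
  then have "card S \<le> (\<Sum>d\<in>{d. d dvd m}. card {r \<in> S. g r = d})"
    using card_UN_le[of "{d. d dvd m}" "\<lambda>d. {r \<in> S. g r = d}"] m by simp
  also have "\<dots> \<le> (\<Sum>d\<in>{d. d dvd m}. 2)" by (intro sum_mono fiber)
  finally show ?thesis by (simp add: S_def)
qed simp

section \<open>Pell's equation by the pigeonhole principle\<close>

lemma Suc_le_two_sqrt_pow2: "real (Suc n) \<le> 2 * sqrt (2 ^ n)"
proof -
  have "(Suc n) ^ 2 \<le> 4 * 2 ^ n"
  proof (induction n)
    case (Suc n)
    show ?case
    proof (cases "n \<ge> 2")
      case True
      then have "2 * 2 \<le> n * n" by (intro mult_le_mono)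
      then have "Suc (Suc n) ^ 2 \<le> 2 * Suc n ^ 2" by (simp add: power2_eq_square)
      also have "\<dots> \<le> 4 * 2 ^ Suc n" using Suc by simp
      finally show ?thesis .
    next
      case False
      then have "n = 0 \<or> n = 1" by auto
      then show ?thesis by (auto simp: power2_eq_square)
    qed
  qed simp
  then have "real ((Suc n) ^ 2) \<le> real (4 * 2 ^ n)" by (simp only: of_nat_le_iff)
  then have "(real (Suc n))\<^sup>2 \<le> (2 * sqrt (2 ^ n))\<^sup>2" by (simp add: power_mult_distrib)
  then show ?thesis by (rule power2_le_imp_le) simp
qed

text \<open>Brahmagupta's identity: up to the sign of v, u + v sqrt a is the quotient of the two
  numbers x + y sqrt a. Divisibility of the irrational part by m suffices, since m^2 then divides
  the square of the rational part.\<close>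

lemma pell_of_congruent_pairs:
  fixes a :: nat and x1 y1 x2 y2 m :: int
  assumes norms: "x1\<^sup>2 - int a * y1\<^sup>2 = m" "x2\<^sup>2 - int a * y2\<^sup>2 = m" and m: "m \<noteq> 0"
    and dvd: "m dvd x1 * y2 - x2 * y1"
  obtains u v :: int where "u\<^sup>2 - int a * v\<^sup>2 = 1" "m * v = x1 * y2 - x2 * y1" "m * u = x1 * x2 - int a * (y1 * y2)"
proof -
  obtain v where v: "x1 * y2 - x2 * y1 = m * v" using dvd by blast
  define w where "w = x1 * x2 - int a * (y1 * y2)"
  have "w\<^sup>2 - int a * (x1 * y2 - x2 * y1)\<^sup>2 = (x1\<^sup>2 - int a * y1\<^sup>2) * (x2\<^sup>2 - int a * y2\<^sup>2)"
    unfolding w_def by (simp add: power2_eq_square algebra_simps)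
  then have w2: "w\<^sup>2 = m\<^sup>2 * (1 + int a * v\<^sup>2)" unfolding norms v by (simp add: power2_eq_square algebra_simps)
  then have "m\<^sup>2 dvd w\<^sup>2" by simp
  then obtain u where u: "w = m * u" by (auto simp: pow_divides_pow_iff)
  have "m\<^sup>2 * (u\<^sup>2 - int a * v\<^sup>2) = m\<^sup>2 * 1" using w2 unfolding u by (simp add: power_mult_distrib algebra_simps)
  then have "u\<^sup>2 - int a * v\<^sup>2 = 1" using m by (simp only: mult_cancel_left) simp
  then show thesis using that[of u v] v u by (simp add: w_def)
qed

lemma pell_solution_bound:
  assumes sf: "squarefree a" and a2: "a \<ge> 2"
  obtains x y :: nat where "x\<^sup>2 = a * y\<^sup>2 + 1" "y \<ge> 1"
    "ln (real x + real y * sqrt (real a)) \<le> 300 * sqrt (real a) * ln (real a)"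
proof -
  define s where "s = sqrt (real a)"
  have s1: "1 \<le> s" "s * s = real a" using a2 by (auto simp: s_def)
  have nsq: "\<not> is_square a"
  proof
    assume "is_square a"
    then obtain k where "a = k\<^sup>2" by (auto simp: is_nth_power_def)
    moreover from this have "k dvd 1" using squarefreeD[OF sf, of k] by simp
    ultimately show False using a2 by simp
  qed
  \<comment> \<open>An approximation with y \<le> 2^j and error below 2^(- j) has norm at most 3 s
    in absolute value.\<close>
  define B where "B = nat \<lceil>3 * s\<rceil>"
  have B: "3 * s \<le> real B" "real B \<le> 4 * s" "B > 0" using s1 unfolding B_def by linarith+
  \<comment> \<open>The indices 0 to J outnumber what the classes can hold if no class contains two
    different approximations. The 16 is a product of four factors 2: the sign of the norm, the roots
    per divisor, the recurrence bound and the divisor sum.\<close>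
  define J where "J = nat \<lceil>16 * real B * harm B\<rceil>"
  have approx: "\<exists>x y :: int. coprime x y \<and> 0 < y \<and> y \<le> 2 ^ j \<and> \<bar>of_int y * s - of_int x\<bar> < 1 / 2 ^ j" for j :: nat
    using Dirichlet_approx_coprime[of "2 ^ j" s] by (metis of_nat_numeral of_nat_power zero_less_numeral zero_less_power)
  then obtain x y :: "nat \<Rightarrow> int" where xy: "\<And>j. coprime (x j) (y j)" "\<And>j. 0 < y j" "\<And>j. y j \<le> 2 ^ j"
    "\<And>j. \<bar>of_int (y j) * s - of_int (x j)\<bar> < 1 / 2 ^ j" by metis
  define m where "m = (\<lambda>j. (x j)\<^sup>2 - int a * (y j)\<^sup>2)"
  have m0: "m j \<noteq> 0" for j
  proof
    assume "m j = 0"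
    then have "real_of_int ((x j)\<^sup>2) = real_of_int (int a * (y j)\<^sup>2)" by (simp add: m_def)
    then have "(of_int (x j))\<^sup>2 = (s * of_int (y j))\<^sup>2" using s1 by (simp add: power2_eq_square)
    then have "\<bar>of_int (x j)\<bar>\<^sup>2 = (s * of_int (y j))\<^sup>2" by simp
    then have "\<bar>of_int (x j)\<bar> = s * of_int (y j)"
      by (rule power2_eq_imp_eq) (use s1 xy(2)[of j] in auto)
    then have "s = \<bar>of_int (x j)\<bar> / of_int (y j)" using xy(2)[of j] by (simp add: field_simps)
    then have "s \<in> \<rat>" by simp
    then show False using nsq sqrt_rat_imp_square[of a] by (simp add: s_def)
  qed
  have conj: "\<bar>of_int (x j) + of_int (y j) * s\<bar> \<le> 3 * s * of_int (y j)" for j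
  proof -
    have "1 / 2 ^ j \<le> (1::real)" by simp
    then have "\<bar>of_int (x j) + of_int (y j) * s\<bar> \<le> 2 * (of_int (y j) * s) + 1"
      using xy(4)[of j] mult_nonneg_nonneg[of "of_int (y j)" s] xy(2)[of j] s1 by linarith
    moreover have "1 \<le> of_int (y j) * s" using mult_mono[of 1 "of_int (y j)" 1 s] xy(2)[of j] s1 by simp
    ultimately show ?thesis by (simp add: algebra_simps)
  qed
  have mnorm: "of_int (m j) = (of_int (x j) - of_int (y j) * s) * (of_int (x j) + of_int (y j) * s)" for j
    using s1 by (simp add: m_def power2_eq_square algebra_simps)
  \<comment> \<open>One approximation may serve several indices, but each step halves the permitted
    error while y stays fixed, so the recurrences number about log (B / |m|) at most.\<close>
  have fiber_gap: "real_of_int \<bar>m j\<bar> * 2 ^ (j' - j) \<le> real B" if "x j = x j'" "y j = y j'" "j \<le> j'" for j j'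
  proof -
    have "real_of_int \<bar>m j\<bar> = \<bar>of_int (x j) - of_int (y j) * s\<bar> * \<bar>of_int (x j) + of_int (y j) * s\<bar>"
      using arg_cong[OF mnorm[of j], of abs] by (simp add: abs_mult)
    also have "\<dots> \<le> 1 / 2 ^ j' * (3 * s * 2 ^ j)"
    proof (intro mult_mono)
      show "\<bar>of_int (x j) - of_int (y j) * s\<bar> \<le> 1 / 2 ^ j'" using xy(4)[of j'] that by (simp add: abs_minus_commute)
      have "3 * s * of_int (y j) \<le> 3 * s * of_int (2 ^ j)" using xy(3)[of j] s1 by (intro mult_left_mono) (simp_all only: of_int_le_iff)
      then show "\<bar>of_int (x j) + of_int (y j) * s\<bar> \<le> 3 * s * 2 ^ j" using conj[of j] by simp
    qed (use s1 in auto)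
    finally have "real_of_int \<bar>m j\<bar> * 2 ^ (j' - j) \<le> 1 / 2 ^ j' * (3 * s * 2 ^ j) * 2 ^ (j' - j)" by (intro mult_right_mono) auto
    also have "\<dots> = 3 * s" using that(3) by (simp add: field_simps flip: power_add)
    finally show ?thesis using B by linarith
  qed
  have mB: "\<bar>m j\<bar> \<le> int B" for j
  proof -
    have "real_of_int \<bar>m j\<bar> \<le> real_of_int (int B)" using fiber_gap[of j j] by simp
    then show ?thesis by (simp only: of_int_le_iff)
  qed
  have cop: "coprime (m j) (y j)" for j
  proof -
    have cx: "coprime (x j ^ 2) (y j)" using xy(1) by simp
    show ?thesis
    proof (rule coprimeI)
      fix d assume d: "d dvd m j" "d dvd y j"
      have "d dvd m j + int a * y j * y j" using d by (intro dvd_add) auto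
      then have "d dvd x j ^ 2" by (simp add: m_def power2_eq_square mult.assoc)
      then show "is_unit d" using coprime_common_divisor[OF cx] d(2) by blast
    qed
  qed
  \<comment> \<open>The residue is x/y mod m, available because m is coprime to y; its square is a
    because m divides x^2 - a y^2.\<close>
  have ex_r: "\<exists>r. r \<in> square_roots_mod a (nat \<bar>m j\<bar>) \<and> m j dvd y j * int r - x j" for j
  proof -
    obtain u v where uv: "u * m j + v * y j = 1" using bezout_int[of "m j" "y j"] cop[of j] by (auto simp: coprime_iff_gcd_eq_1)
    define r where "r = nat ((x j * v) mod \<bar>m j\<bar>)"
    have r: "int r = (x j * v) mod \<bar>m j\<bar>" "r < nat \<bar>m j\<bar>" using m0[of j] by (auto simp: r_def nat_less_iff)
    have "m j dvd x j * v - int r" unfolding r(1) by (metis abs_dvd_iff minus_mod_eq_mult_div dvd_triv_left)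
    then have "m j dvd - (y j * (x j * v - int r)) - m j * (u * x j)" by (intro dvd_diff) auto
    moreover have "x j * (u * m j + v * y j) = x j" using uv by simp
    then have "- (y j * (x j * v - int r)) - m j * (u * x j) = y j * int r - x j" by (simp add: algebra_simps)
    ultimately have d: "m j dvd y j * int r - x j" by simp
    have "m j dvd (y j * int r - x j) * (y j * int r + x j)" using d by simp
    also have "(y j * int r - x j) * (y j * int r + x j) = (y j)\<^sup>2 * ((int r)\<^sup>2 - int a) - m j"
      by (simp add: m_def power2_eq_square algebra_simps)
    finally have "m j dvd (y j)\<^sup>2 * ((int r)\<^sup>2 - int a) - m j + m j" by (intro dvd_add) auto
    then have "m j dvd (y j)\<^sup>2 * ((int r)\<^sup>2 - int a)" by simp
    then have "m j dvd (int r)\<^sup>2 - int a" using cop[of j] by (simp add: coprime_dvd_mult_right_iff)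
    then show ?thesis using r(2) d by (auto simp: square_roots_mod_def)
  qed
  then obtain r where r: "\<And>j. r j \<in> square_roots_mod a (nat \<bar>m j\<bar>)" "\<And>j. m j dvd y j * int (r j) - x j" by metis
  define cls where "cls = (\<lambda>j. (m j > 0, nat \<bar>m j\<bar>, r j))"
  define C where "C = (UNIV :: bool set) \<times> (SIGMA n:{1..B}. square_roots_mod a n)"
  have finC: "finite C" unfolding C_def square_roots_mod_def by (intro finite_SigmaI) auto
  have clsC: "cls j \<in> C" for j using r(1)[of j] m0[of j] mB[of j] by (auto simp: cls_def C_def Suc_le_eq nat_le_iff)
  have "\<exists>j\<le>J. \<exists>j'\<le>J. cls j = cls j' \<and> (x j \<noteq> x j' \<or> y j \<noteq> y j')"
  proof (rule ccontr)
    assume "\<not> ?thesis"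
    then have same: "x j = x j' \<and> y j = y j'" if "cls j = cls j'" "j \<le> J" "j' \<le> J" for j j' using that by blast
    \<comment> \<open>A class then consists of a single approximation, and its indices span at most
      log2 (B / |m|); the count is weakened to a square root to fit the divisor sum.\<close>
    have fiber: "real (card {j \<in> {..J}. cls j = c}) \<le> 2 * sqrt (real B / real (fst (snd c)))" if c: "c \<in> C" for c
    proof (cases "{j \<in> {..J}. cls j = c} = {}")
      case True
      show ?thesis unfolding True by simp
    next
      case False
      define S where "S = {j \<in> {..J}. cls j = c}"
      have S: "finite S" "S \<noteq> {}" using False by (auto simp: S_def)
      have mm: "Min S \<in> S" "Max S \<in> S" "Min S \<le> Max S" using S by auto
      have "S \<subseteq> {Min S..Max S}" using S by auto
      then have "card S \<le> Suc (Max S - Min S)" using card_mono[of "{Min S..Max S}" S] mm by simp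
      then have "real (card S) \<le> real (Suc (Max S - Min S))" by simp
      also have "\<dots> \<le> 2 * sqrt (2 ^ (Max S - Min S))" by (rule Suc_le_two_sqrt_pow2)
      also have "\<dots> \<le> 2 * sqrt (real B / real (fst (snd c)))"
      proof -
        have "cls i = c" if "i \<in> S" for i using that by (simp add: S_def)
        then have "c = cls (Min S)" using mm(1) by blast
        then have e: "real (fst (snd c)) = real_of_int \<bar>m (Min S)\<bar>" by (simp add: cls_def)
        have "real_of_int \<bar>m (Min S)\<bar> > 0" using m0 by simp
        moreover have "real_of_int \<bar>m (Min S)\<bar> * 2 ^ (Max S - Min S) \<le> real B"
          using mm same[of "Min S" "Max S"] by (intro fiber_gap) (auto simp: S_def)
        ultimately have "2 ^ (Max S - Min S) \<le> real B / real (fst (snd c))"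
          unfolding e by (simp add: pos_le_divide_eq mult.commute)
        then show ?thesis by simp
      qed
      finally show ?thesis by (simp add: S_def)
    qed
    have "card {..J} = (\<Sum>c\<in>C. card {j \<in> {..J}. cls j = c})"
    proof -
      have "cls ` {..J} \<subseteq> C" using clsC by blast
      from sum.group[OF _ finC this, of "\<lambda>_. 1::nat"] show ?thesis by simp
    qed
    then have "real (card {..J}) = (\<Sum>c\<in>C. real (card {j \<in> {..J}. cls j = c}))" by (simp only: of_nat_sum)
    also have "\<dots> \<le> (\<Sum>c\<in>C. 2 * sqrt (real B / real (fst (snd c))))" by (intro sum_mono fiber)
    also have "\<dots> = (\<Sum>b\<in>(UNIV :: bool set). \<Sum>c\<in>(SIGMA n:{1..B}. square_roots_mod a n). 2 * sqrt (real B / real (fst c)))"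
      unfolding C_def sum.cartesian_product by (simp add: case_prod_unfold)
    also have "\<dots> = 2 * (\<Sum>(n, \<rho>)\<in>(SIGMA n:{1..B}. square_roots_mod a n). 2 * sqrt (real B / real n))"
      by (simp add: case_prod_unfold)
    also have "\<dots> = 2 * (\<Sum>n = 1..B. real (card (square_roots_mod a n)) * (2 * sqrt (real B / real n)))"
      by (subst sum.Sigma[symmetric]) (auto simp: square_roots_mod_def)
    also have "\<dots> \<le> 2 * (\<Sum>n = 1..B. real (2 * card {u. u dvd n}) * (2 * sqrt (real B / real n)))"
    proof (intro mult_left_mono sum_mono mult_right_mono)
      fix n assume "n \<in> {1..B}"
      then have "card (square_roots_mod a n) \<le> 2 * card {u. u dvd n}" by (intro card_square_roots_mod sf) auto
      then show "real (card (square_roots_mod a n)) \<le> real (2 * card {u. u dvd n})" by (simp only: of_nat_le_iff)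
    qed auto
    also have "\<dots> = 8 * (\<Sum>n = 1..B. real (card {u. u dvd n}) * sqrt (real B / real n))"
      by (simp add: sum_distrib_left mult_ac)
    also have "\<dots> \<le> 8 * (2 * real B * harm B)" by (intro mult_left_mono sum_divisors_weighted) auto
    finally have "real (Suc J) \<le> 16 * real B * harm B" by simp
    then show False unfolding J_def by linarith
  qed
  then obtain j j' where j: "j \<le> J" "j' \<le> J" "cls j = cls j'" "x j \<noteq> x j' \<or> y j \<noteq> y j'" by blast
  have mm: "m j' = m j" "r j' = r j" using j(3) m0[of j] m0[of j'] by (auto simp: cls_def abs_if split: if_splits)
  have "m j dvd x j * y j' - x j' * y j"
  proof -
    have "m j dvd (y j' * int (r j) - x j') * y j - (y j * int (r j) - x j) * y j'"
      using r(2)[of j] r(2)[of j'] unfolding mm by (intro dvd_diff[OF dvd_mult2 dvd_mult2])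
    then show ?thesis by (simp add: algebra_simps)
  qed
  then obtain u v where uv: "u\<^sup>2 - int a * v\<^sup>2 = 1" "m j * v = x j * y j' - x j' * y j" "m j * u = x j * x j' - int a * (y j * y j')"
    using pell_of_congruent_pairs[of "x j" a "y j" "m j" "x j'" "y j'"] mm(1) m0 by (metis m_def)
  \<comment> \<open>v = 0 would equate two reduced fractions x/y with positive denominators, and the
    pairs would coincide.\<close>
  have v0: "v \<noteq> 0"
  proof
    assume "v = 0"
    then have e: "x j * y j' = x j' * y j" using uv(2) by simp
    have "y j dvd y j'" using xy(1)[of j] e by (metis coprime_commute coprime_dvd_mult_right_iff dvd_triv_right)
    moreover have "y j' dvd y j" using xy(1)[of j'] e by (metis coprime_commute coprime_dvd_mult_right_iff dvd_triv_right)
    ultimately have "y j = y j'" using xy(2)[of j] xy(2)[of j'] by (simp add: zdvd_antisym_nonneg)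
    then show False using e j(4) xy(2)[of j] by simp
  qed
  have one: "1 \<le> real_of_int \<bar>m j\<bar>" using m0[of j] by simp
  have bound: "\<bar>of_int u + of_int v * s\<bar> \<le> 3 * s * 2 ^ J" "\<bar>of_int u - of_int v * s\<bar> \<le> 3 * s * 2 ^ J"
  proof -
    have prod: "\<bar>(of_int (x k) - of_int (y k) * s) * (of_int (x l) + of_int (y l) * s)\<bar> \<le> 3 * s * 2 ^ J" if "l \<le> J" for k l
    proof -
      have "1 / 2 ^ k \<le> (1::real)" by simp
      then have 1: "\<bar>of_int (x k) - of_int (y k) * s\<bar> \<le> 1" using xy(4)[of k] by linarith
      have "y l \<le> 2 ^ J" using xy(3)[of l] power_increasing[OF that, of "2::int"] by linarith
      then have "real_of_int (y l) \<le> real_of_int (2 ^ J)" by (simp only: of_int_le_iff)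
      then have "3 * s * of_int (y l) \<le> 3 * s * 2 ^ J" using s1 by (intro mult_left_mono) auto
      then have 2: "\<bar>of_int (x l) + of_int (y l) * s\<bar> \<le> 3 * s * 2 ^ J" using conj[of l] by linarith
      show ?thesis unfolding abs_mult using mult_mono[OF 1 2] by simp
    qed
    have mu: "of_int (m j) * of_int u = of_int (x j) * of_int (x j') - s * s * (of_int (y j) * of_int (y j'))"
      "of_int (m j) * of_int v = (of_int (x j) * of_int (y j') - of_int (x j') * of_int (y j) :: real)"
      using arg_cong[OF uv(3), of real_of_int] arg_cong[OF uv(2), of real_of_int] s1 by simp_all
    have "of_int (m j) * (of_int u + of_int v * s) = (of_int (x j) - of_int (y j) * s) * (of_int (x j') + of_int (y j') * s)"
      unfolding distrib_left mult.assoc[symmetric] mu by (simp add: algebra_simps)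
    then have "real_of_int \<bar>m j\<bar> * \<bar>of_int u + of_int v * s\<bar> \<le> 3 * s * 2 ^ J"
      using prod[OF j(2), of j] by (metis abs_mult of_int_abs)
    then show "\<bar>of_int u + of_int v * s\<bar> \<le> 3 * s * 2 ^ J"
      using mult_right_mono[OF one, of "\<bar>of_int u + of_int v * s\<bar>"] by simp
    have "of_int (m j) * (of_int u - of_int v * s) = (of_int (x j') - of_int (y j') * s) * (of_int (x j) + of_int (y j) * s)"
      unfolding right_diff_distrib mult.assoc[symmetric] mu by (simp add: algebra_simps)
    then have "real_of_int \<bar>m j\<bar> * \<bar>of_int u - of_int v * s\<bar> \<le> 3 * s * 2 ^ J"
      using prod[OF j(1), of j'] by (metis abs_mult of_int_abs)
    then show "\<bar>of_int u - of_int v * s\<bar> \<le> 3 * s * 2 ^ J"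
      using mult_right_mono[OF one, of "\<bar>of_int u - of_int v * s\<bar>"] by simp
  qed
  define U where "U = nat \<bar>u\<bar>"
  define V where "V = nat \<bar>v\<bar>"
  have "int (U\<^sup>2) = int (a * V\<^sup>2 + 1)" using uv(1) by (simp add: U_def V_def)
  then have UV: "U\<^sup>2 = a * V\<^sup>2 + 1" by (simp only: of_nat_eq_iff)
  have V1: "V \<ge> 1" using v0 by (simp add: V_def)
  \<comment> \<open>Taking absolute values selects the larger conjugate, which is why both were
    bounded.\<close>
  have "real U + real V * s = max \<bar>of_int u + of_int v * s\<bar> \<bar>of_int u - of_int v * s\<bar>"
  proof -
    have "\<bar>p\<bar> + \<bar>q\<bar> = max \<bar>p + q\<bar> \<bar>p - q\<bar>" for p q :: real by (auto simp: abs_if max_def)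
    from this[of "of_int u" "of_int v * s"] show ?thesis using s1 by (simp add: U_def V_def abs_mult)
  qed
  then have le: "real U + real V * s \<le> 3 * s * 2 ^ J" using bound by simp
  have pos: "0 < real U + real V * s" using V1 s1 by (intro add_nonneg_pos mult_pos_pos) auto
  have "ln (real U + real V * s) \<le> ln (3 * s * 2 ^ J)" using pos le by (subst ln_le_cancel_iff) auto
  also have "\<dots> = ln 3 + ln s + real J * ln 2" using s1 by (simp add: ln_mult ln_realpow)
  finally have l1: "ln (real U + real V * s) \<le> ln 3 + ln s + real J * ln 2" .
  define l where "l = ln (real a)"
  have lns: "ln s = l / 2" using a2 by (simp add: s_def l_def ln_sqrt)
  have l2: "ln 2 \<le> l" using a2 by (simp add: l_def)
  have ln2: "1 / 2 \<le> ln (2::real)" using ln_ge_iff[of 2 "1/2"] exp_bound[of "1/2::real"] by (simp add: power2_eq_square)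
  have ln4: "ln (4::real) = 2 * ln 2" using ln_mult[of 2 "2::real"] by simp
  have ln3: "ln (3::real) \<le> ln 4" by simp
  have "harm B \<le> 1 + ln (real B)" by (rule harm_le_ln[OF B(3)])
  also have "ln (real B) \<le> ln (4 * s)" using B by (subst ln_le_cancel_iff) auto
  also have "ln (4 * s) = ln 4 + ln s" using s1 by (simp add: ln_mult)
  finally have hB: "harm B \<le> 9 / 2 * l" using ln4 lns l2 ln2 by linarith
  \<comment> \<open>This is 288 s l; the logarithm of 3 s and the rounding fit into the remaining 12
    s l.\<close>
  have "16 * real B * harm B \<le> 16 * (4 * s) * (9 / 2 * l)"
    using B hB s1 harm_nonneg[of B] by (intro mult_mono) auto
  then have J: "real J \<le> 288 * (s * l) + 1" using harm_nonneg[of B, where 'a = real] unfolding J_def by (simp add: mult_ac) linarith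
  have "real J * ln 2 \<le> real J * 1" using ln_2_less_1 by (intro mult_left_mono) auto
  moreover have "l \<le> s * l" using s1 l2 ln2 mult_right_mono[of 1 s l] by simp
  ultimately have "ln (real U + real V * s) \<le> 300 * (s * l)" using l1 J lns ln3 ln4 l2 ln2 by linarith
  then show thesis using that[OF UV V1] by (simp add: s_def l_def mult.assoc)
qed

section \<open>Units of real quadratic fields\<close>

definition quad_field :: "real \<Rightarrow> real set" where
  "quad_field \<delta> = {x + y * \<delta> | x y. x \<in> \<rat> \<and> y \<in> \<rat>}"

lemma quad_fieldI: "x \<in> \<rat> \<Longrightarrow> y \<in> \<rat> \<Longrightarrow> x + y * \<delta> \<in> quad_field \<delta>"
  unfolding quad_field_def by blast

lemma quad_fieldE:
  assumes "z \<in> quad_field \<delta>"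
  obtains x y where "x \<in> \<rat>" "y \<in> \<rat>" "z = x + y * \<delta>"
  using assms unfolding quad_field_def by blast

lemma irrational_coordinates_zero:
  fixes \<delta> x y :: real
  assumes "\<delta> \<notin> \<rat>" "x \<in> \<rat>" "y \<in> \<rat>" "x + y * \<delta> = 0"
  shows "x = 0 \<and> y = 0"
proof (cases "y = 0")
  case False
  moreover have "\<delta> * y = - x" using assms(4) by (simp add: mult.commute)
  ultimately have "\<delta> = - x / y" by (simp only: nonzero_eq_divide_eq not_False_eq_True)
  then have "\<delta> \<in> \<rat>" using assms(2,3) by simp
  then show ?thesis using assms(1) by simp
qed (use assms in simp)

lemma quad_field_add:
  assumes "z \<in> quad_field \<delta>" "w \<in> quad_field \<delta>"
  shows "z + w \<in> quad_field \<delta>"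
proof -
  obtain x y where z: "x \<in> \<rat>" "y \<in> \<rat>" "z = x + y * \<delta>" using assms(1) by (rule quad_fieldE)
  obtain x' y' where w: "x' \<in> \<rat>" "y' \<in> \<rat>" "w = x' + y' * \<delta>" using assms(2) by (rule quad_fieldE)
  have eq: "z + w = (x + x') + (y + y') * \<delta>" using z w by (simp add: algebra_simps)
  show ?thesis unfolding eq using z w by (intro quad_fieldI Rats_add)
qed

lemma quad_field_mult:
  assumes \<delta>: "\<delta> * \<delta> \<in> \<rat>" and "z \<in> quad_field \<delta>" "w \<in> quad_field \<delta>"
  shows "z * w \<in> quad_field \<delta>"
proof -
  obtain x y where z: "x \<in> \<rat>" "y \<in> \<rat>" "z = x + y * \<delta>" using assms(2) by (rule quad_fieldE)
  obtain x' y' where w: "x' \<in> \<rat>" "y' \<in> \<rat>" "w = x' + y' * \<delta>" using assms(3) by (rule quad_fieldE)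
  have eq: "z * w = (x * x' + y * y' * (\<delta> * \<delta>)) + (x * y' + y * x') * \<delta>" using z w by (simp add: algebra_simps)
  show ?thesis unfolding eq using \<delta> z w by (intro quad_fieldI Rats_add) auto
qed

lemma quad_field_inverse:
  assumes \<delta>: "\<delta> * \<delta> \<in> \<rat>" "\<delta> \<notin> \<rat>" and "z \<in> quad_field \<delta>"
  shows "inverse z \<in> quad_field \<delta>"
proof (cases "z = 0")
  case False
  obtain x y where z: "x \<in> \<rat>" "y \<in> \<rat>" "z = x + y * \<delta>" using assms(3) by (rule quad_fieldE)
  define n where "n = x * x - y * y * (\<delta> * \<delta>)"
  define w where "w = x + (- y) * \<delta>"
  have n: "n = z * w" using z by (simp add: w_def n_def algebra_simps)
  have "w \<noteq> 0" using irrational_coordinates_zero[OF \<delta>(2) z(1), of "- y"] z False by (auto simp: w_def)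
  then have "inverse z = w / n" using False unfolding n by (simp add: inverse_eq_divide)
  also have "\<dots> = x / n + (- y / n) * \<delta>" by (simp add: w_def diff_divide_distrib)
  finally have eq: "inverse z = x / n + (- y / n) * \<delta>" .
  have "n \<in> \<rat>" unfolding n_def using z \<delta> by simp
  then show ?thesis unfolding eq using z by (intro quad_fieldI Rats_divide) auto
qed (use quad_fieldI[of 0 0 \<delta>] in simp)

lemma ring_of_reals:
  "carrier (ring_of_type_algebra :: real ring) = UNIV" "\<zero>\<^bsub>(ring_of_type_algebra :: real ring)\<^esub> = 0"
  "\<one>\<^bsub>(ring_of_type_algebra :: real ring)\<^esub> = 1"
  "x \<otimes>\<^bsub>(ring_of_type_algebra :: real ring)\<^esub> y = x * y" "x \<oplus>\<^bsub>(ring_of_type_algebra :: real ring)\<^esub> y = x + y"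
  by (simp_all add: ring_of_type_algebra_def)

lemma ring_of_reals_inv:
  "\<ominus>\<^bsub>(ring_of_type_algebra :: real ring)\<^esub> x = - x"
  "x \<noteq> 0 \<Longrightarrow> inv\<^bsub>(ring_of_type_algebra :: real ring)\<^esub> x = inverse x"
proof -
  interpret K: field "ring_of_type_algebra :: real ring" by (rule field_from_type_algebra)
  show "\<ominus>\<^bsub>(ring_of_type_algebra :: real ring)\<^esub> x = - x"
    by (rule K.minus_equality) (simp_all add: ring_of_reals)
  show "inv\<^bsub>(ring_of_type_algebra :: real ring)\<^esub> x = inverse x" if "x \<noteq> 0"
    by (rule K.comm_inv_char) (use that in \<open>simp_all add: ring_of_reals\<close>)
qed

lemma adjoin_Q_eq_quad_field:
  assumes \<delta>: "\<delta> * \<delta> \<in> \<rat>" "\<delta> \<notin> \<rat>" and \<xi>: "\<xi> = x0 + y0 * \<delta>" "x0 \<in> \<rat>" "y0 \<in> \<rat>" "y0 \<noteq> 0"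
  shows "adjoin_Q \<xi> = quad_field \<delta>"
proof (rule equalityI)
  have one: "1 \<in> quad_field \<delta>" using quad_fieldI[of 1 0 \<delta>] by simp
  have minus: "- z \<in> quad_field \<delta>" if "z \<in> quad_field \<delta>" for z
    using quad_field_mult[OF \<delta>(1) quad_fieldI[of "- 1" 0 \<delta>] that] by simp
  have "z \<in> quad_field \<delta>" if "z \<in> generate_field (ring_of_type_algebra :: real ring) {\<xi>}" for z
    using that
  proof (rule generate_field.induct)
    show "\<one>\<^bsub>(ring_of_type_algebra :: real ring)\<^esub> \<in> quad_field \<delta>" unfolding ring_of_reals by (rule one)
    show "h \<in> quad_field \<delta>" if "h \<in> {\<xi>}" for h using that quad_fieldI[OF \<xi>(2,3)] \<xi>(1) by simp
    show "\<ominus>\<^bsub>(ring_of_type_algebra :: real ring)\<^esub> h \<in> quad_field \<delta>" if "h \<in> quad_field \<delta>" for h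
      unfolding ring_of_reals_inv by (rule minus[OF that])
    show "inv\<^bsub>(ring_of_type_algebra :: real ring)\<^esub> h \<in> quad_field \<delta>"
      if "h \<in> quad_field \<delta>" "h \<noteq> \<zero>\<^bsub>(ring_of_type_algebra :: real ring)\<^esub>" for h
      using quad_field_inverse[OF \<delta> that(1)] that(2) by (simp add: ring_of_reals ring_of_reals_inv)
    show "h \<oplus>\<^bsub>(ring_of_type_algebra :: real ring)\<^esub> k \<in> quad_field \<delta>" if "h \<in> quad_field \<delta>" "k \<in> quad_field \<delta>" for h k
      unfolding ring_of_reals by (rule quad_field_add[OF that])
    show "h \<otimes>\<^bsub>(ring_of_type_algebra :: real ring)\<^esub> k \<in> quad_field \<delta>" if "h \<in> quad_field \<delta>" "k \<in> quad_field \<delta>" for h k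
      unfolding ring_of_reals by (rule quad_field_mult[OF \<delta>(1) that])
  qed
  then show "adjoin_Q \<xi> \<subseteq> quad_field \<delta>" unfolding adjoin_Q_def by blast
  have g1: "1 \<in> adjoin_Q \<xi>"
    using generate_field.one[of "ring_of_type_algebra :: real ring" "{\<xi>}"] by (simp add: adjoin_Q_def ring_of_reals)
  have g\<xi>: "\<xi> \<in> adjoin_Q \<xi>" by (simp add: adjoin_Q_def generate_field.incl)
  have gminus: "- z \<in> adjoin_Q \<xi>" if "z \<in> adjoin_Q \<xi>" for z
    using generate_field.a_inv[of z "ring_of_type_algebra :: real ring" "{\<xi>}"] that by (simp add: adjoin_Q_def ring_of_reals_inv)
  have ginv: "inverse z \<in> adjoin_Q \<xi>" if "z \<in> adjoin_Q \<xi>" "z \<noteq> 0" for z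
    using generate_field.m_inv[of z "ring_of_type_algebra :: real ring" "{\<xi>}"] that by (simp add: adjoin_Q_def ring_of_reals_inv ring_of_reals)
  have gadd: "z + w \<in> adjoin_Q \<xi>" if "z \<in> adjoin_Q \<xi>" "w \<in> adjoin_Q \<xi>" for z w
    using generate_field.eng_add[of z "ring_of_type_algebra :: real ring" "{\<xi>}" w] that by (simp add: adjoin_Q_def ring_of_reals)
  have gmult: "z * w \<in> adjoin_Q \<xi>" if "z \<in> adjoin_Q \<xi>" "w \<in> adjoin_Q \<xi>" for z w
    using generate_field.eng_mult[of z "ring_of_type_algebra :: real ring" "{\<xi>}" w] that by (simp add: adjoin_Q_def ring_of_reals)
  have g0: "0 \<in> adjoin_Q \<xi>" using gadd[OF g1 gminus[OF g1]] by simp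
  have gnat: "real n \<in> adjoin_Q \<xi>" for n by (induction n) (auto intro: gadd g1 g0)
  have gint: "of_int k \<in> adjoin_Q \<xi>" for k by (cases k rule: int_cases2) (auto intro: gnat gminus)
  have grat: "r \<in> adjoin_Q \<xi>" if "r \<in> \<rat>" for r
  proof -
    obtain k l :: int where "r = of_int k / of_int l" "l > 0" using \<open>r \<in> \<rat>\<close> by (auto elim: Rats_cases')
    then show ?thesis using gmult[OF gint[of k] ginv[OF gint[of l]]] by (simp add: divide_inverse)
  qed
  have "(\<xi> + - x0) * inverse y0 \<in> adjoin_Q \<xi>" using \<xi>(2,3) by (intro gmult gadd g\<xi> grat) auto
  moreover have "(\<xi> + - x0) * inverse y0 = \<delta>" using \<xi>(1,4) by simp
  ultimately have g\<delta>: "\<delta> \<in> adjoin_Q \<xi>" by (simp only:)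
  show "quad_field \<delta> \<subseteq> adjoin_Q \<xi>"
    by (auto elim!: quad_fieldE intro: gadd gmult grat g\<delta>)
qed

section \<open>Integral quadratic polynomials and integrality\<close>

lemma clear_denominators:
  assumes "p \<in> \<rat>" "q \<in> \<rat>"
  obtains a b c :: int where "a \<noteq> 0" "gcd a (gcd b c) = 1" "of_int b = of_int a * (p :: real)" "of_int c = of_int a * (q :: real)"
proof -
  obtain p1 p2 :: int where p: "p = of_int p1 / of_int p2" "p2 > 0" using assms(1) by (auto elim: Rats_cases')
  obtain q1 q2 :: int where q: "q = of_int q1 / of_int q2" "q2 > 0" using assms(2) by (auto elim: Rats_cases')
  define A where "A = p2 * q2"
  define B where "B = p1 * q2"
  define C where "C = q1 * p2"
  define g where "g = gcd A (gcd B C)"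
  have A: "A \<noteq> 0" using p q by (simp add: A_def)
  then have g: "g \<noteq> 0" by (simp add: g_def)
  have dvd: "g dvd A" "g dvd B" "g dvd C" by (auto simp: g_def intro: dvd_trans[OF gcd_dvd2])
  then obtain a b c where abc: "A = g * a" "B = g * b" "C = g * c" by (auto elim!: dvdE)
  have g0: "g > 0" using A by (simp add: g_def)
  have "g = gcd (g * a) (gcd (g * b) (g * c))" using g_def unfolding abc .
  also have "\<dots> = g * gcd a (gcd b c)" using g0 by (simp add: gcd_mult_left)
  finally have "gcd a (gcd b c) = 1" using g0 by simp
  moreover have "of_int b = of_int a * p" "of_int c = of_int a * q"
  proof -
    have "of_int B = of_int A * p" "of_int C = of_int A * q" using p q by (simp_all add: A_def B_def C_def)
    then show "of_int b = of_int a * p" "of_int c = of_int a * q" unfolding abc of_int_mult using g by simp_all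
  qed
  ultimately show thesis using that[of a b c] A abc by simp
qed

lemma quadratic_number_code:
  assumes "quadratic_number \<xi>"
  obtains a b c where "quadratic_code (a, b, c) \<xi>" "sqrt (of_int (b\<^sup>2 - 4 * a * c)) \<notin> \<rat>"
proof -
  obtain P :: "rat poly" where P: "Factorial_Ring.irreducible P" "Polynomial.degree P = 2" "poly (map_poly of_rat P) \<xi> = 0"
    using assms unfolding quadratic_number_def by blast
  have irr: "\<xi> \<notin> \<rat>"
  proof
    assume "\<xi> \<in> \<rat>"
    then obtain r where r: "\<xi> = of_rat r" by (elim Rats_cases)
    have "of_rat (poly P r) = poly (map_poly of_rat P) (of_rat r :: real)" by (induction P) (simp_all add: map_poly_pCons of_rat_add of_rat_mult)
    then have "poly P r = 0" using P(3) r by simp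
    then obtain Q where Q: "P = [:- r, 1:] * Q" unfolding poly_eq_0_iff_dvd by (elim dvdE)
    then have "Q \<noteq> 0" using P(2) by auto
    then have "Polynomial.degree Q = 1" using P(2) unfolding Q by (subst (asm) degree_mult_eq) auto
    moreover have "[:- r, 1:] dvd 1 \<or> Q dvd 1" using Factorial_Ring.irreducibleD[OF P(1) Q] .
    ultimately show False using \<open>Q \<noteq> 0\<close> by (auto simp: is_unit_iff_degree)
  qed
  define p0 p1 p2 where "p0 = poly.coeff P 0" and "p1 = poly.coeff P 1" and "p2 = poly.coeff P 2"
  have p2: "p2 \<noteq> 0" using P(2) by (metis leading_coeff_0_iff degree_0 p2_def zero_neq_numeral)
  have e: "poly (map_poly of_rat P) \<xi> = of_rat p0 + of_rat p1 * \<xi> + of_rat p2 * \<xi>\<^sup>2"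
    using P(2) by (simp add: poly_altdef degree_map_poly coeff_map_poly numeral_2_eq_2 p0_def p1_def p2_def)
  have quot: "of_rat p2 * of_rat (q / p2) = (of_rat q :: real)" for q using p2 by (simp flip: of_rat_mult)
  have "of_rat p2 * (\<xi>\<^sup>2 + of_rat (p1 / p2) * \<xi> + of_rat (p0 / p2)) = of_rat p0 + of_rat p1 * \<xi> + of_rat p2 * \<xi>\<^sup>2"
    by (simp add: distrib_left mult.assoc[symmetric] quot)
  then have root: "\<xi>\<^sup>2 + of_rat (p1 / p2) * \<xi> + of_rat (p0 / p2) = 0"
    using P(3) p2 unfolding e by simp
  obtain a b c :: int where abc: "a \<noteq> 0" "gcd a (gcd b c) = 1" "of_int b = of_int a * (of_rat (p1 / p2) :: real)"
    "of_int c = of_int a * (of_rat (p0 / p2) :: real)"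
    using clear_denominators[OF Rats_of_rat Rats_of_rat] by metis
  have "of_int a * \<xi>\<^sup>2 + of_int b * \<xi> + of_int c = of_int a * (\<xi>\<^sup>2 + of_rat (p1 / p2) * \<xi> + of_rat (p0 / p2))"
    unfolding abc by (simp add: algebra_simps)
  then have r0: "of_int a * \<xi>\<^sup>2 + of_int b * \<xi> + of_int c = 0" unfolding root by simp
  define D where "D = b\<^sup>2 - 4 * a * c"
  have sq: "(2 * of_int a * \<xi> + of_int b)\<^sup>2 = of_int D + 4 * of_int a * (of_int a * \<xi>\<^sup>2 + of_int b * \<xi> + of_int c)"
    unfolding D_def by (simp add: power2_eq_square algebra_simps)
  have "0 \<le> real_of_int D" using sq unfolding r0 by (metis mult_zero_right add_0_right zero_le_power2)
  then have D0': "0 \<le> D" by simp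
  have sD: "\<bar>2 * of_int a * \<xi> + of_int b\<bar> = sqrt (of_int D)" using sq unfolding r0 by (metis add_0_right mult_zero_right real_sqrt_abs)
  have irrD: "sqrt (of_int D) \<notin> \<rat>"
  proof
    assume "sqrt (of_int D) \<in> \<rat>"
    moreover have "2 * of_int a * \<xi> + of_int b = sqrt (of_int D) \<or> 2 * of_int a * \<xi> + of_int b = - sqrt (of_int D)"
      using sD by linarith
    ultimately have "2 * of_int a * \<xi> + of_int b \<in> \<rat>" by (metis Rats_minus_iff)
    then have "(2 * of_int a * \<xi> + of_int b - of_int b) / (2 * of_int a) \<in> \<rat>" by (intro Rats_divide Rats_diff Rats_mult) auto
    then show False using irr abc(1) by simp
  qed
  show thesis
  proof (cases "2 * of_int a * \<xi> + of_int b \<ge> 0")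
    case True
    then have "\<xi> = (- of_int b + sqrt (of_int D)) / (2 * of_int a)" using sD abc(1) by (simp add: field_simps)
    then show thesis using that[of a b c] abc(1,2) D0' irrD by (simp add: quadratic_code_def D_def)
  next
    case False
    \<comment> \<open>Negating all coefficients exchanges the roots in the formula for the
      code.\<close>
    then have "\<xi> = (- of_int (- b) + sqrt (of_int D)) / (2 * of_int (- a))" using sD abc(1) by (simp add: field_simps)
    then show thesis using that[of "- a" "- b" "- c"] abc(1,2) D0' irrD by (simp add: quadratic_code_def D_def)
  qed
qed

text \<open>Gauss's lemma by pseudo-division of a monic P by the quadratic: the remainder is linear
  and vanishes at an irrational number, so it is 0. Comparing contents shows that the quotient is
  divisible by the power of a, hence P is an integral multiple of the quadratic and a divides its
  leading coefficient 1.\<close>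

lemma algebraic_int_primitive_quadratic:
  fixes \<alpha> :: real and a b c :: int
  assumes \<alpha>: "algebraic_int \<alpha>" "\<alpha> \<notin> \<rat>" and root: "of_int a * \<alpha>\<^sup>2 + of_int b * \<alpha> + of_int c = 0"
    and gcd: "gcd a (gcd b c) = 1"
  shows "a dvd 1"
proof -
  obtain P where P: "poly (map_poly of_int P) \<alpha> = 0" "lead_coeff P = (1::int)"
    using \<alpha>(1) unfolding algebraic_int_altdef_ipoly by blast
  have lin: "k = 0 \<and> l = 0" if "of_int k + of_int l * \<alpha> = 0" for k l :: int
    using irrational_coordinates_zero[OF \<alpha>(2) _ _ that] by simp
  have a0: "a \<noteq> 0"
  proof
    assume "a = 0"
    then have "b = 0" "c = 0" using lin[of c b] root by (auto simp: add.commute)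
    then show False using \<open>a = 0\<close> gcd by simp
  qed
  define q where "q = [:c, b, a:]"
  have q: "q \<noteq> 0" "Polynomial.degree q = 2" "lead_coeff q = a" using a0 by (auto simp: q_def)
  have cq: "Polynomial.content q = 1" using gcd by (simp add: q_def Polynomial.content_def cCons_def a0 gcd.commute gcd.left_commute)
  obtain g r where gr: "pseudo_divmod P q = (g, r)" by (cases "pseudo_divmod P q")
  define e where "e = Suc (Polynomial.degree P) - Polynomial.degree q"
  have div: "smult (a ^ e) P = q * g + r" "r = 0 \<or> Polynomial.degree r < 2"
    using pseudo_divmod[OF q(1) gr] q by (auto simp: e_def)
  define ev where "ev = (\<lambda>p :: int poly. poly (map_poly of_int p) \<alpha>)"
  have ev: "ev (p + p') = ev p + ev p'" "ev (p * p') = ev p * ev p'" "ev (smult k p) = of_int k * ev p" for p p' k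
  proof -
    have pC: "ev (pCons k p) = of_int k + \<alpha> * ev p" for k p by (simp add: ev_def map_poly_pCons)
    have e0: "ev 0 = 0" by (simp add: ev_def)
    show add: "ev (p + p') = ev p + ev p'" for p p'
    proof (induction p arbitrary: p')
      case (pCons k p)
      then show ?case by (cases p') (simp add: pC algebra_simps)
    qed (simp add: e0)
    show sm: "ev (smult k p) = of_int k * ev p" for p k by (induction p) (simp_all add: e0 pC algebra_simps)
    show "ev (p * p') = ev p * ev p'" for p p' by (induction p) (simp_all add: e0 pC add sm algebra_simps)
  qed
  have "ev q = 0" using root by (simp add: ev_def q_def map_poly_pCons power2_eq_square algebra_simps)
  then have evr: "ev r = 0" using arg_cong[OF div(1), of ev] P(1) by (simp add: ev) (simp add: ev_def)
  have "r = 0"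
  proof (rule ccontr)
    assume "r \<noteq> 0"
    then have "r = [:poly.coeff r 0, poly.coeff r 1:]"
      using div(2) by (intro poly_eqI) (auto simp: coeff_pCons coeff_eq_0 split: nat.splits)
    then obtain k l where kl: "r = [:k, l:]" by blast
    then have "of_int k + of_int l * \<alpha> = 0" using evr by (simp add: ev_def map_poly_pCons algebra_simps)
    then show False using lin kl \<open>r \<noteq> 0\<close> by simp
  qed
  then have eq: "smult (a ^ e) P = q * g" using div(1) by simp
  have "Polynomial.content P dvd 1" using content_dvd_coeff[of P "Polynomial.degree P"] P(2) by simp
  then have "a ^ e dvd Polynomial.content (q * g)" unfolding eq[symmetric] by simp
  then have "a ^ e dvd Polynomial.content g" by (simp add: content_mult cq)
  then obtain g' where g': "g = smult (a ^ e) g'"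
    unfolding const_poly_dvd_iff_dvd_content[symmetric] by (auto elim!: dvdE)
  have "smult (a ^ e) P = smult (a ^ e) (q * g')" using eq g' by simp
  then have "P = q * g'" using a0 by (metis smult_cancel power_not_zero)
  then have "lead_coeff P = a * lead_coeff g'" using q(3) by (simp add: lead_coeff_mult)
  then show ?thesis using P(2) by (metis dvd_triv_left)
qed

text \<open>
  For integral \<open>\<delta>\<^sup>2\<close> these are the units of the ring of integers: trace \<open>2 x\<close> and norm are integers, so that
  no separate condition on \<open>y\<close> is needed.
\<close>

definition quad_units :: "real \<Rightarrow> real set" where
  "quad_units \<delta> = {x + y * \<delta> | x y. x \<in> \<rat> \<and> y \<in> \<rat> \<and> 2 * x \<in> \<int> \<and> (x\<^sup>2 - y\<^sup>2 * \<delta>\<^sup>2 = 1 \<or> x\<^sup>2 - y\<^sup>2 * \<delta>\<^sup>2 = - 1)}"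

lemma algebraic_int_monic_quadratic:
  fixes u :: real
  assumes "u\<^sup>2 + of_int b * u + of_int c = 0"
  shows "algebraic_int u"
proof (rule algebraic_int.intros)
  show "lead_coeff [:of_int c, of_int b, 1 :: real:] = 1" by simp
  show "\<forall>i. poly.coeff [:of_int c, of_int b, 1 :: real:] i \<in> \<int>" by (auto simp: coeff_pCons split: nat.splits)
  show "poly [:of_int c, of_int b, 1:] u = 0" using assms by (simp add: power2_eq_square algebra_simps)
qed

lemma quad_units_conj:
  fixes x y \<delta> :: real
  assumes "x\<^sup>2 - y\<^sup>2 * \<delta>\<^sup>2 = n" "n = 1 \<or> n = - 1"
  shows "inverse (x + y * \<delta>) = n * (x - y * \<delta>)"
proof (rule inverse_unique)
  have "(x + y * \<delta>) * (n * (x - y * \<delta>)) = n * (x\<^sup>2 - y\<^sup>2 * \<delta>\<^sup>2)" by (simp add: power2_eq_square algebra_simps)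
  also have "\<dots> = 1" unfolding assms(1) using assms(2) by auto
  finally show "(x + y * \<delta>) * (n * (x - y * \<delta>)) = 1" .
qed

lemma quad_units_nonzero: "u \<in> quad_units \<delta> \<Longrightarrow> u \<noteq> 0"
proof
  assume "u \<in> quad_units \<delta>" "u = 0"
  then obtain x y where "x + y * \<delta> = 0" "x\<^sup>2 - y\<^sup>2 * \<delta>\<^sup>2 = 1 \<or> x\<^sup>2 - y\<^sup>2 * \<delta>\<^sup>2 = - 1" unfolding quad_units_def by auto
  moreover have "x\<^sup>2 - y\<^sup>2 * \<delta>\<^sup>2 = (x + y * \<delta>) * (x - y * \<delta>)" by (simp add: power2_eq_square algebra_simps)
  ultimately show False by simp
qed

lemma integer_units_quad_field:
  assumes \<delta>: "\<delta>\<^sup>2 = of_int D" "\<delta> \<notin> \<rat>"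
  shows "integer_units (quad_field \<delta>) = quad_units \<delta>"
proof (intro equalityI subsetI)
  fix u assume "u \<in> integer_units (quad_field \<delta>)"
  then have u: "u \<in> quad_field \<delta>" "u \<noteq> 0" "algebraic_int u" "algebraic_int (inverse u)" by (auto simp: integer_units_def)
  obtain x y where xy: "x \<in> \<rat>" "y \<in> \<rat>" "u = x + y * \<delta>" using u(1) by (rule quad_fieldE)
  show "u \<in> quad_units \<delta>"
  proof (cases "y = 0")
    case True
    then have "u \<in> \<rat>" using xy by simp
    then have "u \<in> \<int>" "inverse u \<in> \<int>"
      using rational_algebraic_int_is_int[OF u(3)] rational_algebraic_int_is_int[OF u(4) Rats_inverse] by blast+
    then obtain k l where kl: "u = of_int k" "inverse u = of_int l" by (auto elim!: Ints_cases)
    then have "of_int (k * l) = (1 :: real)" using u(2) by (metis of_int_mult right_inverse)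
    then have "k * l = 1" by (metis of_int_eq_1_iff)
    then have "k = 1 \<or> k = - 1" by (auto simp: zmult_eq_1_iff)
    then have "x = 1 \<or> x = - 1" using kl xy True by auto
    then have "2 * x \<in> \<int>" "x\<^sup>2 - y\<^sup>2 * \<delta>\<^sup>2 = 1" using True by auto
    then show ?thesis unfolding quad_units_def using xy by blast
  next
    case False
    have irr: "u \<notin> \<rat>"
    proof
      assume "u \<in> \<rat>"
      then have "(u - x) / y \<in> \<rat>" using xy(1,2) by (intro Rats_divide Rats_diff)
      moreover have "(u - x) / y = \<delta>" using xy(3) False by simp
      ultimately show False using \<delta>(2) by simp
    qed
    define s where "s = - 2 * x"
    define n where "n = x\<^sup>2 - y\<^sup>2 * \<delta>\<^sup>2"
    have rats: "s \<in> \<rat>" "n \<in> \<rat>" using xy \<delta>(1) by (auto simp: s_def n_def)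
    have root: "u\<^sup>2 + s * u + n = 0" unfolding xy s_def n_def by (simp add: power2_eq_square algebra_simps)
    obtain a b c where abc: "a \<noteq> 0" "gcd a (gcd b c) = 1" "of_int b = of_int a * s" "of_int c = of_int a * n"
      using clear_denominators[OF rats] by metis
    have r1: "of_int a * u\<^sup>2 + of_int b * u + of_int c = 0"
      using arg_cong[OF root, of "\<lambda>z. of_int a * z"] unfolding abc by (simp add: algebra_simps)
    have "a dvd 1" using algebraic_int_primitive_quadratic[OF u(3) irr r1 abc(2)] .
    \<comment> \<open>The reversed polynomial belongs to 1/u, so integrality of the inverse makes c
      a unit too, and the norm c / a is 1 or -1.\<close>
    have r2: "of_int c * (inverse u)\<^sup>2 + of_int b * inverse u + of_int a = 0"
    proof -
      have "of_int c * (inverse u)\<^sup>2 + of_int b * inverse u + of_int a = (of_int a * u\<^sup>2 + of_int b * u + of_int c) * (inverse u)\<^sup>2"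
        using u(2) by (simp add: power2_eq_square field_simps)
      then show ?thesis unfolding r1 by simp
    qed
    have "inverse u \<notin> \<rat>" using irr by (metis Rats_inverse inverse_inverse_eq)
    moreover have "gcd c (gcd b a) = 1" using abc(2) by (simp add: gcd.commute gcd.left_commute)
    ultimately have "c dvd 1" by (rule algebraic_int_primitive_quadratic[OF u(4) _ r2])
    then have "\<bar>c\<bar> = 1" "\<bar>a\<bar> = 1" using \<open>a dvd 1\<close> by auto
    then have ac: "a = 1 \<or> a = - 1" "c = 1 \<or> c = - 1" by auto
    then have "s = of_int b \<or> s = - of_int b" using abc(3) by auto
    then have "2 * x = of_int b \<or> 2 * x = of_int (- b)" by (auto simp: s_def)
    then have "2 * x \<in> \<int>" by (metis Ints_of_int)
    moreover have "n = 1 \<or> n = - 1" using abc(4) ac by auto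
    ultimately show ?thesis unfolding quad_units_def n_def using xy by blast
  qed
next
  fix u assume "u \<in> quad_units \<delta>"
  then obtain x y where xy: "x \<in> \<rat>" "y \<in> \<rat>" "u = x + y * \<delta>" "2 * x \<in> \<int>" "x\<^sup>2 - y\<^sup>2 * \<delta>\<^sup>2 = 1 \<or> x\<^sup>2 - y\<^sup>2 * \<delta>\<^sup>2 = - 1"
    unfolding quad_units_def by blast
  define n where "n = x\<^sup>2 - y\<^sup>2 * \<delta>\<^sup>2"
  have n: "n = 1 \<or> n = - 1" using xy by (simp add: n_def)
  obtain t where t: "2 * x = of_int t" using xy(4) by (elim Ints_cases)
  obtain k where k: "n = of_int k" using n by (metis of_int_1 of_int_minus)
  have inv: "inverse u = n * (x - y * \<delta>)" unfolding xy using quad_units_conj[OF n_def[symmetric] n] .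
  have "u\<^sup>2 + of_int (- t) * u + of_int k = 0"
    unfolding k[symmetric] of_int_minus t[symmetric] xy n_def by (simp add: power2_eq_square algebra_simps)
  then have "algebraic_int u" by (rule algebraic_int_monic_quadratic)
  moreover have "algebraic_int (inverse u)"
  proof (rule algebraic_int_monic_quadratic)
    have "n * n = 1" using n by auto
    have "(inverse u)\<^sup>2 + of_int (- t * k) * inverse u + of_int k = n * n * (x - y * \<delta>)\<^sup>2 - 2 * x * (n * n) * (x - y * \<delta>) + n"
      unfolding inv of_int_mult of_int_minus t[symmetric] k[symmetric] by (simp add: power2_eq_square algebra_simps)
    also have "\<dots> = 0" unfolding \<open>n * n = 1\<close> by (simp add: n_def power2_eq_square algebra_simps)
    finally show "(inverse u)\<^sup>2 + of_int (- t * k) * inverse u + of_int k = 0" .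
  qed
  moreover have "u \<noteq> 0" using quad_units_nonzero[OF \<open>u \<in> quad_units \<delta>\<close>] .
  moreover have "u \<in> quad_field \<delta>" unfolding xy using xy(1,2) by (rule quad_fieldI)
  ultimately show "u \<in> integer_units (quad_field \<delta>)" by (simp add: integer_units_def)
qed

section \<open>Structure of the unit group\<close>

lemma quad_units_minus: "u \<in> quad_units \<delta> \<Longrightarrow> - u \<in> quad_units \<delta>"
  unfolding quad_units_def by clarify (rule exI[of _ "- _"], rule exI[of _ "- _"], simp)

lemma quad_units_inverse:
  assumes "u \<in> quad_units \<delta>"
  shows "inverse u \<in> quad_units \<delta>"
proof -
  obtain x y where xy: "x \<in> \<rat>" "y \<in> \<rat>" "u = x + y * \<delta>" "2 * x \<in> \<int>" "x\<^sup>2 - y\<^sup>2 * \<delta>\<^sup>2 = 1 \<or> x\<^sup>2 - y\<^sup>2 * \<delta>\<^sup>2 = - 1"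
    using assms unfolding quad_units_def by blast
  have conj: "x + (- y) * \<delta> \<in> quad_units \<delta>" unfolding quad_units_def
    by (intro CollectI exI[of _ x] exI[of _ "- y"] conjI) (use xy in auto)
  then have "inverse u = x + (- y) * \<delta> \<or> inverse u = - (x + (- y) * \<delta>)"
    using quad_units_conj[of x y \<delta>] xy by auto
  then show ?thesis using conj quad_units_minus[OF conj] by auto
qed

lemma quad_units_mult:
  assumes \<delta>: "\<delta>\<^sup>2 = of_int D" and "u \<in> quad_units \<delta>" "v \<in> quad_units \<delta>"
  shows "u * v \<in> quad_units \<delta>"
proof -
  obtain x y where u: "x \<in> \<rat>" "y \<in> \<rat>" "u = x + y * \<delta>" "2 * x \<in> \<int>" "x\<^sup>2 - y\<^sup>2 * \<delta>\<^sup>2 = 1 \<or> x\<^sup>2 - y\<^sup>2 * \<delta>\<^sup>2 = - 1"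
    using assms unfolding quad_units_def by blast
  obtain z w where v: "z \<in> \<rat>" "w \<in> \<rat>" "v = z + w * \<delta>" "2 * z \<in> \<int>" "z\<^sup>2 - w\<^sup>2 * \<delta>\<^sup>2 = 1 \<or> z\<^sup>2 - w\<^sup>2 * \<delta>\<^sup>2 = - 1"
    using assms unfolding quad_units_def by blast
  obtain s t where st: "2 * x = of_int s" "2 * z = of_int t" using u(4) v(4) by (auto elim!: Ints_cases)
  obtain m n :: int where mn: "x\<^sup>2 - y\<^sup>2 * \<delta>\<^sup>2 = of_int m" "z\<^sup>2 - w\<^sup>2 * \<delta>\<^sup>2 = of_int n" "m = 1 \<or> m = - 1" "n = 1 \<or> n = - 1"
    using u(5) v(5) by (metis of_int_1 of_int_minus)
  define p where "p = x * z + y * w * \<delta>\<^sup>2"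
  define q where "q = x * w + y * z"
  have uv: "u * v = p + q * \<delta>" unfolding u v p_def q_def by (simp add: power2_eq_square algebra_simps)
  have norm: "p\<^sup>2 - q\<^sup>2 * \<delta>\<^sup>2 = (x\<^sup>2 - y\<^sup>2 * \<delta>\<^sup>2) * (z\<^sup>2 - w\<^sup>2 * \<delta>\<^sup>2)"
    unfolding p_def q_def by (simp add: power2_eq_square algebra_simps)
  have pq: "p \<in> \<rat>" "q \<in> \<rat>" using u v \<delta> by (auto simp: p_def q_def)
  \<comment> \<open>With conjugates written as primes, \<open>u v + u' v'\<close> and \<open>u v' + u' v\<close> are the roots of a monic integral polynomial.\<close>
  have "(2 * p)\<^sup>2 + of_int (- s * t) * (2 * p) + of_int (s\<^sup>2 * n + t\<^sup>2 * m - 4 * m * n) = 0"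
    unfolding of_int_add of_int_diff of_int_mult of_int_minus of_int_power of_int_numeral st[symmetric] mn(1,2)[symmetric] p_def
    by (simp add: power2_eq_square algebra_simps)
  then have "algebraic_int (2 * p)" by (rule algebraic_int_monic_quadratic)
  then have "2 * p \<in> \<int>" using pq by (intro rational_algebraic_int_is_int) auto
  moreover have "p\<^sup>2 - q\<^sup>2 * \<delta>\<^sup>2 = 1 \<or> p\<^sup>2 - q\<^sup>2 * \<delta>\<^sup>2 = - 1" unfolding norm mn(1,2) using mn(3,4) by auto
  ultimately show ?thesis unfolding uv quad_units_def using pq by blast
qed

text \<open>Pell's equation is solved for the squarefree part a of D = a f^2; y sqrt a is (y / f)
  sqrt D, and a fractional coordinate y / f is permitted.\<close>

lemma ex_quad_unit:
  assumes "D \<ge> 0" "sqrt (of_int D) \<notin> \<rat>"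
  obtains u where "u \<in> quad_units (sqrt (of_int D))" "u > 1"
proof -
  define n where "n = nat D"
  define a where "a = squarefree_part n"
  define f where "f = square_part n"
  have n: "real_of_int D = real n" "n = a * f\<^sup>2" using assms(1) squarefree_decompose[of n] by (simp_all add: n_def a_def f_def)
  have irr: "sqrt (real n) \<notin> \<rat>" using assms(2) by (simp only: n(1) not_False_eq_True)
  have f0: "f > 0" using irr n(2) by (cases "f = 0") auto
  have "a \<noteq> 0" by (simp add: a_def)
  moreover have "a \<noteq> 1" using irr n(2) by (auto simp: real_sqrt_mult)
  ultimately have "a \<ge> 2" by linarith
  moreover have "squarefree a" by (simp add: a_def)
  ultimately obtain x y where xy: "x\<^sup>2 = a * y\<^sup>2 + 1" "y \<ge> 1" using pell_solution_bound by metis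
  define \<delta> where "\<delta> = sqrt (real n)"
  have \<delta>: "\<delta> > 0" "\<delta>\<^sup>2 = real a * (real f)\<^sup>2" using n \<open>a \<ge> 2\<close> f0 by (auto simp: \<delta>_def)
  have "(real x)\<^sup>2 - (real y / real f)\<^sup>2 * \<delta>\<^sup>2 = real (x\<^sup>2) - real (a * y\<^sup>2)"
    using f0 unfolding \<delta>(2) by (simp add: power_divide)
  also have "\<dots> = 1" unfolding xy(1) by simp
  finally have "real x + real y / real f * \<delta> \<in> quad_units \<delta>"
    unfolding quad_units_def by (intro CollectI exI[of _ "real x"] exI[of _ "real y / real f"] conjI) auto
  moreover have "x \<ge> 1" using xy(1) by (cases x) auto
  then have "real x + real y / real f * \<delta> > 1" using xy(2) f0 \<delta>(1) by (intro add_le_less_mono[of 1 "real x" 0, simplified]) auto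
  ultimately show thesis using that unfolding n(1) \<delta>_def by blast
qed

text \<open>The conjugate of a unit above 1 is below 1 in absolute value, so the trace is at most B
  + 1 and the unit is a root of one of finitely many monic quadratics.\<close>

lemma finite_quad_units: "finite {u \<in> quad_units \<delta>. 1 < u \<and> u \<le> B}"
proof (rule finite_subset)
  define m where "m = \<lceil>B + 1\<rceil>"
  have fin: "finite {u :: real. poly [:of_int k, - of_int t, 1:] u = 0}" for t k :: int
    by (rule poly_roots_finite) simp
  show "finite (\<Union>t\<in>{-m..m}. \<Union>k\<in>{-1, 1}. {u :: real. poly [:of_int k, - of_int t, 1:] u = 0})"
    by (intro finite_UN_I fin) auto
  show "{u \<in> quad_units \<delta>. 1 < u \<and> u \<le> B} \<subseteq> (\<Union>t\<in>{-m..m}. \<Union>k\<in>{-1, 1}. {u :: real. poly [:of_int k, - of_int t, 1:] u = 0})"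
  proof
    fix u assume "u \<in> {u \<in> quad_units \<delta>. 1 < u \<and> u \<le> B}"
    then obtain x y where u: "1 < u" "u \<le> B" "u = x + y * \<delta>" "2 * x \<in> \<int>" "x\<^sup>2 - y\<^sup>2 * \<delta>\<^sup>2 = 1 \<or> x\<^sup>2 - y\<^sup>2 * \<delta>\<^sup>2 = - 1"
      unfolding quad_units_def by blast
    obtain t where t: "2 * x = of_int t" using u(4) by (elim Ints_cases)
    obtain k :: int where k: "k \<in> {- 1, 1}" "x\<^sup>2 - y\<^sup>2 * \<delta>\<^sup>2 = of_int k" using u(5) by fastforce
    have "poly [:of_int k, - of_int t, 1:] u = 0"
      unfolding u(3) k(2)[symmetric] t[symmetric] by (simp add: power2_eq_square algebra_simps)
    moreover have "t \<in> {-m..m}"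
    proof -
      have inv: "inverse u = (x\<^sup>2 - y\<^sup>2 * \<delta>\<^sup>2) * (x - y * \<delta>)" unfolding u(3) using quad_units_conj[OF refl u(5)] .
      have "0 < inverse u" "inverse u < 1" using u(1) by (auto simp: inverse_less_1_iff)
      then have "\<bar>x - y * \<delta>\<bar> < 1" using inv u(5) by auto
      moreover have "2 * x = u + (x - y * \<delta>)" using u(3) by simp
      ultimately have "\<bar>of_int t\<bar> \<le> B + 1" using u(1,2) t by linarith
      then show ?thesis unfolding m_def by (simp add: abs_le_iff) linarith
    qed
    ultimately show "u \<in> (\<Union>t\<in>{-m..m}. \<Union>k\<in>{-1, 1}. {u :: real. poly [:of_int k, - of_int t, 1:] u = 0})"
      using k(1) by blast
  qed
qed

lemma ex_least_quad_unit:
  assumes "D \<ge> 0" "sqrt (of_int D) \<notin> \<rat>"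
  obtains u where "u \<in> quad_units (sqrt (of_int D))" "u > 1" "\<And>v. v \<in> quad_units (sqrt (of_int D)) \<Longrightarrow> v > 1 \<Longrightarrow> u \<le> v"
proof -
  define U where "U = quad_units (sqrt (of_int D))"
  obtain w where w: "w \<in> U" "w > 1" using ex_quad_unit[OF assms] by (auto simp: U_def)
  define S where "S = {u \<in> U. 1 < u \<and> u \<le> w}"
  have S: "finite S" "w \<in> S" using finite_quad_units w by (auto simp: S_def U_def)
  have "Min S \<in> S" using S by (intro Min_in) auto
  moreover have "Min S \<le> v" if "v \<in> U" "v > 1" for v
  proof (cases "v \<le> w")
    case True
    then show ?thesis using S(1) that by (intro Min_le) (auto simp: S_def)
  next
    case False
    moreover have "Min S \<le> w" using S by (intro Min_le)
    ultimately show ?thesis by linarith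
  qed
  ultimately show thesis using that[of "Min S"] by (auto simp: S_def U_def)
qed

lemma quad_units_powi:
  assumes "\<delta>\<^sup>2 = of_int D" "u \<in> quad_units \<delta>"
  shows "u powi k \<in> quad_units \<delta>"
proof -
  have one: "1 \<in> quad_units \<delta>"
    unfolding quad_units_def by (intro CollectI exI[of _ 1] exI[of _ 0] conjI) auto
  have "v ^ n \<in> quad_units \<delta>" if "v \<in> quad_units \<delta>" for v n
    by (induction n) (auto intro: one quad_units_mult[OF assms(1) that])
  then show ?thesis using assms(2) quad_units_inverse[OF assms(2)] by (auto simp: power_int_def)
qed

text \<open>Dividing |v| by the largest power of u not exceeding it leaves a unit that is at least 1
  and below u, hence 1 by minimality.\<close>

lemma least_quad_unit_fundamental:
  assumes \<delta>: "\<delta>\<^sup>2 = of_int D" "\<delta> \<notin> \<rat>" and u: "u \<in> quad_units \<delta>" "u > 1"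
    and least: "\<And>v. v \<in> quad_units \<delta> \<Longrightarrow> v > 1 \<Longrightarrow> u \<le> v"
  shows "fundamental_unit (quad_field \<delta>) u"
  unfolding fundamental_unit_def integer_units_quad_field[OF \<delta>]
proof (intro conjI ballI u)
  fix v assume v: "v \<in> quad_units \<delta>"
  define w where "w = \<bar>v\<bar>"
  have w: "w \<in> quad_units \<delta>" "w > 0" using v quad_units_minus[OF v] quad_units_nonzero[OF v] by (auto simp: w_def abs_if)
  have lnu: "ln u > 0" using u(2) by simp
  define k where "k = \<lfloor>ln w / ln u\<rfloor>"
  define z where "z = w * u powi (- k)"
  have z: "z \<in> quad_units \<delta>" unfolding z_def using \<delta> u w by (intro quad_units_mult quad_units_powi)
  have up: "u powi j = exp (of_int j * ln u)" for j
    using powr_real_of_int'[of u j] u(2) by (simp add: powr_def)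
  have zexp: "z = exp (ln w - of_int k * ln u)" using w(2) by (simp add: z_def up exp_diff exp_minus divide_inverse)
  have "of_int k \<le> ln w / ln u" "ln w / ln u < of_int k + 1" by (simp_all add: k_def)
  then have b: "of_int k * ln u \<le> ln w" "ln w < (of_int k + 1) * ln u"
    using lnu by (simp_all add: pos_le_divide_eq pos_divide_less_eq)
  have "z = 1"
  proof (rule ccontr)
    assume "z \<noteq> 1"
    moreover have "z \<ge> 1" using b(1) by (simp add: zexp)
    ultimately have "u \<le> z" using least[OF z] by simp
    moreover have "z < exp (ln u)" unfolding zexp using b(2) by (simp add: algebra_simps)
    ultimately show False using u(2) by simp
  qed
  then have "ln w = of_int k * ln u" by (simp add: zexp)
  then have "w = u powi k" using w(2) up[of k] by (metis exp_ln)
  moreover have "v = w \<or> v = - w" by (auto simp: w_def abs_if)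
  ultimately show "\<exists>k. v = u powi k \<or> v = - (u powi k)" by blast
qed

text \<open>Two fundamental units are powers of each other up to sign, with exponents of product 1;
  so the definite description has a unique solution.\<close>

lemma regulator_eq:
  assumes fund: "fundamental_unit K u" and u: "u > 1"
  shows "regulator K = ln u"
  unfolding regulator_def
proof (rule the_equality)
  show "\<exists>v. fundamental_unit K v \<and> ln u = \<bar>ln \<bar>v\<bar>\<bar>" using assms by (intro exI[of _ u]) auto
next
  fix R assume "\<exists>v. fundamental_unit K v \<and> R = \<bar>ln \<bar>v\<bar>\<bar>"
  then obtain v where v: "fundamental_unit K v" "R = \<bar>ln \<bar>v\<bar>\<bar>" by blast
  obtain k where k: "v = u powi k \<or> v = - (u powi k)" using fund v(1) unfolding fundamental_unit_def by blast
  obtain l where l: "u = v powi l \<or> u = - (v powi l)" using fund v(1) unfolding fundamental_unit_def by blast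
  have lnpow: "ln (x powi j) = of_int j * ln x" if "x > 0" for x :: real and j
    using powr_real_of_int'[of x j] ln_powr[of x "of_int j"] that by simp
  have v0: "v \<noteq> 0" using v(1) by (auto simp: fundamental_unit_def integer_units_def)
  have "\<bar>v\<bar> = u powi k" using k u by auto
  then have 1: "ln \<bar>v\<bar> = of_int k * ln u" using lnpow u by simp
  have "\<bar>u\<bar> = \<bar>v powi l\<bar>" using l by auto
  then have "u = \<bar>v\<bar> powi l" using u by (simp add: power_int_abs)
  then have 2: "ln u = of_int l * ln \<bar>v\<bar>" using lnpow[of "\<bar>v\<bar>" l] v0 by simp
  have lnu: "ln u > 0" using u by simp
  have "ln u = of_int (l * k) * ln u" using 2 unfolding 1 by (simp only: of_int_mult mult.assoc)
  then have "of_int (l * k) = (1 :: real)" using lnu by simp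
  then have "l * k = 1" by (simp only: of_int_eq_1_iff)
  then have "\<bar>k\<bar> = 1" by (auto simp: zmult_eq_1_iff)
  then have "\<bar>real_of_int k\<bar> = 1" by linarith
  then show "R = ln u" unfolding v(2) 1 abs_mult using lnu by simp
qed

text \<open>Squaring removes the norm -1, so that the conjugate becomes the inverse; it doubles each
  logarithm, which turns 36 into 144 in the bound by regulators. Clearing the denominator of 2 q in
  p^2 - q^2 D = 1 gives e and f.\<close>

lemma square_of_quad_unit:
  assumes D: "D \<ge> 0" "sqrt (of_int D) \<notin> \<rat>" and u: "u \<in> quad_units (sqrt (of_int D))" "u > 1"
  obtains t e f :: nat where "u\<^sup>2 + inverse (u\<^sup>2) = real t" "1 \<le> e" "1 \<le> f" "D * (int f)\<^sup>2 = ((int t)\<^sup>2 - 4) * (int e)\<^sup>2"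
proof -
  define \<delta> where "\<delta> = sqrt (of_int D)"
  have \<delta>: "\<delta>\<^sup>2 = of_int D" using D by (simp add: \<delta>_def)
  obtain x y where xy: "x \<in> \<rat>" "y \<in> \<rat>" "u = x + y * \<delta>" "2 * x \<in> \<int>" "x\<^sup>2 - y\<^sup>2 * \<delta>\<^sup>2 = 1 \<or> x\<^sup>2 - y\<^sup>2 * \<delta>\<^sup>2 = - 1"
    using u(1) unfolding quad_units_def \<delta>_def by blast
  define p where "p = x\<^sup>2 + y\<^sup>2 * \<delta>\<^sup>2"
  define q where "q = 2 * x * y"
  have sq: "u\<^sup>2 = p + q * \<delta>" unfolding xy p_def q_def by (simp add: power2_eq_square algebra_simps)
  have "p\<^sup>2 - q\<^sup>2 * \<delta>\<^sup>2 = (x\<^sup>2 - y\<^sup>2 * \<delta>\<^sup>2)\<^sup>2" unfolding p_def q_def by (simp add: power2_eq_square algebra_simps)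
  also have "\<dots> = 1" using xy(5) by auto
  finally have norm: "p\<^sup>2 - q\<^sup>2 * \<delta>\<^sup>2 = 1" .
  have inv: "inverse (u\<^sup>2) = p - q * \<delta>" unfolding sq using quad_units_conj[OF norm] by simp
  have u2: "u\<^sup>2 > 1" using u(2) by simp
  have tr: "u\<^sup>2 + inverse (u\<^sup>2) = 2 * p" using inv sq by linarith
  have "2 * p = (2 * x)\<^sup>2 - 2 * (x\<^sup>2 - y\<^sup>2 * \<delta>\<^sup>2)" unfolding p_def by (simp add: power_mult_distrib)
  moreover have "x\<^sup>2 - y\<^sup>2 * \<delta>\<^sup>2 \<in> \<int>" using xy(5) by auto
  moreover have "(2 * x)\<^sup>2 \<in> \<int>" using xy(4) by (rule Ints_power)
  moreover have "c \<in> \<int>" if "c = a - 2 * b" "a \<in> \<int>" "b \<in> \<int>" for a b c :: real using that by auto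
  ultimately have "2 * p \<in> \<int>" by blast
  then obtain t0 where t0: "2 * p = of_int t0" by (elim Ints_cases)
  have "0 < u\<^sup>2 + inverse (u\<^sup>2)" using u2 positive_imp_inverse_positive[of "u\<^sup>2"] by linarith
  then have t0pos: "t0 > 0" unfolding tr t0 by simp
  have q0: "q \<noteq> 0"
  proof
    assume "q = 0"
    then have "q * \<delta> = 0" by simp
    then have "u\<^sup>2 = inverse (u\<^sup>2)" using inv sq by linarith
    moreover have "inverse (u\<^sup>2) < 1" using u2 by (simp add: inverse_less_1_iff)
    ultimately show False using u2 by simp
  qed
  have "2 * q \<in> \<rat>" using xy by (simp add: q_def)
  then obtain m n :: int where mn: "2 * q = of_int m / of_int n" "n > 0" by (auto elim: Rats_cases')
  have m0: "m \<noteq> 0" using mn q0 by auto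
  have "real_of_int ((t0\<^sup>2 - 4) * n\<^sup>2) = ((2 * p)\<^sup>2 - 4) * (of_int n)\<^sup>2" unfolding t0 by simp
  also have "\<dots> = (2 * q * of_int n)\<^sup>2 * \<delta>\<^sup>2" using norm by (simp add: power_mult_distrib algebra_simps)
  also have "2 * q * of_int n = of_int m" using mn by simp
  also have "(of_int m)\<^sup>2 * \<delta>\<^sup>2 = real_of_int (D * m\<^sup>2)" unfolding \<delta> by simp
  finally have eq: "D * m\<^sup>2 = (t0\<^sup>2 - 4) * n\<^sup>2" by (simp only: of_int_eq_iff)
  show thesis
  proof (rule that[of "nat t0" "nat n" "nat \<bar>m\<bar>"])
    show "u\<^sup>2 + inverse (u\<^sup>2) = real (nat t0)" unfolding tr t0 using t0pos by simp
    show "1 \<le> nat n" "1 \<le> nat \<bar>m\<bar>" using mn m0 by auto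
    show "D * (int (nat \<bar>m\<bar>))\<^sup>2 = ((int (nat t0))\<^sup>2 - 4) * (int (nat n))\<^sup>2" using eq t0pos mn(2) by simp
  qed
qed

section \<open>Bounds for the exponent\<close>

text \<open>Squaring x = - (y sqrt D + z sqrt D') isolates 2 y z sqrt D sqrt D', whence y z = 0 and
  only one irrational remains.\<close>

lemma sqrt_lin_indep:
  fixes D D' :: int
  assumes irr: "sqrt (of_int D) \<notin> \<rat>" "sqrt (of_int D') \<notin> \<rat>" "sqrt (of_int D) * sqrt (of_int D') \<notin> \<rat>"
    and nonneg: "D \<ge> 0" "D' \<ge> 0"
    and rat: "x \<in> \<rat>" "y \<in> \<rat>" "z \<in> \<rat>" and eq: "x + y * sqrt (of_int D) + z * sqrt (of_int D') = 0"
  shows "x = 0 \<and> y = 0 \<and> z = 0"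
proof -
  define \<delta> \<delta>' where "\<delta> = sqrt (of_int D)" and "\<delta>' = sqrt (of_int D')"
  have \<delta>: "\<delta>\<^sup>2 \<in> \<rat>" "\<delta>'\<^sup>2 \<in> \<rat>" using nonneg by (simp_all add: \<delta>_def \<delta>'_def)
  have eq': "x = - (y * \<delta> + z * \<delta>')" using eq unfolding \<delta>_def \<delta>'_def by linarith
  have "x\<^sup>2 = y\<^sup>2 * \<delta>\<^sup>2 + z\<^sup>2 * \<delta>'\<^sup>2 + 2 * y * z * (\<delta> * \<delta>')" unfolding eq' by (simp add: power2_eq_square algebra_simps)
  then have "(y\<^sup>2 * \<delta>\<^sup>2 + z\<^sup>2 * \<delta>'\<^sup>2 - x\<^sup>2) + (2 * y * z) * (\<delta> * \<delta>') = 0" by linarith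
  moreover have "y\<^sup>2 * \<delta>\<^sup>2 + z\<^sup>2 * \<delta>'\<^sup>2 - x\<^sup>2 \<in> \<rat>" "2 * y * z \<in> \<rat>" using rat \<delta> by simp_all
  ultimately have "2 * y * z = 0" using irrational_coordinates_zero irr(3) unfolding \<delta>_def \<delta>'_def by blast
  then consider "y = 0" | "z = 0" by auto
  then show ?thesis
  proof cases
    case 1
    then show ?thesis using irrational_coordinates_zero[OF irr(2) rat(1,3)] eq by simp
  next
    case 2
    then show ?thesis using irrational_coordinates_zero[OF irr(1) rat(1,2)] eq by simp
  qed
qed

lemma quadratic_code_coordinates:
  assumes "quadratic_code (a, b, c) \<xi>"
  shows "\<xi> = - of_int b / (2 * of_int a) + 1 / (2 * of_int a) * sqrt (of_int (b\<^sup>2 - 4 * a * c))"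
    "a \<noteq> 0" "b\<^sup>2 - 4 * a * c \<ge> 0"
  using assms unfolding quadratic_code_def by (simp_all add: diff_divide_distrib)

lemma lin_indep_1_Q_codes:
  assumes codes: "quadratic_code (a, b, c) \<xi>" "quadratic_code (a', b', c') \<zeta>"
    and D: "D = b\<^sup>2 - 4 * a * c" "D' = b'\<^sup>2 - 4 * a' * c'"
    and irr: "sqrt (of_int D) \<notin> \<rat>" "sqrt (of_int D') \<notin> \<rat>" "sqrt (of_int D) * sqrt (of_int D') \<notin> \<rat>"
  shows "lin_indep_1_Q \<xi> \<zeta>"
  unfolding lin_indep_1_Q_def
proof (intro allI impI)
  fix x y z assume rat: "x \<in> \<rat>" "y \<in> \<rat>" "z \<in> \<rat>" and eq: "x + y * \<xi> + z * \<zeta> = 0"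
  note c = quadratic_code_coordinates[OF codes(1), folded D] 
  note c' = quadratic_code_coordinates[OF codes(2), folded D]
  define s s' where "s = sqrt (of_int D)" and "s' = sqrt (of_int D')"
  define p p' where "p = 1 / (2 * real_of_int a)" and "p' = 1 / (2 * real_of_int a')"
  define r r' where "r = - real_of_int b / (2 * real_of_int a)" and "r' = - real_of_int b' / (2 * real_of_int a')"
  have \<xi>: "\<xi> = r + p * s" and \<zeta>: "\<zeta> = r' + p' * s'"
    using c(1) c'(1) by (simp_all only: r_def p_def s_def r'_def p'_def s'_def)
  have "(x + y * r + z * r') + (y * p) * s + (z * p') * s' = 0"
    using eq unfolding \<xi> \<zeta> by (simp add: algebra_simps)
  moreover have "x + y * r + z * r' \<in> \<rat>" "y * p \<in> \<rat>" "z * p' \<in> \<rat>"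
    using rat unfolding r_def r'_def p_def p'_def by simp_all
  ultimately have "x + y * r + z * r' = 0 \<and> y * p = 0 \<and> z * p' = 0"
    using sqrt_lin_indep[OF irr c(3) c'(3)] unfolding s_def s'_def by blast
  moreover have "p \<noteq> 0" "p' \<noteq> 0" using c(2) c'(2) by (simp_all add: p_def p'_def)
  ultimately show "x = 0 \<and> y = 0 \<and> z = 0" by auto
qed

lemma adjoin_Q_code:
  assumes "quadratic_code (a, b, c) \<xi>" "D = b\<^sup>2 - 4 * a * c" "sqrt (of_int D) \<notin> \<rat>"
  shows "adjoin_Q \<xi> = quad_field (sqrt (of_int D))"
proof (rule adjoin_Q_eq_quad_field)
  note c = quadratic_code_coordinates[OF assms(1), folded assms(2)]
  show "sqrt (of_int D) * sqrt (of_int D) \<in> \<rat>" using c(3) by simp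
  show "sqrt (of_int D) \<notin> \<rat>" by (rule assms(3))
  show "\<xi> = - of_int b / (2 * of_int a) + 1 / (2 * of_int a) * sqrt (of_int D)" by (rule c(1))
  show "1 / (2 * real_of_int a) \<noteq> 0" using c(2) by simp
qed simp_all

text \<open>A rational product makes each root a rational multiple of the other. Distinct fields
  thus supply the irrational product on which independence rests.\<close>

lemma quad_field_sqrt_eq:
  fixes D D' :: int
  assumes "D \<ge> 0" "D' \<ge> 0" "sqrt (of_int D) \<notin> \<rat>" "sqrt (of_int D') \<notin> \<rat>" "sqrt (of_int D) * sqrt (of_int D') \<in> \<rat>"
  shows "quad_field (sqrt (of_int D)) = quad_field (sqrt (of_int D'))"
proof -
  define s s' where "s = sqrt (of_int D)" and "s' = sqrt (of_int D')"
  have s: "s * s = of_int D" "s' * s' = of_int D'" using assms(1,2) by (simp_all add: s_def s'_def)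
  have nz: "s \<noteq> 0" "s' \<noteq> 0" using assms(3,4) unfolding s_def s'_def by (metis Rats_0)+
  have "D \<noteq> 0" using s nz by auto
  then have eq: "s' = 0 + (s * s' / of_int D) * s" using s(1) by (simp add: mult.commute mult.left_commute)
  have "s' = 0 + 1 * s'" by simp
  then have "adjoin_Q s' = quad_field s'" using adjoin_Q_eq_quad_field[of s' s' 0 1] s assms(4) by (simp add: s'_def[symmetric])
  moreover have "adjoin_Q s' = quad_field s"
  proof (rule adjoin_Q_eq_quad_field)
    show "s' = 0 + (s * s' / of_int D) * s" by (rule eq)
    show "s * s' / of_int D \<in> \<rat>" using assms(5) unfolding s_def s'_def by (intro Rats_divide) auto
    show "s * s' / of_int D \<noteq> 0" using nz \<open>D \<noteq> 0\<close> by simp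
    show "s \<notin> \<rat>" using assms(3) by (simp only: s_def not_False_eq_True)
    show "s * s \<in> \<rat>" unfolding s by simp
  qed simp
  ultimately show ?thesis by (simp add: s_def s'_def)
qed

lemma computable_real_of_nat: "computable_real (real c)"
  unfolding computable_real_def computable_family_def
proof (intro exI conjI allI)
  show "recursive (\<lambda>n. 2 * (c * Suc (snd (prod_decode n))))"
    by (intro recursive_mult recursive_const recursive_Suc recursive_snd recursive_id)
  fix x k
  have "real_of_int (int_decode (2 * (c * Suc (snd (prod_decode (prod_encode (x, k))))))) = real c * (real k + 1)"
    unfolding int_decode_double by (simp add: algebra_simps)
  then show "\<bar>real c - real_of_int (int_decode (2 * (c * Suc (snd (prod_decode (prod_encode (x, k))))))) / (real k + 1)\<bar> \<le> 1 / (real k + 1)"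
    by simp
qed

lemma regulator_unit:
  assumes "quadratic_code (a, b, c) \<xi>" "D = b\<^sup>2 - 4 * a * c" "sqrt (of_int D) \<notin> \<rat>"
  obtains u t e f where "1 < u\<^sup>2" "ln (u\<^sup>2) = 2 * regulator (adjoin_Q \<xi>)" "u\<^sup>2 + inverse (u\<^sup>2) = real t" "1 \<le> e" "1 \<le> f"
    "D * (int f)\<^sup>2 = ((int t)\<^sup>2 - 4) * (int e)\<^sup>2"
proof -
  have D0: "D \<ge> 0" using quadratic_code_coordinates(3)[OF assms(1)] assms(2) by simp
  obtain u where u: "u \<in> quad_units (sqrt (of_int D))" "u > 1" "\<And>v. v \<in> quad_units (sqrt (of_int D)) \<Longrightarrow> v > 1 \<Longrightarrow> u \<le> v"
    using ex_least_quad_unit[OF D0 assms(3)] by blast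
  have "fundamental_unit (quad_field (sqrt (of_int D))) u"
    using least_quad_unit_fundamental[OF _ assms(3) u] D0 by simp
  then have "regulator (adjoin_Q \<xi>) = ln u" unfolding adjoin_Q_code[OF assms] using u(2) by (rule regulator_eq)
  then have "ln (u\<^sup>2) = 2 * regulator (adjoin_Q \<xi>)" using u(2) by (simp add: ln_realpow)
  moreover have "1 < u\<^sup>2" using u(2) by simp
  ultimately show thesis using square_of_quad_unit[OF D0 assms(3) u(1,2)] that by metis
qed

lemma mu_eff_le_regulators:
  assumes "quadratic_number \<xi>" "quadratic_number \<zeta>" "adjoin_Q \<xi> \<noteq> adjoin_Q \<zeta>"
  shows "mu_eff certified_constant \<xi> \<zeta> \<le>
    ereal (2 - inverse (real (144 * exponent_const) * regulator (adjoin_Q \<xi>) * regulator (adjoin_Q \<zeta>)))"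
proof -
  obtain a b c where code: "quadratic_code (a, b, c) \<xi>" "sqrt (of_int (b\<^sup>2 - 4 * a * c)) \<notin> \<rat>"
    using quadratic_number_code[OF assms(1)] .
  obtain a' b' c' where code': "quadratic_code (a', b', c') \<zeta>" "sqrt (of_int (b'\<^sup>2 - 4 * a' * c')) \<notin> \<rat>"
    using quadratic_number_code[OF assms(2)] .
  have "sqrt (of_int (b\<^sup>2 - 4 * a * c)) * sqrt (of_int (b'\<^sup>2 - 4 * a' * c')) \<notin> \<rat>"
    using quad_field_sqrt_eq[OF quadratic_code_coordinates(3)[OF code(1)] quadratic_code_coordinates(3)[OF code'(1)] code(2) code'(2)]
      adjoin_Q_code[OF code(1) refl code(2)] adjoin_Q_code[OF code'(1) refl code'(2)] assms(3) by argo
  then have indep: "lin_indep_1_Q \<xi> \<zeta>" using lin_indep_1_Q_codes[OF code(1) code'(1) refl refl code(2) code'(2)] by blast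
  obtain u t e f where u: "1 < u\<^sup>2" "ln (u\<^sup>2) = 2 * regulator (adjoin_Q \<xi>)" "u\<^sup>2 + inverse (u\<^sup>2) = real t" "1 \<le> e" "1 \<le> f"
    "(b\<^sup>2 - 4 * a * c) * (int f)\<^sup>2 = ((int t)\<^sup>2 - 4) * (int e)\<^sup>2"
    using regulator_unit[OF code(1) refl code(2)] .
  obtain u' t' e' f' where u': "1 < u'\<^sup>2" "ln (u'\<^sup>2) = 2 * regulator (adjoin_Q \<zeta>)" "u'\<^sup>2 + inverse (u'\<^sup>2) = real t'" "1 \<le> e'" "1 \<le> f'"
    "(b'\<^sup>2 - 4 * a' * c') * (int f')\<^sup>2 = ((int t')\<^sup>2 - 4) * (int e')\<^sup>2"
    using regulator_unit[OF code'(1) refl code'(2)] .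
  have "36 * real exponent_const * (2 * regulator (adjoin_Q \<xi>)) * (2 * regulator (adjoin_Q \<zeta>)) =
      real (144 * exponent_const) * regulator (adjoin_Q \<xi>) * regulator (adjoin_Q \<zeta>)" by simp
  then show ?thesis using mu_eff_le[OF indep code(1) code'(1) u(1,3-6) u'(1,3-6)] unfolding u(2) u'(2) by metis
qed

text \<open>A Pell solution for the squarefree part already has norm 1, so it is not squared, and
  its bound only grows on passing to a. The 4 comes from the discriminant 4 a of X^2 - a.\<close>

lemma sqrt_unit:
  assumes "\<not> is_square (a :: nat)"
  obtains \<epsilon> t e f where "1 < \<epsilon>" "ln \<epsilon> \<le> 300 * sqrt (real a) * ln (real a)" "\<epsilon> + inverse \<epsilon> = real t" "1 \<le> e" "1 \<le> f"
    "4 * int a * (int f)\<^sup>2 = ((int t)\<^sup>2 - 4) * (int e)\<^sup>2"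
proof -
  define a0 where "a0 = squarefree_part a"
  define f0 where "f0 = square_part a"
  have a: "a = a0 * f0\<^sup>2" using squarefree_decompose[of a] by (simp add: a0_def f0_def)
  have "f0 \<noteq> 0"
  proof
    assume "f0 = 0"
    then have "a = 0\<^sup>2" using a by simp
    then show False using assms by (metis is_nth_power_nth_power)
  qed
  then have f0: "f0 \<ge> 1" by simp
  have "a0 \<noteq> 0" by (simp add: a0_def)
  moreover have "a0 \<noteq> 1" using a assms by (auto simp: is_nth_power_def)
  ultimately have a2: "a0 \<ge> 2" by linarith
  have "squarefree a0" by (simp add: a0_def)
  then obtain x y where xy: "x\<^sup>2 = a0 * y\<^sup>2 + 1" "y \<ge> 1" "ln (real x + real y * sqrt (real a0)) \<le> 300 * sqrt (real a0) * ln (real a0)"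
    using pell_solution_bound a2 by metis
  define \<epsilon> where "\<epsilon> = real x + real y * sqrt (real a0)"
  have x1: "x \<ge> 1" using xy(1) by (cases x) auto
  have s: "sqrt (real a0) > 0" using a2 by simp
  have "real y * sqrt (real a0) > 0" using xy(2) s by simp
  then have 1: "1 < \<epsilon>" using x1 unfolding \<epsilon>_def by linarith
  have "\<epsilon> * (real x - real y * sqrt (real a0)) = real (x\<^sup>2) - real (a0 * y\<^sup>2)"
    unfolding \<epsilon>_def by (simp add: algebra_simps power2_eq_square)
  also have "\<dots> = 1" unfolding xy(1) by simp
  finally have "inverse \<epsilon> = real x - real y * sqrt (real a0)" by (rule inverse_unique)
  then have tr: "\<epsilon> + inverse \<epsilon> = real (2 * x)" unfolding \<epsilon>_def by simp
  have "a0 * 1 \<le> a" unfolding a using f0 by (intro mult_left_mono) auto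
  then have "a0 \<le> a" by simp
  then have "sqrt (real a0) * ln (real a0) \<le> sqrt (real a) * ln (real a)" using a2 by (intro mult_mono) auto
  then have 2: "ln \<epsilon> \<le> 300 * sqrt (real a) * ln (real a)" using xy(3) unfolding \<epsilon>_def by linarith
  have "int (x\<^sup>2) = int (a0 * y\<^sup>2 + 1)" unfolding xy(1) ..
  then have "(int (2 * x))\<^sup>2 - 4 = 4 * int a0 * (int y)\<^sup>2" by (simp add: power_mult_distrib)
  then have "4 * int a * (int y)\<^sup>2 = ((int (2 * x))\<^sup>2 - 4) * (int f0)\<^sup>2" unfolding a by simp
  then show thesis using that 1 2 tr f0 xy(2) by blast
qed

lemma quadratic_code_sqrt: "quadratic_code (1, 0, - int a) (sqrt (real a))"
  unfolding quadratic_code_def by (simp add: real_sqrt_mult)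

lemma sqrt_discriminant: "sqrt (real_of_int (0\<^sup>2 - 4 * 1 * - int a)) = 2 * sqrt (real a)"
  by (simp add: real_sqrt_mult)

lemma two_mult_Rats_iff: "2 * x \<in> \<rat> \<longleftrightarrow> x \<in> \<rat>" for x :: real
  using Rats_divide[of "2 * x" 2] by auto

text \<open>The Pell units enter directly rather than through regulators; 3240000 is 36 times 300
  squared.\<close>

lemma mu_eff_le_sqrt:
  assumes "\<not> is_square a" "\<not> is_square b" "\<not> is_square (a * b)"
  shows "mu_eff certified_constant (sqrt (real a)) (sqrt (real b)) \<le>
    ereal (2 - inverse (real (3240000 * exponent_const) * sqrt (real (a * b)) * ln (real a) * ln (real b)))"
proof -
  obtain \<epsilon> t e f where u: "1 < \<epsilon>" "ln \<epsilon> \<le> 300 * sqrt (real a) * ln (real a)" "\<epsilon> + inverse \<epsilon> = real t" "1 \<le> e" "1 \<le> f"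
    "4 * int a * (int f)\<^sup>2 = ((int t)\<^sup>2 - 4) * (int e)\<^sup>2"
    using sqrt_unit[OF assms(1)] .
  obtain \<eta> t' e' f' where u': "1 < \<eta>" "ln \<eta> \<le> 300 * sqrt (real b) * ln (real b)" "\<eta> + inverse \<eta> = real t'" "1 \<le> e'" "1 \<le> f'"
    "4 * int b * (int f')\<^sup>2 = ((int t')\<^sup>2 - 4) * (int e')\<^sup>2"
    using sqrt_unit[OF assms(2)] .
  have ab: "2 * sqrt (real a) * (2 * sqrt (real b)) = 2 * (2 * sqrt (real (a * b)))" by (simp add: real_sqrt_mult)
  have indep: "lin_indep_1_Q (sqrt (real a)) (sqrt (real b))"
    by (rule lin_indep_1_Q_codes[OF quadratic_code_sqrt quadratic_code_sqrt refl refl];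
        unfold sqrt_discriminant ab two_mult_Rats_iff) (use assms sqrt_rat_imp_square in blast)+
  have D: "(0\<^sup>2 - 4 * 1 * - int a) * (int f)\<^sup>2 = ((int t)\<^sup>2 - 4) * (int e)\<^sup>2"
    "(0\<^sup>2 - 4 * 1 * - int b) * (int f')\<^sup>2 = ((int t')\<^sup>2 - 4) * (int e')\<^sup>2" using u(6) u'(6) by simp_all
  let ?P = "36 * real exponent_const * ln \<epsilon> * ln \<eta>"
  let ?Q = "real (3240000 * exponent_const) * sqrt (real (a * b)) * ln (real a) * ln (real b)"
  have le: "mu_eff certified_constant (sqrt (real a)) (sqrt (real b)) \<le> ereal (2 - inverse ?P)"
    by (rule mu_eff_le[OF indep quadratic_code_sqrt quadratic_code_sqrt u(1,3-5) D(1) u'(1,3-5) D(2)])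
  have "ln \<epsilon> > 0" "ln \<eta> > 0" using u(1) u'(1) by simp_all
  then have P0: "?P > 0" using exponent_const_pos by simp
  have "ln \<epsilon> * ln \<eta> \<le> (300 * sqrt (real a) * ln (real a)) * (300 * sqrt (real b) * ln (real b))"
    using u(2) u'(2) \<open>ln \<epsilon> > 0\<close> \<open>ln \<eta> > 0\<close> by (intro mult_mono) auto
  then have "36 * real exponent_const * (ln \<epsilon> * ln \<eta>) \<le>
      36 * real exponent_const * ((300 * sqrt (real a) * ln (real a)) * (300 * sqrt (real b) * ln (real b)))"
    by (intro mult_left_mono) auto
  also have "\<dots> = ?Q" by (simp add: real_sqrt_mult)
  finally have "?P \<le> ?Q" by (simp only: mult.assoc)
  then have "inverse ?Q \<le> inverse ?P" using P0 by (rule le_imp_inverse_le)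
  then have "ereal (2 - inverse ?P) \<le> ereal (2 - inverse ?Q)" unfolding ereal_less_eq by (rule diff_left_mono)
  with le show ?thesis by (rule order_trans)
qed

theorem theorem1p1:
  shows "\<exists>C. effective_constants C \<and>
    (\<exists>c1 :: real. c1 > 0 \<and> computable_real c1 \<and>
      (\<forall>\<xi> \<zeta> :: real. quadratic_number \<xi> \<longrightarrow> quadratic_number \<zeta> \<longrightarrow> adjoin_Q \<xi> \<noteq> adjoin_Q \<zeta> \<longrightarrow>
         mu_eff C \<xi> \<zeta> \<le>
           ereal (2 - inverse (c1 * regulator (adjoin_Q \<xi>) * regulator (adjoin_Q \<zeta>))))) \<and>
    (\<exists>c2 :: real. c2 > 0 \<and> computable_real c2 \<and>
      (\<forall>a b :: nat. a > 0 \<longrightarrow> b > 0 \<longrightarrow>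
         \<not> is_square a \<longrightarrow> \<not> is_square b \<longrightarrow> \<not> is_square (a * b) \<longrightarrow>
         mu_eff C (sqrt (real a)) (sqrt (real b)) \<le>
           ereal (2 - inverse (c2 * sqrt (real (a * b)) * ln (real a) * ln (real b)))))"
proof (intro exI[of _ certified_constant] conjI)
  show "effective_constants certified_constant" by (rule effective_certified_constant)
  show "\<exists>c1 :: real. c1 > 0 \<and> computable_real c1 \<and>
      (\<forall>\<xi> \<zeta> :: real. quadratic_number \<xi> \<longrightarrow> quadratic_number \<zeta> \<longrightarrow> adjoin_Q \<xi> \<noteq> adjoin_Q \<zeta> \<longrightarrow>
         mu_eff certified_constant \<xi> \<zeta> \<le>
           ereal (2 - inverse (c1 * regulator (adjoin_Q \<xi>) * regulator (adjoin_Q \<zeta>))))"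
  proof (intro exI[of _ "real (144 * exponent_const)"] conjI allI impI)
    show "0 < real (144 * exponent_const)" using exponent_const_pos by simp
  qed (use computable_real_of_nat mu_eff_le_regulators in blast)+
  show "\<exists>c2 :: real. c2 > 0 \<and> computable_real c2 \<and>
      (\<forall>a b :: nat. a > 0 \<longrightarrow> b > 0 \<longrightarrow>
         \<not> is_square a \<longrightarrow> \<not> is_square b \<longrightarrow> \<not> is_square (a * b) \<longrightarrow>
         mu_eff certified_constant (sqrt (real a)) (sqrt (real b)) \<le>
           ereal (2 - inverse (c2 * sqrt (real (a * b)) * ln (real a) * ln (real b))))"
  proof (intro exI[of _ "real (3240000 * exponent_const)"] conjI allI impI)
    show "0 < real (3240000 * exponent_const)" using exponent_const_pos by simp
  qed (use computable_real_of_nat mu_eff_le_sqrt in blast)+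
qed

end
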